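(* Let $\mu$ be a probability measure on $\mathbb{R}$. Then $\mu\in I_s^{\boxplus}$ if and only if there is $\sigma\in I_{r+}^{\boxplus}$ such that $$\mathcal{C}_{\mu}^{\boxplus}(z)=\mathcal{C}_{\sigma}^{\boxplus}(z^{2}),\qquad z\in\mathbb{C}\setminus\mathbb{R}.$$ Moreover, in this case the Lévy measures $\nu_\mu$ and $\nu_\sigma$ are related by $$\nu_{\mu}=\tfrac12\left(\nu_{\sigma}^{(1/2)+}+\nu_{\sigma}^{(1/2)-}\right)\qquad\text{and}\qquad \nu_{\sigma}=2\,(\nu_{\mu}|_{(0,\infty)})^{(2)}.$$
   Context: For a probability measure $\mu$ on $\mathbb{R}$, $G_\mu(z)=\int_{\mathbb{R}}\frac{1}{z-x}\mu(\mathrm{d}x)$ for $z\in\mathbb{C}^+$ (upper half-plane), $F_\mu=1/G_\mu$, and $F_\mu^{-1}$ is the right inverse of $F_\mu$, defined on some region $\Gamma_{\eta,M}=\{z:|\mathrm{Re}\,z|<\eta\,\mathrm{Im}\,z,\ \mathrm{Im}\,z>M\}$. The free cumulant transform is $\mathcal{C}_\mu^{\boxplus}(z)=zF_\mu^{-1}(z^{-1})-1$ for $z^{-1}\in\Gamma_{\eta,M}$. The free additive convolution $\mu_1\boxplus\mu_2$ is the probability measure with $\mathcal{C}_{\mu_1\boxplus\mu_2}^{\boxplus}=\mathcal{C}_{\mu_1}^{\boxplus}+\mathcal{C}_{\mu_2}^{\boxplus}$ on a common domain. $\mu$ is free infinitely divisible ($\mu\in I^{\boxplus}$) if for every $n\in\mathbb{N}$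 it is the $n$-fold $\boxplus$-convolution of some probability measure. Equivalently (free Lévy–Khintchine formula), $\mathcal{C}^{\boxplus}_\mu$ extends to the lower half-plane $\mathbb{C}^-$ as $$\mathcal{C}_\mu^{\boxplus}(z)=b_\mu z+a_\mu z^2+\int_{\mathbb{R}}\Big(\frac{1}{1-zx}-1-zx1_{[-1,1]}(x)\Big)\nu_\mu(\mathrm{d}x),$$ with $b_\mu\in\mathbb{R}$, $a_\mu\ge0$ and $\nu_\mu$ (the Lévy measure) satisfying $\nu_\mu(\{0\})=0$, $\int_{\mathbb{R}}\min(1,x^2)\nu_\mu(\mathrm{d}x)<\infty$; the triplet $(a_\mu,\nu_\mu,b_\mu)$ is unique. The same formula defines $\mathcal{C}_\mu^{\boxplus}$ on $\mathbb{C}\setminus\mathbb{R}$. $I_s^{\boxplus}$ is the set of symmetric ($\mu(B)=\mu(-B)$) measures in $I^{\boxplus}$. $I_{r+}^{\boxplus}$ is the set of free regular measures: those $\sigma\in I^{\boxplus}$ with $$\mathcal{C}_\sigma^{\boxplus}(z)=b_\sigma z+\int_{\mathbb{R}_+}\Big(\frac{1}{1-zx}-1\Big)\nu_\sigma(\mathrm{d}x),$$ where $\mathbb{R}_+=[0,\infty)$, $b_\sigma\ge0$, $\nu_\sigma((-\infty,0])=0$ and $\int_0^\infty\min(1,x)\nu_\sigma(\mathrm{d}x)<\infty$; for such $\sigma$ this formula defines $\mathcal{C}_\sigma^{\boxplus}$ on $\mathbb{C}\setminus\mathbb{R}_+$. For a measure $\nu$ on $(0,\infty)$, $\nu^{(1/2)+}$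 is its image on $(0,\infty)$ under $x\mapsto\sqrt{x}$, $\nu^{(1/2)-}$ is its image on $(-\infty,0)$ under $x\mapsto-\sqrt{x}$, and $\nu^{(2)}$ is its image under $x\mapsto x^2$. *)

theory Defs
  imports "HOL-Probability.Probability"
begin

section \<open>Free cumulant transform\<close>

definition cauchy_transform :: "real measure \<Rightarrow> complex \<Rightarrow> complex" where
  "cauchy_transform \<mu> z = (LINT x|\<mu>. 1 / (z - complex_of_real x))"

definition recip_cauchy_transform :: "real measure \<Rightarrow> complex \<Rightarrow> complex" where
  "recip_cauchy_transform \<mu> z = 1 / cauchy_transform \<mu> z"

definition trunc_cone :: "real \<Rightarrow> real \<Rightarrow> complex set" where
  "trunc_cone \<eta> M = {z. \<bar>Re z\<bar> < \<eta> * Im z \<and> Im z > M}"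

text \<open>
  The map \<open>F = recip_cauchy_transform \<mu>\<close> is in general not injective on the upper half-plane,
  and it can have several holomorphic right inverses on the same cone: for \<open>F z = z - 1 / z\<close>, one
  behaves like \<open>w\<close> and another like \<open>- 1 / w\<close> at infinity. The right inverse
  used to define the free cumulant transform is the one asymptotic to the identity; this
  condition makes it unique.
\<close>

definition right_inverse_on_cone ::
    "real measure \<Rightarrow> real \<Rightarrow> real \<Rightarrow> (complex \<Rightarrow> complex) \<Rightarrow> bool" where
  "right_inverse_on_cone \<mu> \<eta> M g \<longleftrightarrow>
     \<eta> > 0 \<and> M > 0 \<and> g holomorphic_on trunc_cone \<eta> M \<and>
     (\<forall>w\<in>trunc_cone \<eta> M. Im (g w) > 0 \<and> recip_cauchy_transform \<mu> (g w) = w) \<and>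
     ((\<lambda>w. g w / w) \<longlongrightarrow> 1) (inf at_infinity (principal (trunc_cone \<eta> M)))"

definition invertible_on_cone :: "real measure \<Rightarrow> real \<Rightarrow> real \<Rightarrow> bool" where
  "invertible_on_cone \<mu> \<eta> M \<longleftrightarrow> (\<exists>g. right_inverse_on_cone \<mu> \<eta> M g)"

text \<open>
  Two right inverses as above agree where their cones intersect, so the value at \<open>w\<close> does not
  depend on the cone. It is only meaningful if \<open>w\<close> lies in a cone on which a right inverse exists.
\<close>

definition recip_cauchy_inverse :: "real measure \<Rightarrow> complex \<Rightarrow> complex" where
  "recip_cauchy_inverse \<mu> w =
     (THE u. \<exists>\<eta> M g. right_inverse_on_cone \<mu> \<eta> M g \<and> w \<in> trunc_cone \<eta> M \<and> u = g w)"

definition free_cumulant :: "real measure \<Rightarrow> complex \<Rightarrow> complex" where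
  "free_cumulant \<mu> z = z * recip_cauchy_inverse \<mu> (1 / z) - 1"

section \<open>Free convolution and free infinite divisibility\<close>

text \<open>
  The free additive convolution always exists and is determined by its two arguments; it is
  given here by its graph.
\<close>

definition is_free_convolution :: "real measure \<Rightarrow> real measure \<Rightarrow> real measure \<Rightarrow> bool" where
  "is_free_convolution \<mu>\<^sub>1 \<mu>\<^sub>2 \<mu> \<longleftrightarrow>
     real_distribution \<mu>\<^sub>1 \<and> real_distribution \<mu>\<^sub>2 \<and> real_distribution \<mu> \<and>
     (\<exists>\<eta> M. invertible_on_cone \<mu>\<^sub>1 \<eta> M \<and> invertible_on_cone \<mu>\<^sub>2 \<eta> M \<and> invertible_on_cone \<mu> \<eta> M \<and>
        (\<forall>z. 1 / z \<in> trunc_cone \<eta> M \<longrightarrow>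
           free_cumulant \<mu> z = free_cumulant \<mu>\<^sub>1 z + free_cumulant \<mu>\<^sub>2 z))"

inductive is_free_convolution_power :: "real measure \<Rightarrow> nat \<Rightarrow> real measure \<Rightarrow> bool"
  for \<rho> :: "real measure" where
  one: "real_distribution \<rho> \<Longrightarrow> is_free_convolution_power \<rho> 1 \<rho>"
| step: "is_free_convolution_power \<rho> n \<tau> \<Longrightarrow> is_free_convolution \<tau> \<rho> \<mu> \<Longrightarrow>
         is_free_convolution_power \<rho> (Suc n) \<mu>"

definition free_inf_divisible :: "real measure set" where
  "free_inf_divisible =
     {\<mu>. real_distribution \<mu> \<and>
         (\<forall>n\<ge>1. \<exists>\<rho>. real_distribution \<rho> \<and> is_free_convolution_power \<rho> n \<mu>)}"

definition free_inf_divisible_symmetric :: "real measure set" where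
  "free_inf_divisible_symmetric =
     {\<mu> \<in> free_inf_divisible. \<forall>B\<in>sets borel. measure \<mu> B = measure \<mu> (uminus ` B)}"

section \<open>Free L\'evy--Khintchine representation\<close>

definition levy_khintchine :: "real \<Rightarrow> real measure \<Rightarrow> real \<Rightarrow> complex \<Rightarrow> complex" where
  "levy_khintchine a \<nu> b z =
     complex_of_real b * z + complex_of_real a * z\<^sup>2 +
     (LINT x|\<nu>. 1 / (1 - z * complex_of_real x) - 1
                - z * complex_of_real x * complex_of_real (indicat_real {-1..1} x))"

text \<open>
  Agreement on the reciprocals of a truncated cone is equivalent to the right-hand side being the
  analytic continuation of the free cumulant transform to the lower half-plane.
\<close>

definition free_triplet :: "real measure \<Rightarrow> real \<Rightarrow> real measure \<Rightarrow> real \<Rightarrow> bool" where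
  "free_triplet \<mu> a \<nu> b \<longleftrightarrow>
     a \<ge> 0 \<and> sets \<nu> = sets borel \<and> emeasure \<nu> {0} = 0 \<and>
     (\<integral>\<^sup>+x. ennreal (min 1 (x\<^sup>2)) \<partial>\<nu>) < \<infinity> \<and>
     (\<exists>\<eta> M. invertible_on_cone \<mu> \<eta> M \<and>
        (\<forall>z. 1 / z \<in> trunc_cone \<eta> M \<longrightarrow> free_cumulant \<mu> z = levy_khintchine a \<nu> b z))"

definition free_levy_measure :: "real measure \<Rightarrow> real measure" where
  "free_levy_measure \<mu> = (THE \<nu>. \<exists>a b. free_triplet \<mu> a \<nu> b)"

definition levy_khintchine_regular :: "real measure \<Rightarrow> real \<Rightarrow> complex \<Rightarrow> complex" where
  "levy_khintchine_regular \<nu> b z =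
     complex_of_real b * z + (LINT x:{0..}|\<nu>. 1 / (1 - z * complex_of_real x) - 1)"

text \<open>
  The measure \<open>\<nu>\<close> below is also the one in the triplet; only the linear coefficient changes, the
  two differing by the integral of \<open>x\<close> over \<open>(0, 1]\<close>.
\<close>

definition free_regular_pair :: "real measure \<Rightarrow> real measure \<Rightarrow> real \<Rightarrow> bool" where
  "free_regular_pair \<sigma> \<nu> b \<longleftrightarrow>
     b \<ge> 0 \<and> sets \<nu> = sets borel \<and> emeasure \<nu> {..0} = 0 \<and>
     (\<integral>\<^sup>+x\<in>{0..}. ennreal (min 1 x) \<partial>\<nu>) < \<infinity> \<and>
     (\<exists>\<eta> M. invertible_on_cone \<sigma> \<eta> M \<and>
        (\<forall>z. 1 / z \<in> trunc_cone \<eta> M \<longrightarrow> free_cumulant \<sigma> z = levy_khintchine_regular \<nu> b z))"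

definition free_regular :: "real measure set" where
  "free_regular = {\<sigma> \<in> free_inf_divisible. \<exists>\<nu> b. free_regular_pair \<sigma> \<nu> b}"

section \<open>Extensions of the free cumulant transform\<close>

text \<open>
  \<open>1 / z\<close> in a cone forces \<open>z\<close> to be in the lower half-plane, so the continuation to the upper
  half-plane is fixed by reflection. For a freely infinitely divisible measure the extension is
  given off the real axis by the L\'evy--Khintchine formula, which commutes with conjugation. The
  definition makes sense without assuming that \<open>\<mu>\<close> is infinitely divisible.
\<close>

definition free_cumulant_extension :: "real measure \<Rightarrow> (complex \<Rightarrow> complex) \<Rightarrow> bool" where
  "free_cumulant_extension \<mu> f \<longleftrightarrow>
     f holomorphic_on (- \<real>) \<and> (\<forall>z\<in>- \<real>. f (cnj z) = cnj (f z)) \<and>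
     (\<exists>\<eta> M. invertible_on_cone \<mu> \<eta> M \<and>
        (\<forall>z. 1 / z \<in> trunc_cone \<eta> M \<longrightarrow> f z = free_cumulant \<mu> z))"

definition free_cumulant_extends :: "real measure \<Rightarrow> bool" where
  "free_cumulant_extends \<mu> \<longleftrightarrow> (\<exists>f. free_cumulant_extension \<mu> f)"

text \<open>Meaningful for \<open>z\<close> off the real axis, where all extensions agree.\<close>

definition free_cumulant_ext :: "real measure \<Rightarrow> complex \<Rightarrow> complex" where
  "free_cumulant_ext \<mu> z = (THE u. \<exists>f. free_cumulant_extension \<mu> f \<and> u = f z)"

text \<open>Meaningful for free regular \<open>\<sigma>\<close> and \<open>z\<close> off the nonnegative real axis.\<close>

definition free_cumulant_regular :: "real measure \<Rightarrow> complex \<Rightarrow> complex" where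
  "free_cumulant_regular \<sigma> z =
     (THE u. \<exists>\<nu> b. free_regular_pair \<sigma> \<nu> b \<and> u = levy_khintchine_regular \<nu> b z)"

section \<open>Image measures\<close>

text \<open>
  Measures on \<open>(0, \<infinity>)\<close> are represented by Borel measures on the real line, restricted to
  \<open>{0<..}\<close> before taking images.
\<close>

definition sqrt_image_pos :: "real measure \<Rightarrow> real measure" where
  "sqrt_image_pos \<nu> = distr (restrict_space \<nu> {0<..}) borel sqrt"

definition sqrt_image_neg :: "real measure \<Rightarrow> real measure" where
  "sqrt_image_neg \<nu> = distr (restrict_space \<nu> {0<..}) borel (\<lambda>x. - sqrt x)"

definition square_image_pos :: "real measure \<Rightarrow> real measure" where
  "square_image_pos \<nu> = distr (restrict_space \<nu> {0<..}) borel (\<lambda>x. x\<^sup>2)"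

end

theory Submission
  imports Defs "HOL-Complex_Analysis.Complex_Analysis"
begin

text \<open>
  Write \<open>F\<close> for the reciprocal Cauchy transform of \<open>\<mu>\<close> and \<open>H w = F\<^sup>-\<^sup>1 w - w\<close>. Then \<open>\<mu>\<close> is freely
  infinitely divisible iff \<open>H\<close> extends to a holomorphic map of the upper half-plane into the closed
  lower half-plane with \<open>H (i y) / (i y) \<longrightarrow> 0\<close>, and every such \<open>H\<close> occurs. If \<open>\<rho>\<close> is an \<open>n\<close>-th
  free convolution root of \<open>\<mu>\<close>, then \<open>F\<^sub>\<rho> (z / n + (1 - 1 / n) F z) = F z\<close> on the whole upper
  half-plane, so that a limit of \<open>n (w - F\<^sub>\<rho> w)\<close>, which exists by Montel and Hurwitz, extends \<open>H\<close>.
  Conversely, the Nevanlinna representation of \<open>H\<close> shows that \<open>w + H w\<close> maps the set where its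
  imaginary part is positive bijectively onto the upper half-plane, and the reciprocal of the
  inverse is again a Cauchy transform by the Nevanlinna representation; scaling \<open>H\<close> gives the roots.

  The measure \<open>\<mu>\<close> is symmetric iff \<open>H (- cnj w) = - cnj (H w)\<close>. Averaging the Nevanlinna kernel
  \<open>(1 + w x) / (w - x)\<close> over \<open>x\<close> and \<open>- x\<close> then gives \<open>w (1 + x\<^sup>2) / (w\<^sup>2 - x\<^sup>2)\<close>, a function of \<open>w\<^sup>2\<close>
  and \<open>x\<^sup>2\<close> up to the factor \<open>w\<close>, and this is the kernel of a free regular law for the image of the
  representing measure under \<open>x \<mapsto> x\<^sup>2\<close>. The relation between the L\'evy measures is
  \<open>1 / (1 - z x) + 1 / (1 + z x) = 2 / (1 - z\<^sup>2 x\<^sup>2)\<close> together with uniqueness in the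
  L\'evy--Khintchine formula, which reduces to the uniqueness of a measure with given Cauchy transform.
\<close>

text \<open>The substitution w = 1 / z turns the free cumulant transform into z * H (1 / z), so free
  convolution becomes addition of the functions H and taking n-th roots becomes division of H by n.
  Right inverses are controlled only on cones, so identities are proved on an open piece and carried
  to a half-plane by the identity theorem. Two obstacles shape the analysis. The functions n (w - F
  w) of the roots come without a uniform bound, but their values lie in the closed lower half-plane;
  hence 1 / (h - \<i>) has modulus at most 1, and the nonvanishing of its limit is what excludes
  poles of H. For the converse, preimages under w + H w might run off to infinity in a nearly
  horizontal direction, where cone estimates say nothing; the inequality Im (w + H w) > 0 itself
  supplies the bound. The mass at 0 changes its role between the two laws: an atom at 0 of the
  measure representing H is the quadratic coefficient of \<mu>, and after squaring it is the linear
  coefficient of \<sigma>.\<close>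

abbreviation uhp :: "complex set" where "uhp \<equiv> {z. 0 < Im z}"

lemma open_uhp: "open uhp" and convex_uhp: "convex uhp" and connected_uhp: "connected uhp"
  using open_halfspace_Im_gt[of 0] convex_halfspace_Im_gt[of 0]
  by (auto intro: convex_connected)

section \<open>Distance to the real line, and limits at infinity within a set\<close>

lemma Im_le_cmod_diff_real: "\<bar>Im z\<bar> \<le> cmod (z - complex_of_real x)"
  using abs_Im_le_cmod[of "z - complex_of_real x"] by simp

lemma diff_real_neq_0: "Im z \<noteq> 0 \<Longrightarrow> z - complex_of_real x \<noteq> 0"
  by (auto simp: complex_eq_iff)

text \<open>The filter has a countable base, so sequences decide the limit. This connects the filter
  in the definition of a right inverse with dominated convergence, which works along
  sequences.\<close>

lemma tendsto_inf_at_infinityI: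
  fixes f :: "complex \<Rightarrow> 'a::metric_space"
  assumes "\<And>z::nat \<Rightarrow> complex. (\<And>n. z n \<in> S) \<Longrightarrow> filterlim z at_infinity sequentially \<Longrightarrow>
             (\<lambda>n. f (z n)) \<longlonglongrightarrow> l"
  shows "(f \<longlongrightarrow> l) (inf at_infinity (principal S))"
proof (rule ccontr)
  assume "\<not> ?thesis"
  then obtain e where e: "e > 0"
    "\<not> eventually (\<lambda>z. dist (f z) l < e) (inf at_infinity (principal S))"
    unfolding tendsto_iff by blast
  then have "\<exists>z. z \<in> S \<and> norm z \<ge> real n \<and> \<not> dist (f z) l < e" for n
    unfolding eventually_inf_principal eventually_at_infinity by blast
  then obtain z where z: "\<And>n. z n \<in> S" "\<And>n. norm (z n) \<ge> real n" "\<And>n. \<not> dist (f (z n)) l < e"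
    by metis
  have "filterlim z at_infinity sequentially"
    unfolding filterlim_at_infinity_conv_norm_at_top
    by (rule filterlim_at_top_mono[OF filterlim_real_sequentially]) (auto simp: z)
  from assms[OF z(1) this] have "eventually (\<lambda>n. dist (f (z n)) l < e) sequentially"
    using e by (auto simp: tendsto_iff)
  with z(3) show False by simp
qed

lemma tendsto_inf_at_infinityD:
  assumes "(f \<longlongrightarrow> l) (inf at_infinity (principal S))"
    and "\<And>n::nat. z n \<in> S" "filterlim z at_infinity sequentially"
  shows "(\<lambda>n. f (z n)) \<longlonglongrightarrow> l"
  by (rule filterlim_compose[OF assms(1)])
     (use assms in \<open>auto simp: filterlim_inf filterlim_principal\<close>)

section \<open>Truncated cones\<close>

lemma trunc_cone_subset_uhp: "M > 0 \<Longrightarrow> trunc_cone \<eta> M \<subseteq> uhp"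
  by (auto simp: trunc_cone_def)

lemma trunc_cone_mono: "\<eta> \<le> \<eta>' \<Longrightarrow> M' \<le> M \<Longrightarrow> M > 0 \<Longrightarrow> trunc_cone \<eta> M \<subseteq> trunc_cone \<eta>' M'"
  unfolding trunc_cone_def
  by (auto intro: less_le_trans mult_right_mono)

lemma trunc_cone_Int:
  "M > 0 \<Longrightarrow> M' > 0 \<Longrightarrow> trunc_cone \<eta> M \<inter> trunc_cone \<eta>' M' = trunc_cone (min \<eta> \<eta>') (max M M')"
  using mult_right_mono[of \<eta> \<eta>'] mult_right_mono[of \<eta>' \<eta>]
  by (auto simp: trunc_cone_def min_def max_def) (meson leI le_less_trans less_imp_le less_le_trans not_le order_trans)+

lemma open_trunc_cone: "open (trunc_cone \<eta> M)"
proof -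
  have "trunc_cone \<eta> M = {z. \<bar>Re z\<bar> < \<eta> * Im z} \<inter> {z. M < Im z}"
    by (auto simp: trunc_cone_def)
  moreover have "open {z. \<bar>Re z\<bar> < \<eta> * Im z}"
    by (intro open_Collect_less continuous_intros)
  ultimately show ?thesis
    by (auto intro: open_Int open_halfspace_Im_gt)
qed

lemma convex_trunc_cone: "convex (trunc_cone \<eta> M)"
proof -
  have "trunc_cone \<eta> M = {z. inner (Complex 1 (-\<eta>)) z < 0} \<inter> {z. inner (Complex (-1) (-\<eta>)) z < 0} \<inter> {z. M < Im z}"
    by (auto simp: trunc_cone_def inner_complex_def abs_less_iff)
  then show ?thesis
    by (auto intro!: convex_Int convex_halfspace_lt convex_halfspace_Im_gt)
qed

lemma cmod_le_cone: "z \<in> trunc_cone \<eta> M \<Longrightarrow> M > 0 \<Longrightarrow> cmod z \<le> (1 + \<eta>) * Im z"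
  using cmod_le[of z] unfolding trunc_cone_def by (auto simp: algebra_simps)

text \<open>In a cone the modulus of z is comparable with its imaginary part, which is at most the
  distance from z to any real point. The bound is uniform in x and serves as the majorant for
  dominated convergence.\<close>

lemma cmod_div_le_cone:
  assumes "z \<in> trunc_cone \<eta> M" "M > 0"
  shows "cmod (z / (z - complex_of_real x)) \<le> 1 + \<eta>"
proof -
  have "Im z > 0" using assms by (auto simp: trunc_cone_def)
  moreover have "\<eta> * Im z > 0" using assms
    by (auto simp: trunc_cone_def intro: le_less_trans[OF abs_ge_zero])
  ultimately have "\<eta> > 0" by (simp add: zero_less_mult_iff)
  have "cmod z \<le> (1 + \<eta>) * cmod (z - complex_of_real x)"
  proof -
    have "(1 + \<eta>) * Im z \<le> (1 + \<eta>) * cmod (z - complex_of_real x)"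
      using Im_le_cmod_diff_real[of z x] \<open>\<eta> > 0\<close> by (intro mult_left_mono) auto
    then show ?thesis using cmod_le_cone[OF assms] by linarith
  qed
  then show ?thesis
    using diff_real_neq_0[of z x] \<open>Im z > 0\<close> by (simp add: norm_divide divide_le_eq)
qed

lemma iy_in_trunc_cone: "\<eta> > 0 \<Longrightarrow> M > 0 \<Longrightarrow> y > M \<Longrightarrow> \<i> * complex_of_real y \<in> trunc_cone \<eta> M"
  by (auto simp: trunc_cone_def)

lemma trunc_cone_nonempty: "\<eta> > 0 \<Longrightarrow> M > 0 \<Longrightarrow> trunc_cone \<eta> M \<noteq> {}"
  using iy_in_trunc_cone[of \<eta> M "M+1"] by force

lemma trunc_cone_minus_cnj: "- cnj z \<in> trunc_cone \<eta> M \<longleftrightarrow> z \<in> trunc_cone \<eta> M"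
  by (auto simp: trunc_cone_def)

section \<open>Cauchy transforms\<close>

lemma (in finite_measure) integrable_boundedI:
  fixes f :: "'a \<Rightarrow> 'b::{banach, second_countable_topology}"
  assumes "f \<in> borel_measurable M" "\<And>x. norm (f x) \<le> B"
  shows "integrable M f"
  by (rule integrable_const_bound[where B=B]) (use assms in auto)

lemma (in finite_measure) norm_integral_boundedI:
  fixes f :: "'a \<Rightarrow> 'b::{banach, second_countable_topology}"
  assumes "AE x in M. norm (f x) \<le> B" "B \<ge> 0"
  shows "norm (integral\<^sup>L M f) \<le> B * measure M (space M)"
proof (cases "integrable M f")
  case True
  have "norm (integral\<^sup>L M f) \<le> (\<integral>x. norm (f x) \<partial>M)"
    by (rule integral_norm_bound)
  also have "\<dots> \<le> (\<integral>x. B \<partial>M)"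
    by (rule integral_mono_AE) (use True assms in auto)
  finally show ?thesis by (simp add: mult.commute)
next
  case False
  \<comment> \<open>The integral of a function that is not integrable is 0 by convention.\<close>
  then show ?thesis using assms by (simp add: not_integrable_integral_eq)
qed

lemma tendsto_div_diff_real:
  assumes "filterlim z at_infinity sequentially"
  shows "(\<lambda>n. z n / (z n - complex_of_real x)) \<longlonglongrightarrow> 1"
proof -
  have "(\<lambda>n. 1 / (1 - complex_of_real x / z n)) \<longlonglongrightarrow> 1 / (1 - 0)"
    by (intro tendsto_intros tendsto_divide_0[OF tendsto_const assms]) auto
  moreover have "\<forall>\<^sub>F n in sequentially. 1 / (1 - complex_of_real x / z n) = z n / (z n - complex_of_real x)"
    using filterlim_at_infinity_imp_eventually_ne[OF assms, of 0]
    by eventually_elim (simp add: field_simps)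
  ultimately show ?thesis by (auto dest: tendsto_cong[THEN iffD1])
qed

text \<open>The error of the difference quotient of 1 / z against its derivative; the explicit
  factor a - b makes it vanish to first order.\<close>

lemma reciprocal_difference_quotient:
  fixes a b :: "'a::field"
  assumes "a \<noteq> 0" "b \<noteq> 0" "a \<noteq> b"
  shows "(1 / a - 1 / b) / (a - b) + 1 / b\<^sup>2 = (a - b) * (1 / (a * b\<^sup>2))"
proof -
  have "(1 / a - 1 / b) / (a - b) = - 1 / (a * b)"
    using assms by (simp add: field_simps)
  then show ?thesis using assms by (simp add: field_simps power2_eq_square)
qed

context finite_borel_measure
begin

lemma measurable_M_eq: "borel_measurable M = borel_measurable borel"
  by (rule measurable_cong_sets) (auto simp: M_is_borel)

lemma space_M: "space M = UNIV"
  using sets_eq_imp_space_eq[OF M_is_borel] by simp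

lemma integrable_cauchy_kernel:
  assumes "Im z \<noteq> 0"
  shows "integrable M (\<lambda>x. 1 / (z - complex_of_real x))"
  by (rule integrable_boundedI[where B="1 / \<bar>Im z\<bar>"])
     (use assms Im_le_cmod_diff_real[of z] in
       \<open>auto simp: measurable_M_eq norm_divide intro!: divide_left_mono mult_pos_pos
          simp del: zero_less_norm_iff intro: less_le_trans[of _ "\<bar>Im z\<bar>"]\<close>)

text \<open>The set \<open>S\<close> is an arbitrary closed carrier of the measure: the real line
  gives holomorphy on the half-planes, the nonnegative half-line gives it on the slit plane where
  free regular transforms live.\<close>

lemma cauchy_transform_has_field_derivative:
  assumes "closed S" "AE x in M. complex_of_real x \<in> S" "z0 \<notin> S"
  shows "(cauchy_transform M has_field_derivative
           - (LINT x|M. 1 / (z0 - complex_of_real x)\<^sup>2)) (at z0)"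
proof -
  obtain d where d: "d > 0" "ball z0 d \<subseteq> - S"
    using assms open_contains_ball[of "-S"] by (auto simp: closed_def)
  have far: "cmod (z - of_real x) \<ge> d / 2" "cmod (z0 - of_real x) \<ge> d"
    "z - of_real x \<noteq> 0" "z0 - of_real x \<noteq> 0"
    if "complex_of_real x \<in> S" "dist z z0 < d / 2" for x z
  proof -
    have "of_real x \<notin> ball z0 d" using d that by auto
    then show a: "cmod (z0 - of_real x) \<ge> d" by (simp add: dist_norm)
    have "cmod (z0 - of_real x) \<le> cmod (z - of_real x) + dist z z0"
      by (metis add.commute dist_norm dist_commute dist_triangle)
    then show b: "cmod (z - of_real x) \<ge> d / 2" using a that by auto
    show "z - of_real x \<noteq> 0" "z0 - of_real x \<noteq> 0" using a b d by auto
  qed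
  have AE_far: "AE x in M. cmod (z - of_real x) \<ge> d / 2 \<and> cmod (z0 - of_real x) \<ge> d \<and>
    z - of_real x \<noteq> 0 \<and> z0 - of_real x \<noteq> 0" if "dist z z0 < d / 2" for z
    using assms(2) by eventually_elim (use far that in blast)
  have int1: "integrable M (\<lambda>x. 1 / (z - complex_of_real x))" if "dist z z0 < d / 2" for z
  proof (rule integrable_const_bound[where B="1 / (d/2)"])
    show "AE x in M. cmod (1 / (z - complex_of_real x)) \<le> 1 / (d/2)"
      using AE_far[OF that]
    proof eventually_elim
      case (elim x)
      then show ?case using d unfolding norm_divide norm_one by (intro divide_left_mono mult_pos_pos) auto
    qed
  qed (auto simp: measurable_M_eq)
  have int2: "integrable M (\<lambda>x. 1 / (z0 - complex_of_real x)\<^sup>2)"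
  proof (rule integrable_const_bound[where B="1 / d\<^sup>2"])
    show "AE x in M. cmod (1 / (z0 - complex_of_real x)\<^sup>2) \<le> 1 / d\<^sup>2"
    proof -
      have "dist z0 z0 < d / 2" using d by simp
      from AE_far[OF this] show ?thesis
        by eventually_elim (use d in \<open>auto simp: norm_divide norm_power intro!: frac_le power_mono\<close>)
    qed
  qed (auto simp: measurable_M_eq)
  let ?D = "LINT x|M. 1 / (z0 - complex_of_real x)\<^sup>2"
  \<comment> \<open>The kernel of the error has one factor at z, at distance at least d / 2 from the
    carrier, and two factors at \<open>z0\<close>, at distance at least d.\<close>
  let ?C = "1 / (d/2 * d\<^sup>2) * measure M (space M)"
  have bound: "norm ((cauchy_transform M z - cauchy_transform M z0) / (z - z0) - - ?D) \<le> dist z z0 * ?C"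
    if z: "dist z z0 < d / 2" "z \<noteq> z0" for z
  proof -
    have "(cauchy_transform M z - cauchy_transform M z0) / (z - z0) - - ?D
      = (LINT x|M. (1 / (z - of_real x) - 1 / (z0 - of_real x)) / (z - z0) + 1 / (z0 - complex_of_real x)\<^sup>2)"
      unfolding cauchy_transform_def
      using int1[of z] int1[of z0] int2 z d
      by (simp add: Bochner_Integration.integral_diff)
    also have "norm \<dots> \<le> dist z z0 * (1 / (d/2 * d\<^sup>2)) * measure M (space M)"
    proof (rule norm_integral_boundedI)
      show "AE x in M. norm ((1 / (z - of_real x) - 1 / (z0 - of_real x)) / (z - z0) + 1 / (z0 - complex_of_real x)\<^sup>2)
         \<le> dist z z0 * (1 / (d/2 * d\<^sup>2))"
        using AE_far[OF z(1)]
      proof eventually_elim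
        case (elim x)
        have "(1 / (z - of_real x) - 1 / (z0 - of_real x)) / (z - z0) + 1 / (z0 - complex_of_real x)\<^sup>2
          = (z - z0) * (1 / ((z - of_real x) * (z0 - of_real x)\<^sup>2))" (is "?l = _")
          using reciprocal_difference_quotient[of "z - of_real x" "z0 - of_real x"] elim z by simp
        moreover have "norm (1 / ((z - of_real x) * (z0 - complex_of_real x)\<^sup>2)) \<le> 1 / (d/2 * d\<^sup>2)"
          using elim d(1) unfolding norm_divide norm_mult norm_power norm_one
          by (intro frac_le mult_mono power_mono mult_pos_pos zero_less_power) auto
        ultimately show ?case
          by (simp add: norm_mult dist_norm mult_left_mono del: times_divide_eq_right)
      qed
    qed (use d in auto)
    finally show ?thesis by simp
  qed
  show ?thesis
    unfolding has_field_derivative_iff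
  proof (rule LIM_zero_cancel, rule Lim_null_comparison)
    show "\<forall>\<^sub>F z in at z0. norm ((cauchy_transform M z - cauchy_transform M z0) / (z - z0) - - ?D) \<le> dist z z0 * ?C"
      unfolding eventually_at using d bound
      by (intro exI[of _ "d/2"]) auto
    show "((\<lambda>z. dist z z0 * ?C) \<longlongrightarrow> 0) (at z0)"
      by (rule tendsto_eq_rhs[OF tendsto_mult[OF tendsto_dist[OF tendsto_ident_at tendsto_const] tendsto_const]]) simp
  qed
qed

lemma cauchy_transform_holomorphic_on:
  assumes "closed S" "AE x in M. complex_of_real x \<in> S"
  shows "cauchy_transform M holomorphic_on - S"
  unfolding holomorphic_on_def field_differentiable_def
proof
  fix z assume "z \<in> - S"
  then show "\<exists>f'. (cauchy_transform M has_field_derivative f') (at z within - S)"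
    using cauchy_transform_has_field_derivative[OF assms, of z] has_field_derivative_at_within by blast
qed

lemma cauchy_transform_holomorphic_on_uhp: "cauchy_transform M holomorphic_on uhp"
  by (rule holomorphic_on_subset[OF cauchy_transform_holomorphic_on[of \<real>]])
     (auto simp: complex_is_Real_iff closed_complex_Reals)

text \<open>The two-point kernel governs differences of values of the Cauchy transform. Its
  normalised integral tends to the total mass, so for a probability measure it is eventually
  nonzero.\<close>

lemma tendsto_integral_cone2:
  assumes z: "\<And>n. z n \<in> trunc_cone \<eta> A" "A > 0" "filterlim z at_infinity sequentially"
    and w: "\<And>n. w n \<in> trunc_cone \<eta> A" "filterlim w at_infinity sequentially"
  shows "(\<lambda>n. LINT x|M. (z n / (z n - complex_of_real x)) * (w n / (w n - complex_of_real x)))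
           \<longlonglongrightarrow> measure M (space M)"
proof -
  have "(\<lambda>n. LINT x|M. (z n / (z n - complex_of_real x)) * (w n / (w n - complex_of_real x)))
           \<longlonglongrightarrow> (LINT x|M. 1)"
  proof (rule integral_dominated_convergence[where w="\<lambda>_. (1 + \<eta>) * (1 + \<eta>)"])
    show "AE x in M. (\<lambda>n. (z n / (z n - complex_of_real x)) * (w n / (w n - complex_of_real x))) \<longlonglongrightarrow> 1"
      using tendsto_mult[OF tendsto_div_diff_real[OF z(3)] tendsto_div_diff_real[OF w(2)]] by (intro always_eventually) auto
    show "AE x in M. norm ((z n / (z n - complex_of_real x)) * (w n / (w n - complex_of_real x))) \<le> (1 + \<eta>) * (1 + \<eta>)" for n
    proof (intro always_eventually allI)
      fix x
      have "norm (z n / (z n - complex_of_real x)) \<le> 1 + \<eta>" "norm (w n / (w n - complex_of_real x)) \<le> 1 + \<eta>"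
        by (rule cmod_div_le_cone[OF z(1,2)], rule cmod_div_le_cone[OF w(1) z(2)])
      then show "norm ((z n / (z n - complex_of_real x)) * (w n / (w n - complex_of_real x))) \<le> (1 + \<eta>) * (1 + \<eta>)"
        unfolding norm_mult by (meson mult_mono norm_ge_zero order_trans)
    qed
  qed (auto simp: measurable_M_eq)
  then show ?thesis by (simp add: scaleR_conv_of_real)
qed

lemma integrable_cauchy_kernel2:
  assumes "Im z \<noteq> 0" "Im w \<noteq> 0"
  shows "integrable M (\<lambda>x. (1 / (z - complex_of_real x)) * (1 / (w - complex_of_real x)))"
proof (rule integrable_boundedI[where B="1 / \<bar>Im z\<bar> * (1 / \<bar>Im w\<bar>)"])
  fix x
  have "norm (1 / (v - complex_of_real x)) \<le> 1 / \<bar>Im v\<bar>" if "Im v \<noteq> 0" for v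
    using that Im_le_cmod_diff_real[of v x] by (auto simp: norm_divide intro!: frac_le)
  then show "norm ((1 / (z - complex_of_real x)) * (1 / (w - complex_of_real x))) \<le> 1 / \<bar>Im z\<bar> * (1 / \<bar>Im w\<bar>)"
    using assms unfolding norm_mult by (intro mult_mono) auto
qed (auto simp: measurable_M_eq)

text \<open>The resolvent identity 1 / a - 1 / b = (b - a) / (a b), integrated.\<close>

lemma cauchy_transform_diff:
  assumes "Im z \<noteq> 0" "Im w \<noteq> 0"
  shows "cauchy_transform M z - cauchy_transform M w =
    (w - z) * (LINT x|M. (1 / (z - complex_of_real x)) * (1 / (w - complex_of_real x)))"
proof -
  have "cauchy_transform M z - cauchy_transform M w = (LINT x|M. 1 / (z - of_real x) - 1 / (w - of_real x))"
    unfolding cauchy_transform_def using integrable_cauchy_kernel assms by simp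
  also have "\<dots> = (LINT x|M. (w - z) * ((1 / (z - complex_of_real x)) * (1 / (w - complex_of_real x))))"
    using diff_real_neq_0[OF assms(1)] diff_real_neq_0[OF assms(2)]
    by (intro Bochner_Integration.integral_cong) (auto simp: field_simps)
  finally show ?thesis by (simp only: integral_mult_right_zero)
qed

lemma Im_cauchy_transform:
  assumes "Im z \<noteq> 0"
  shows "Im (cauchy_transform M z) = - Im z * (LINT x|M. (1 / cmod (z - of_real x))\<^sup>2)"
    and "integrable M (\<lambda>x. (1 / cmod (z - of_real x))\<^sup>2)"
proof -
  show int: "integrable M (\<lambda>x. (1 / cmod (z - of_real x))\<^sup>2)"
    using integrable_norm[OF integrable_cauchy_kernel2[OF assms assms]]
    by (simp add: norm_mult norm_divide power2_eq_square)
  have "Im (cauchy_transform M z) = (LINT x|M. Im (1 / (z - complex_of_real x)))"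
    unfolding cauchy_transform_def
    by (rule integral_bounded_linear[OF bounded_linear_Im integrable_cauchy_kernel[OF assms], symmetric])
  also have "\<dots> = (LINT x|M. - Im z * (1 / cmod (z - of_real x))\<^sup>2)"
    by (intro Bochner_Integration.integral_cong) (auto simp: Im_divide cmod_power2 power_divide)
  finally show "Im (cauchy_transform M z) = - Im z * (LINT x|M. (1 / cmod (z - of_real x))\<^sup>2)"
    by simp
qed

end

section \<open>Reciprocal Cauchy transforms and their right inverses\<close>

context real_distribution
begin

text \<open>The second bound is the Cauchy-Schwarz inequality, obtained as nonnegativity of the
  variance of 1 / |z - x|. It says that the reciprocal transform does not decrease imaginary
  parts.\<close>

lemma Im_cauchy_transform_neg:
  assumes "Im z > 0"
  shows "Im (cauchy_transform M z) < 0" "(cmod (cauchy_transform M z))\<^sup>2 * Im z \<le> - Im (cauchy_transform M z)"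
proof -
  let ?f = "\<lambda>x. (1 / cmod (z - of_real x))\<^sup>2"
  let ?g = "\<lambda>x. 1 / cmod (z - of_real x)"
  note im = Im_cauchy_transform[of z]
  have int2: "integrable M ?f" using im assms by auto
  have "integrable M (\<lambda>x. norm (1 / (z - complex_of_real x)))"
    using integrable_cauchy_kernel[of z] assms by (intro integrable_norm) auto
  then have int1: "integrable M ?g" by (simp add: norm_divide)
  have "cmod (cauchy_transform M z) \<le> (LINT x|M. norm (1 / (z - complex_of_real x)))"
    unfolding cauchy_transform_def by (rule integral_norm_bound)
  also have "\<dots> = expectation ?g" by (simp add: norm_divide)
  finally have "(cmod (cauchy_transform M z))\<^sup>2 \<le> (expectation ?g)\<^sup>2"
    by (rule power_mono) simp
  also have "\<dots> \<le> expectation ?f"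
    using variance_eq[OF int1 int2] variance_positive[of ?g] by simp
  finally show "(cmod (cauchy_transform M z))\<^sup>2 * Im z \<le> - Im (cauchy_transform M z)"
    using im assms by (simp add: mult.commute)
  have "expectation ?f \<noteq> 0"
  proof
    assume "expectation ?f = 0"
    then have "AE x in M. ?f x = 0"
      using integral_nonneg_eq_0_iff_AE[OF int2] by auto
    moreover have "?f x \<noteq> 0" for x using diff_real_neq_0[of z x] assms by auto
    ultimately show False by simp
  qed
  moreover have "expectation ?f \<ge> 0" by simp
  ultimately have "expectation ?f > 0" by linarith
  then show "Im (cauchy_transform M z) < 0" using im assms by (simp add: mult_pos_pos)
qed

lemma cauchy_transform_neq_0: "Im z > 0 \<Longrightarrow> cauchy_transform M z \<noteq> 0"
  using Im_cauchy_transform_neg(1)[of z] by auto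

lemma Im_recip_cauchy_transform_ge: 
  assumes "Im z > 0" shows "Im (recip_cauchy_transform M z) \<ge> Im z"
proof -
  have eq: "Im (recip_cauchy_transform M z) = - Im (cauchy_transform M z) / (cmod (cauchy_transform M z))\<^sup>2"
    by (simp add: recip_cauchy_transform_def Im_divide cmod_power2)
  show ?thesis
    unfolding eq using Im_cauchy_transform_neg(2)[OF assms] cauchy_transform_neq_0[OF assms]
    by (subst pos_le_divide_eq) (auto simp: mult.commute)
qed

lemma recip_cauchy_transform_holomorphic: "recip_cauchy_transform M holomorphic_on uhp"
proof -
  have "(\<lambda>z. 1 / cauchy_transform M z) holomorphic_on uhp"
    using cauchy_transform_neq_0
    by (intro holomorphic_intros cauchy_transform_holomorphic_on_uhp) auto
  then show ?thesis by (simp add: recip_cauchy_transform_def[abs_def])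
qed

text \<open>Equal values force w - z times the two-point integral to vanish, and after
  multiplication by z w that integral tends to 1. Injectivity is thus available only far out in a
  cone.\<close>

lemma recip_cauchy_transform_inj_cone:
  assumes z: "\<And>n. z n \<in> trunc_cone \<eta> A" "A > 0" "filterlim z at_infinity sequentially"
    and w: "\<And>n. w n \<in> trunc_cone \<eta> A" "filterlim w at_infinity sequentially"
    and eq: "\<And>n. recip_cauchy_transform M (z n) = recip_cauchy_transform M (w n)"
  shows "\<forall>\<^sub>F n in sequentially. z n = w n"
proof -
  have Im: "Im (z n) > 0" "Im (w n) > 0" for n
    using z w trunc_cone_subset_uhp[of A \<eta>] by auto
  from tendsto_integral_cone2[OF z w]
  have "\<forall>\<^sub>F n in sequentially. (LINT x|M. (z n / (z n - complex_of_real x)) * (w n / (w n - complex_of_real x))) \<noteq> 0"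
    by (rule tendsto_imp_eventually_ne) (use prob_space in simp)
  then show ?thesis
  proof eventually_elim
    case (elim n)
    have "cauchy_transform M (z n) = cauchy_transform M (w n)"
      using eq[of n] by (simp add: recip_cauchy_transform_def) 
    then have "(w n - z n) * (LINT x|M. (1 / (z n - complex_of_real x)) * (1 / (w n - complex_of_real x))) = 0"
      using cauchy_transform_diff[of "z n" "w n"] Im by (metis diff_self less_irrefl)
    moreover have "(LINT x|M. (z n / (z n - complex_of_real x)) * (w n / (w n - complex_of_real x)))
      = z n * w n * (LINT x|M. (1 / (z n - complex_of_real x)) * (1 / (w n - complex_of_real x)))"
      by (subst integral_mult_right_zero[symmetric], rule Bochner_Integration.integral_cong) auto
    ultimately show ?case using elim by auto
  qed
qed

end

lemma right_inverse_on_coneD: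
  assumes "right_inverse_on_cone M \<eta> A g"
  shows "\<eta> > 0" "A > 0" "g holomorphic_on trunc_cone \<eta> A"
    and "w \<in> trunc_cone \<eta> A \<Longrightarrow> Im (g w) > 0"
    and "w \<in> trunc_cone \<eta> A \<Longrightarrow> recip_cauchy_transform M (g w) = w"
    and "((\<lambda>w. g w / w) \<longlongrightarrow> 1) (inf at_infinity (principal (trunc_cone \<eta> A)))"
  using assms unfolding right_inverse_on_cone_def by auto

context real_distribution
begin

text \<open>Both inverses are asymptotic to the identity, so far out their values lie in one common
  cone, where the reciprocal transform separates points. The identity theorem then spreads the
  equality over the intersection of the domains.\<close>

lemma right_inverse_on_cone_unique:
  assumes g1: "right_inverse_on_cone M \<eta>1 A1 g1" and g2: "right_inverse_on_cone M \<eta>2 A2 g2"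
    and w: "w \<in> trunc_cone \<eta>1 A1" "w \<in> trunc_cone \<eta>2 A2"
  shows "g1 w = g2 w"
proof -
  define \<eta> A where "\<eta> = min \<eta>1 \<eta>2" and "A = max A1 A2"
  have pos: "\<eta> > 0" "A > 0"
    using right_inverse_on_coneD(1,2)[OF g1] right_inverse_on_coneD(1,2)[OF g2] by (auto simp: \<eta>_def A_def)
  have sub: "trunc_cone \<eta> A \<subseteq> trunc_cone \<eta>1 A1" "trunc_cone \<eta> A \<subseteq> trunc_cone \<eta>2 A2"
    using pos(2) by (intro trunc_cone_mono; simp add: \<eta>_def A_def)+
  have wA: "w \<in> trunc_cone \<eta> A"
    unfolding \<eta>_def A_def
      trunc_cone_Int[OF right_inverse_on_coneD(2)[OF g1] right_inverse_on_coneD(2)[OF g2], symmetric]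
    using w by blast
  have key: "\<forall>\<^sub>F n in sequentially. g1 (z n) = g2 (z n)"
    if z: "\<And>n. z n \<in> trunc_cone \<eta> A" and zi: "filterlim z at_infinity sequentially" for z
  proof -
    \<comment> \<open>If g w differs from w by at most Im w / 2, the imaginary part at worst halves
      and the real part grows by at most Im w / 2. The slope becomes at most (\<eta> + 1 / 2) / (1 /
      2) = 2 \<eta> + 1.\<close>
    have far: "filterlim (\<lambda>n. g (z n)) at_infinity sequentially \<and> 
         (\<forall>\<^sub>F n in sequentially. g (z n) \<in> trunc_cone (2 * \<eta> + 1) 1)"
      if "right_inverse_on_cone M \<eta>' A' g" "trunc_cone \<eta> A \<subseteq> trunc_cone \<eta>' A'" for g \<eta>' A'
    proof -
      have r: "(\<lambda>n. g (z n) / z n) \<longlonglongrightarrow> 1"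
        by (rule tendsto_inf_at_infinityD[OF right_inverse_on_coneD(6)[OF that(1)] subsetD[OF that(2) z] zi])
      have nz: "\<forall>\<^sub>F n in sequentially. z n \<noteq> 0"
        by (rule filterlim_at_infinity_imp_eventually_ne[OF zi])
      have "filterlim (\<lambda>n. (g (z n) / z n) * z n) at_infinity sequentially"
        by (rule tendsto_mult_filterlim_at_infinity[OF r _ zi]) simp
      moreover have "\<forall>\<^sub>F n in sequentially. (g (z n) / z n) * z n = g (z n)"
        using nz by eventually_elim simp
      ultimately have gi: "filterlim (\<lambda>n. g (z n)) at_infinity sequentially"
        by (subst (asm) filterlim_cong[OF refl refl])
      \<comment> \<open>Since |w| is at most (1 + \<eta>) Im w in the cone, this relative error
        gives the absolute error Im w / 2. The next bound on the modulus forces Im w > 2, hence Im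
        (g w) > 1.\<close>
      have "\<forall>\<^sub>F n in sequentially. dist (g (z n) / z n) 1 < 1 / (2 * (1 + \<eta>))"
        using r pos by (intro tendstoD) auto
      moreover have "\<forall>\<^sub>F n in sequentially. norm (z n) > 2 * (1 + \<eta>)"
        using zi unfolding filterlim_at_infinity_conv_norm_at_top filterlim_at_top_dense by blast
      ultimately have "\<forall>\<^sub>F n in sequentially. g (z n) \<in> trunc_cone (2 * \<eta> + 1) 1"
        using nz
      proof eventually_elim
        case (elim n)
        have zn: "cmod (z n) \<le> (1 + \<eta>) * Im (z n)" "\<bar>Re (z n)\<bar> < \<eta> * Im (z n)"
          using cmod_le_cone[OF z pos(2)] z[of n] by (auto simp: trunc_cone_def)
        have "cmod (g (z n) - z n) = dist (g (z n) / z n) 1 * cmod (z n)"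
        proof -
          have "g (z n) - z n = (g (z n) / z n - 1) * z n" using elim by (simp add: field_simps)
          then show ?thesis by (simp only: dist_norm norm_mult)
        qed
        also have "\<dots> \<le> 1 / (2 * (1 + \<eta>)) * ((1 + \<eta>) * Im (z n))"
          using elim zn pos by (intro mult_mono) auto
        also have "\<dots> = Im (z n) / 2" using pos by (simp add: field_simps)
        finally have d: "cmod (g (z n) - z n) \<le> Im (z n) / 2" .
        have i: "Im (g (z n)) \<ge> Im (z n) / 2"
          using d abs_Im_le_cmod[of "g (z n) - z n"] by (simp add: abs_le_iff)
        have "\<bar>Re (g (z n))\<bar> \<le> \<bar>Re (z n)\<bar> + Im (z n) / 2"
          using d abs_Re_le_cmod[of "g (z n) - z n"] by simp
        also have "\<dots> < (2 * \<eta> + 1) * (Im (z n) / 2)" using zn by (simp add: algebra_simps)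
        also have "\<dots> \<le> (2 * \<eta> + 1) * Im (g (z n))" using i pos by (intro mult_left_mono) auto
        finally have "\<bar>Re (g (z n))\<bar> < (2 * \<eta> + 1) * Im (g (z n))" .
        moreover have "Im (z n) > 2"
        proof -
          have "(1 + \<eta>) * 2 < (1 + \<eta>) * Im (z n)" using zn elim by linarith
          then show ?thesis using pos by (simp only: mult_less_cancel_left_pos)
        qed
        ultimately show ?case using i by (auto simp: trunc_cone_def)
      qed
      with gi show ?thesis by blast
    qed
    from far[OF g1 sub(1)] far[OF g2 sub(2)]
    have "\<forall>\<^sub>F n in sequentially. g1 (z n) \<in> trunc_cone (2 * \<eta> + 1) 1 \<and> g2 (z n) \<in> trunc_cone (2 * \<eta> + 1) 1"
      by (auto intro: eventually_conj)
    then obtain N where N: "\<And>n. n \<ge> N \<Longrightarrow> g1 (z n) \<in> trunc_cone (2 * \<eta> + 1) 1 \<and> g2 (z n) \<in> trunc_cone (2 * \<eta> + 1) 1"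
      by (auto simp: eventually_sequentially)
    have "\<forall>\<^sub>F n in sequentially. g1 (z (n + N)) = g2 (z (n + N))"
    proof (rule recip_cauchy_transform_inj_cone[where \<eta>="2 * \<eta> + 1" and A=1])
      show "filterlim (\<lambda>n. g1 (z (n + N))) at_infinity sequentially"
           "filterlim (\<lambda>n. g2 (z (n + N))) at_infinity sequentially"
        using filterlim_compose[OF far[OF g1 sub(1), THEN conjunct1] filterlim_add_const_nat_at_top[of N]]
          filterlim_compose[OF far[OF g2 sub(2), THEN conjunct1] filterlim_add_const_nat_at_top[of N]]
        by simp_all
      show "recip_cauchy_transform M (g1 (z (n + N))) = recip_cauchy_transform M (g2 (z (n + N)))" for n
        using g1 g2 subsetD[OF sub(1) z[of "n + N"]] subsetD[OF sub(2) z[of "n + N"]] by (simp add: right_inverse_on_coneD(5))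
    qed (use N in auto)
    then show ?thesis by (subst (asm) eventually_sequentially_seg)
  qed
  have "\<exists>B. \<forall>z\<in>trunc_cone \<eta> A. norm z > B \<longrightarrow> g1 z = g2 z"
  proof (rule ccontr)
    assume "\<not> ?thesis"
    then have "\<exists>z. z \<in> trunc_cone \<eta> A \<and> norm z > real n \<and> g1 z \<noteq> g2 z" for n :: nat by blast
    then obtain z where z: "\<And>n. z n \<in> trunc_cone \<eta> A" "\<And>n::nat. norm (z n) > real n" "\<And>n. g1 (z n) \<noteq> g2 (z n)"
      by metis
    have "filterlim z at_infinity sequentially"
      unfolding filterlim_at_infinity_conv_norm_at_top
      by (rule filterlim_at_top_mono[OF filterlim_real_sequentially]) (auto simp: z less_imp_le)
    from key[OF z(1) this] z(3) show False by simp
  qed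
  then obtain B where B: "\<And>z. z \<in> trunc_cone \<eta> A \<Longrightarrow> norm z > B \<Longrightarrow> g1 z = g2 z" by blast
  show ?thesis
  proof (rule analytic_continuation_open[where s="trunc_cone \<eta> A \<inter> {z. norm z > B}" and s'="trunc_cone \<eta> A"
      and f=g1 and g=g2])
    have "open {z::complex. norm z > B}" by (intro open_Collect_less continuous_intros)
    then show "open (trunc_cone \<eta> A \<inter> {z. norm z > B})" by (intro open_Int open_trunc_cone)
    have "\<i> * complex_of_real (A + \<bar>B\<bar> + 1) \<in> trunc_cone \<eta> A \<inter> {z. norm z > B}"
      using pos iy_in_trunc_cone[of \<eta> A "A + \<bar>B\<bar> + 1"] by (auto simp: norm_mult simp del: of_real_add)
    then show "trunc_cone \<eta> A \<inter> {z. norm z > B} \<noteq> {}" by blast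
    show "connected (trunc_cone \<eta> A)" by (intro convex_connected convex_trunc_cone)
    show "g1 holomorphic_on trunc_cone \<eta> A" "g2 holomorphic_on trunc_cone \<eta> A"
      by (rule holomorphic_on_subset[OF right_inverse_on_coneD(3)[OF g1] sub(1)],
          rule holomorphic_on_subset[OF right_inverse_on_coneD(3)[OF g2] sub(2)])
  qed (use B wA open_trunc_cone in auto)
qed

lemma recip_cauchy_inverse_eq:
  assumes "right_inverse_on_cone M \<eta> A g" "w \<in> trunc_cone \<eta> A"
  shows "recip_cauchy_inverse M w = g w"
  unfolding recip_cauchy_inverse_def
proof (rule the_equality)
  show "\<exists>\<eta> A g'. right_inverse_on_cone M \<eta> A g' \<and> w \<in> trunc_cone \<eta> A \<and> g w = g' w"
    using assms by blast
  show "u = g w" if "\<exists>\<eta> A g'. right_inverse_on_cone M \<eta> A g' \<and> w \<in> trunc_cone \<eta> A \<and> u = g' w" for u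
    using that right_inverse_on_cone_unique[OF _ assms(1) _ assms(2)] by blast
qed

lemma free_cumulant_eq:
  assumes "right_inverse_on_cone M \<eta> A g" "1 / z \<in> trunc_cone \<eta> A"
  shows "free_cumulant M z = z * g (1 / z) - 1"
  using recip_cauchy_inverse_eq[OF assms] by (simp add: free_cumulant_def)

end

lemma right_inverse_on_cone_mono:
  assumes "right_inverse_on_cone M \<eta> A g" "0 < \<eta>'" "\<eta>' \<le> \<eta>" "A \<le> A'"
  shows "right_inverse_on_cone M \<eta>' A' g"
proof -
  note g = right_inverse_on_coneD[OF assms(1)]
  have sub: "trunc_cone \<eta>' A' \<subseteq> trunc_cone \<eta> A"
    using assms g(2) by (intro trunc_cone_mono) auto
  have "((\<lambda>w. g w / w) \<longlongrightarrow> 1) (inf at_infinity (principal (trunc_cone \<eta>' A')))"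
    by (rule tendsto_mono[OF _ g(6)]) (use sub in \<open>simp add: le_infI2\<close>)
  moreover have "g holomorphic_on trunc_cone \<eta>' A'"
    by (rule holomorphic_on_subset[OF g(3) sub])
  ultimately show ?thesis
    using assms(2,4) g(2) g(4,5)[OF subsetD[OF sub]] unfolding right_inverse_on_cone_def by simp
qed

lemma invertible_on_cone_mono:
  "invertible_on_cone M \<eta> A \<Longrightarrow> 0 < \<eta>' \<Longrightarrow> \<eta>' \<le> \<eta> \<Longrightarrow> A \<le> A' \<Longrightarrow> invertible_on_cone M \<eta>' A'"
  unfolding invertible_on_cone_def using right_inverse_on_cone_mono[of M \<eta> A _ \<eta>' A'] by (elim exE) blast

section \<open>A measure is determined by its Cauchy transform\<close>

lemma integrable_inverse_1_plus_square_UNIV: "integrable lborel (\<lambda>v::real. 1 / (1 + v\<^sup>2))"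
  using integrable_inverse_1_plus_square
  by (simp add: set_integrable_def einterval_eq_UNIV inverse_eq_divide)

lemma integral_inverse_1_plus_square_pos: "(LBINT v. 1 / (1 + v\<^sup>2)) > (0::real)"
proof -
  have "(LBINT v. 1 / (1 + v\<^sup>2)) = pi"
    using LBINT_inverse_1_plus_square
    by (simp add: interval_lebesgue_integral_def set_lebesgue_integral_def einterval_eq_UNIV inverse_eq_divide)
  then show ?thesis by simp
qed

lemma norm_iexp_mult: "norm (iexp a * complex_of_real r) = \<bar>r\<bar>"
  by (simp only: norm_mult norm_exp_i_times norm_of_real mult_1)

text \<open>The integral is \<pi> exp (- |s y|). One nonzero value suffices for cancelling this
  factor, and that follows from the positive limit as y tends to 0.\<close>

lemma exists_fourier_cauchy_density_neq_0:
  "\<exists>y>0. (CLBINT v. iexp (s * y * v) * of_real (1 / (1 + v\<^sup>2))) \<noteq> 0"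
proof -
  have "(\<lambda>n. CLBINT v. iexp (s * (1 / real (Suc n)) * v) * of_real (1 / (1 + v\<^sup>2)))
          \<longlonglongrightarrow> (CLBINT v. iexp (s * 0 * v) * of_real (1 / (1 + v\<^sup>2)))"
  proof (rule integral_dominated_convergence[where w="\<lambda>v. 1 / (1 + v\<^sup>2)"])
    show "AE v in lborel. (\<lambda>n. iexp (s * (1 / real (Suc n)) * v) * of_real (1 / (1 + v\<^sup>2)))
       \<longlonglongrightarrow> iexp (s * 0 * v) * of_real (1 / (1 + v\<^sup>2))"
      by (intro always_eventually allI tendsto_intros LIMSEQ_Suc lim_1_over_n)
    show "AE v in lborel. norm (iexp (s * (1 / real (Suc n)) * v) * of_real (1 / (1 + v\<^sup>2))) \<le> 1 / (1 + v\<^sup>2)" for n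
      unfolding norm_iexp_mult by (intro always_eventually allI) simp
  qed (use integrable_inverse_1_plus_square_UNIV in simp_all)
  moreover have "(CLBINT v. iexp (s * 0 * v) * of_real (1 / (1 + v\<^sup>2))) \<noteq> 0"
    using integral_inverse_1_plus_square_pos by (simp add: integral_complex_of_real del: of_real_divide)
  ultimately have "\<forall>\<^sub>F n in sequentially. (CLBINT v. iexp (s * (1 / real (Suc n)) * v) * of_real (1 / (1 + v\<^sup>2))) \<noteq> 0"
    by (rule tendsto_imp_eventually_ne)
  then obtain n where "(CLBINT v. iexp (s * (1 / real (Suc n)) * v) * of_real (1 / (1 + v\<^sup>2))) \<noteq> 0"
    by (auto simp: eventually_sequentially)
  then show ?thesis by (intro exI[of _ "1 / real (Suc n)"]) auto
qed

context finite_borel_measure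
begin

text \<open>The imaginary part of the Cauchy transform on a horizontal line is, up to the factor \<open>-\<pi>\<close>, the
  density of the convolution with a Cauchy distribution, so that its Fourier transform factorises.\<close>

lemma fourier_Im_cauchy_transform:
  assumes "y > 0"
  shows "(CLBINT x. iexp (s * x) * of_real (- Im (cauchy_transform M (Complex x y)))) =
    (CLINT t|M. iexp (s * t)) * (CLBINT v. iexp (s * y * v) * of_real (1 / (1 + v\<^sup>2)))"
proof -
  interpret pair_sigma_finite M lborel
    by (auto simp: pair_sigma_finite_def lborel.sigma_finite_measure_axioms sigma_finite_measure_axioms)
  note [measurable_cong] = M_is_borel
  \<comment> \<open>This is y / ((x - t)^2 + y^2), the Poisson kernel up to \<pi>, arranged so that
    the substitution x = t + y v separates t from v.\<close>
  define k where "k = (\<lambda>t x. (1 / y) * (1 / (1 + ((x - t) / y)\<^sup>2)))"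
  have k_affine: "k t (t + y * v) = (1 / y) * (1 / (1 + v\<^sup>2))" for t v
    using assms by (simp add: k_def)
  have k_int: "integrable lborel (k t)" and k_val: "(LBINT x. k t x) = (LBINT v. 1 / (1 + v\<^sup>2))" for t
  proof -
    have k: "k t x = (1 / y) * (1 / (1 + (- t / y + (1 / y) * x)\<^sup>2))" for x
      by (simp add: k_def diff_divide_distrib)
    show "integrable lborel (k t)"
      unfolding k using assms
      by (intro integrable_mult_right lborel_integrable_real_affine[OF integrable_inverse_1_plus_square_UNIV]) auto
    show "(LBINT x. k t x) = (LBINT v. 1 / (1 + v\<^sup>2))"
      using assms by (subst lborel_integral_real_affine[of y _ t]) (simp_all only: k_affine integral_mult_right_zero, simp_all)
  qed
  have k_nonneg: "k t x \<ge> 0" for t x using assms by (simp add: k_def)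
  have Im: "- Im (cauchy_transform M (Complex x y)) = (LINT t|M. k t x)" for x
  proof -
    have "- Im (cauchy_transform M (Complex x y)) = (LINT t|M. y * (1 / cmod (Complex x y - of_real t))\<^sup>2)"
      using assms by (subst Im_cauchy_transform(1)) auto
    also have "\<dots> = (LINT t|M. k t x)"
    proof (intro Bochner_Integration.integral_cong refl)
      fix t
      have "y * (1 / cmod (Complex x y - of_real t))\<^sup>2 = y / ((x - t)\<^sup>2 + y\<^sup>2)"
        by (simp add: power_divide cmod_power2)
      also have "\<dots> = k t x"
      proof -
        have "y\<^sup>2 + (x - t)\<^sup>2 \<noteq> 0" using assms by (simp add: sum_power2_eq_zero_iff)
        then show ?thesis using assms by (simp add: k_def field_simps power2_eq_square)
      qed
      finally show "y * (1 / cmod (Complex x y - of_real t))\<^sup>2 = k t x" .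
    qed
    finally show ?thesis .
  qed
  have k_meas [measurable]: "(\<lambda>(t, x). k t x) \<in> borel_measurable (M \<Otimes>\<^sub>M lborel)"
    unfolding k_def by measurable
  have int: "integrable (M \<Otimes>\<^sub>M lborel) (\<lambda>(t, x). iexp (s * x) * of_real (k t x))"
  proof (rule Fubini_integrable)
    show "(\<lambda>(t, x). iexp (s * x) * of_real (k t x)) \<in> borel_measurable (M \<Otimes>\<^sub>M lborel)"
      unfolding k_def by measurable
    show "integrable M (\<lambda>t. LBINT x. norm (case (t, x) of (t, x) \<Rightarrow> iexp (s * x) * complex_of_real (k t x)))"
      by (simp add: norm_mult k_nonneg k_val)
    show "AE t in M. integrable lborel (\<lambda>x. case (t, x) of (t, x) \<Rightarrow> iexp (s * x) * complex_of_real (k t x))"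
    proof (intro always_eventually allI)
      fix t
      have "integrable lborel (\<lambda>x. iexp (s * x) * complex_of_real (k t x))"
        by (rule Bochner_Integration.integrable_bound[OF k_int[of t]])
           (simp add: k_def, simp only: norm_iexp_mult real_norm_def, simp)
      then show "integrable lborel (\<lambda>x. case (t, x) of (t, x) \<Rightarrow> iexp (s * x) * complex_of_real (k t x))" by simp
    qed
  qed
  have "(CLBINT x. iexp (s * x) * of_real (- Im (cauchy_transform M (Complex x y)))) =
      (CLBINT x. (CLINT t|M. iexp (s * x) * of_real (k t x)))"
    unfolding Im by (simp add: integral_complex_of_real)
  also have "\<dots> = (CLINT t|M. (CLBINT x. iexp (s * x) * of_real (k t x)))"
    by (rule Fubini_integral[OF int])
  also have "\<dots> = (CLINT t|M. iexp (s * t) * (CLBINT v. iexp (s * y * v) * of_real (1 / (1 + v\<^sup>2))))"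
  proof (intro Bochner_Integration.integral_cong refl)
    fix t
    have "(CLBINT x. iexp (s * x) * of_real (k t x)) = y *\<^sub>R (CLBINT v. iexp (s * (t + y * v)) * of_real (k t (t + y * v)))"
      using assms by (subst lborel_integral_real_affine[of y _ t]) auto
    also have "\<dots> = (CLBINT v. y *\<^sub>R (iexp (s * (t + y * v)) * of_real (k t (t + y * v))))"
      by (simp only: integral_scaleR_right)
    also have "\<dots> = (CLBINT v. iexp (s * t) * (iexp (s * y * v) * of_real (1 / (1 + v\<^sup>2))))"
      using assms
    proof (intro Bochner_Integration.integral_cong refl)
      fix v
      have eq: "y *\<^sub>R (a * complex_of_real ((1 / y) * r)) = a * of_real r" for a r
        using assms by (simp add: scaleR_conv_of_real)
      show "y *\<^sub>R (iexp (s * (t + y * v)) * of_real (k t (t + y * v))) =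
          iexp (s * t) * (iexp (s * y * v) * complex_of_real (1 / (1 + v\<^sup>2)))"
        unfolding k_affine eq by (simp add: distrib_left exp_add mult.assoc del: of_real_divide)
    qed
    finally show "(CLBINT x. iexp (s * x) * of_real (k t x)) = iexp (s * t) * (CLBINT v. iexp (s * y * v) * of_real (1 / (1 + v\<^sup>2)))"
      by (simp only: integral_mult_right_zero)
  qed
  finally show ?thesis by (simp only: integral_mult_left_zero)
qed

end

text \<open>Cancelling the Fourier transform of the Cauchy density leaves equal Fourier transforms
  of the two measures. Levy's uniqueness theorem concerns probability measures, hence the division
  by the common mass and the separate case of mass 0.\<close>

lemma cauchy_transform_eq_imp_eq:
  assumes "finite_borel_measure M" "finite_borel_measure N"
    and eq: "\<And>z. Im z > 0 \<Longrightarrow> cauchy_transform M z = cauchy_transform N z"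
  shows "M = N"
proof -
  interpret M: finite_borel_measure M by fact
  interpret N: finite_borel_measure N by fact
  have char: "(CLINT t|M. iexp (s * t)) = (CLINT t|N. iexp (s * t))" for s
  proof -
    obtain y where y: "y > 0" "(CLBINT v. iexp (s * y * v) * of_real (1 / (1 + v\<^sup>2))) \<noteq> 0"
      using exists_fourier_cauchy_density_neq_0 by blast
    have "(CLINT t|M. iexp (s * t)) * (CLBINT v. iexp (s * y * v) * of_real (1 / (1 + v\<^sup>2))) =
      (CLINT t|N. iexp (s * t)) * (CLBINT v. iexp (s * y * v) * of_real (1 / (1 + v\<^sup>2)))"
      using y by (simp only: M.fourier_Im_cauchy_transform[symmetric] N.fourier_Im_cauchy_transform[symmetric] eq
          complex.sel)
    then show ?thesis using y by (simp only: mult_cancel_right) simp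
  qed
  \<comment> \<open>At frequency 0 the Fourier transform is the total mass.\<close>
  from char[of 0] have mass: "measure M UNIV = measure N UNIV"
    using M.space_M N.space_M by simp
  show ?thesis
  proof (cases "measure M UNIV = 0")
    case True
    have "emeasure M A = 0 \<and> emeasure N A = 0" for A
    proof -
      have "emeasure M A \<le> emeasure M UNIV" "emeasure N A \<le> emeasure N UNIV"
        using emeasure_space[of M A] emeasure_space[of N A] M.space_M N.space_M by auto
      then show ?thesis using True mass by (simp add: measure_le_0_iff M.emeasure_eq_measure N.emeasure_eq_measure)
    qed
    then show ?thesis by (intro measure_eqI) (auto simp: M.M_is_borel N.M_is_borel)
  next
    case False
    define m where "m = measure M UNIV"
    have m: "m > 0" using False by (simp add: m_def order_less_le)
    define P where "P L = density L (\<lambda>_. ennreal (1 / m))" for L :: "real measure"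
    have em: "emeasure (P L) A = ennreal (1 / m) * emeasure L A"
      if "A \<in> sets borel" "sets L = sets borel" for A L
      using that by (simp add: P_def emeasure_density nn_integral_cmult_indicator)
    have rd: "real_distribution (P L)" if "finite_borel_measure L" "measure L UNIV = m" for L
    proof -
      interpret L: finite_borel_measure L by fact
      have sp: "space (P L) = UNIV" by (simp add: P_def L.space_M)
      have "emeasure (P L) UNIV = ennreal (1 / m) * ennreal m"
        using em[of UNIV L] L.M_is_borel that(2) by (simp add: L.emeasure_eq_measure)
      also have "\<dots> = ennreal (1 / m * m)" using m by (intro ennreal_mult[symmetric]) auto
      also have "\<dots> = 1" using m by simp
      finally have "prob_space (P L)"
        by (intro prob_spaceI) (simp only: sp)
      moreover have "sets (P L) = sets borel" by (simp add: P_def L.M_is_borel)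
      ultimately show ?thesis
        by (simp add: real_distribution_def real_distribution_axioms_def)
    qed
    have ch: "char (P L) s = (1 / m) *\<^sub>R (CLINT t|L. iexp (s * t))" if "finite_borel_measure L" for L s
    proof -
      interpret L: finite_borel_measure L by fact
      show ?thesis unfolding char_def P_def using m
        by (subst integral_density) (auto simp: L.measurable_M_eq)
    qed
    have "P M = P N"
    proof (rule Levy_uniqueness)
      show "real_distribution (P M)" by (rule rd[OF assms(1)]) (simp add: m_def)
      show "real_distribution (P N)" by (rule rd[OF assms(2)]) (simp only: m_def mass)
      show "char (P M) = char (P N)"
        by (rule ext) (simp only: ch[OF assms(1)] ch[OF assms(2)] char)
    qed
    show ?thesis
    proof (rule measure_eqI)
      fix A assume "A \<in> sets M"
      then have A: "A \<in> sets borel" by (simp add: M.M_is_borel)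
      have "ennreal (1 / m) * emeasure M A = ennreal (1 / m) * emeasure N A"
        using em[OF A M.M_is_borel] em[OF A N.M_is_borel] \<open>P M = P N\<close> by simp
      then show "emeasure M A = emeasure N A"
        using m by (subst (asm) ennreal_mult_cancel_left) auto
    qed (simp add: M.M_is_borel N.M_is_borel)
  qed
qed

section \<open>Nevanlinna functions\<close>

text \<open>The Nevanlinna form without a linear term in w, which the growth condition along the
  imaginary axis excludes. For nonreal w the kernel is bounded in x, so every finite Borel measure
  is admissible.\<close>

definition nevanlinna_fun :: "real \<Rightarrow> real measure \<Rightarrow> complex \<Rightarrow> complex" where
  "nevanlinna_fun \<gamma> \<sigma> w =
     complex_of_real \<gamma> + (LINT x|\<sigma>. (1 + w * complex_of_real x) / (w - complex_of_real x))"

context finite_borel_measure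
begin

text \<open>The first form reduces the integral to a Cauchy transform. In the second the summand x
  is independent of w and cancels when values at two points are subtracted.\<close>

lemma nevanlinna_kernel_eq:
  assumes "Im w \<noteq> 0"
  shows "(1 + w * complex_of_real x) / (w - complex_of_real x) = - w + (1 + w\<^sup>2) * (1 / (w - complex_of_real x))"
    and "(1 + w * complex_of_real x) / (w - complex_of_real x) = of_real x + of_real (1 + x\<^sup>2) * (1 / (w - complex_of_real x))"
  using diff_real_neq_0[OF assms, of x] by (auto simp: field_simps power2_eq_square)

lemma integrable_nevanlinna_kernel:
  assumes "Im w \<noteq> 0"
  shows "integrable M (\<lambda>x. (1 + w * complex_of_real x) / (w - complex_of_real x))"
  unfolding nevanlinna_kernel_eq(1)[OF assms]
  by (intro Bochner_Integration.integrable_add integrable_mult_right integrable_cauchy_kernel assms integrable_const)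

lemma nevanlinna_fun_eq:
  assumes "Im w \<noteq> 0"
  shows "nevanlinna_fun \<gamma> M w =
    of_real \<gamma> - w * of_real (measure M UNIV) + (1 + w\<^sup>2) * cauchy_transform M w"
proof -
  have "(LINT x|M. - w + (1 + w\<^sup>2) * (1 / (w - complex_of_real x))) =
      (LINT x|M. - w) + (LINT x|M. (1 + w\<^sup>2) * (1 / (w - complex_of_real x)))"
    by (intro Bochner_Integration.integral_add integrable_mult_right integrable_cauchy_kernel assms integrable_const)
  also have "\<dots> = - w * of_real (measure M UNIV) + (1 + w\<^sup>2) * cauchy_transform M w"
    by (simp only: integral_mult_right_zero cauchy_transform_def lebesgue_integral_const space_M)
       (simp add: scaleR_conv_of_real mult.commute)
  finally show ?thesis
    unfolding nevanlinna_fun_def nevanlinna_kernel_eq(1)[OF assms] by simp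
qed

lemma nevanlinna_fun_holomorphic: "nevanlinna_fun \<gamma> M holomorphic_on uhp"
proof -
  have "(\<lambda>w. of_real \<gamma> - w * of_real (measure M UNIV) + (1 + w\<^sup>2) * cauchy_transform M w) holomorphic_on uhp"
    by (intro holomorphic_intros cauchy_transform_holomorphic_on_uhp)
  then show ?thesis
    by (rule holomorphic_transform) (auto simp: nevanlinna_fun_eq)
qed

lemma Im_nevanlinna_fun:
  assumes "Im w \<noteq> 0"
  shows "Im (nevanlinna_fun \<gamma> M w) = - Im w * (LINT x|M. (1 + x\<^sup>2) / (cmod (w - of_real x))\<^sup>2)"
    and "integrable M (\<lambda>x. (1 + x\<^sup>2) / (cmod (w - of_real x))\<^sup>2)"
proof -
  have im: "Im ((1 + w * complex_of_real x) / (w - complex_of_real x)) = - Im w * ((1 + x\<^sup>2) / (cmod (w - of_real x))\<^sup>2)" for x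
  proof -
    have "Im ((1 + w * complex_of_real x) / (w - complex_of_real x)) =
        (Im w * x * (Re w - x) - (1 + Re w * x) * Im w) / (cmod (w - of_real x))\<^sup>2"
      by (simp add: Im_divide cmod_power2)
    also have "Im w * x * (Re w - x) - (1 + Re w * x) * Im w = - Im w * (1 + x\<^sup>2)"
      by (simp add: algebra_simps power2_eq_square)
    finally show ?thesis by simp
  qed
  have "integrable M (\<lambda>x. Im ((1 + w * complex_of_real x) / (w - complex_of_real x)))"
    by (rule integrable_Im[OF integrable_nevanlinna_kernel[OF assms]])
  then show int: "integrable M (\<lambda>x. (1 + x\<^sup>2) / (cmod (w - of_real x))\<^sup>2)"
    unfolding im using assms by (simp add: integrable_mult_right_iff del: times_divide_eq_right)
  have "Im (nevanlinna_fun \<gamma> M w) = (LINT x|M. Im ((1 + w * complex_of_real x) / (w - complex_of_real x)))"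
    unfolding nevanlinna_fun_def
    using integral_bounded_linear[OF bounded_linear_Im integrable_nevanlinna_kernel[OF assms]] by simp
  then show "Im (nevanlinna_fun \<gamma> M w) = - Im w * (LINT x|M. (1 + x\<^sup>2) / (cmod (w - of_real x))\<^sup>2)"
    unfolding im by (simp only: integral_mult_right_zero)
qed

lemma integrable_nevanlinna_kernel2:
  assumes "Im w1 \<noteq> 0" "Im w2 \<noteq> 0"
  shows "integrable M (\<lambda>x. of_real (1 + x\<^sup>2) * ((1 / (w1 - complex_of_real x)) * (1 / (w2 - complex_of_real x))))"
proof (rule Bochner_Integration.integrable_bound)
  show "integrable M (\<lambda>x. (1 + x\<^sup>2) / (cmod (w1 - of_real x))\<^sup>2 + (1 + x\<^sup>2) / (cmod (w2 - of_real x))\<^sup>2)"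
    using Im_nevanlinna_fun(2) assms by (intro Bochner_Integration.integrable_add) auto
  show "AE x in M. norm (of_real (1 + x\<^sup>2) * ((1 / (w1 - complex_of_real x)) * (1 / (w2 - complex_of_real x))))
      \<le> norm ((1 + x\<^sup>2) / (cmod (w1 - of_real x))\<^sup>2 + (1 + x\<^sup>2) / (cmod (w2 - of_real x))\<^sup>2)"
  proof (intro always_eventually allI)
    fix x
    define a b where "a = 1 / cmod (w1 - of_real x)" and "b = 1 / cmod (w2 - of_real x)"
    have "a * b \<le> a\<^sup>2 + b\<^sup>2"
      using sum_squares_bound[of a b] zero_le_power2[of a] zero_le_power2[of b] by linarith
    then have "(1 + x\<^sup>2) * (a * b) \<le> (1 + x\<^sup>2) * (a\<^sup>2 + b\<^sup>2)" by (intro mult_left_mono) auto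
    then show "norm (of_real (1 + x\<^sup>2) * ((1 / (w1 - complex_of_real x)) * (1 / (w2 - complex_of_real x))))
      \<le> norm ((1 + x\<^sup>2) / (cmod (w1 - of_real x))\<^sup>2 + (1 + x\<^sup>2) / (cmod (w2 - of_real x))\<^sup>2)"
      unfolding norm_mult norm_of_real norm_divide norm_one
      by (simp add: a_def b_def power_divide distrib_left del: of_real_add)
  qed
qed (auto simp: measurable_M_eq)

text \<open>The resolvent identity with weight 1 + x^2; it is used to show that w + H w is
  injective.\<close>

lemma nevanlinna_fun_diff:
  assumes "Im w1 \<noteq> 0" "Im w2 \<noteq> 0"
  shows "nevanlinna_fun \<gamma> M w1 - nevanlinna_fun \<gamma> M w2 =
    (w2 - w1) * (LINT x|M. of_real (1 + x\<^sup>2) * ((1 / (w1 - complex_of_real x)) * (1 / (w2 - complex_of_real x))))"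
proof -
  have "nevanlinna_fun \<gamma> M w1 - nevanlinna_fun \<gamma> M w2 =
    (LINT x|M. (1 + w1 * complex_of_real x) / (w1 - complex_of_real x) - (1 + w2 * complex_of_real x) / (w2 - complex_of_real x))"
    unfolding nevanlinna_fun_def using integrable_nevanlinna_kernel assms by simp
  also have "\<dots> = (LINT x|M. (w2 - w1) * (of_real (1 + x\<^sup>2) * ((1 / (w1 - complex_of_real x)) * (1 / (w2 - complex_of_real x)))))"
    unfolding nevanlinna_kernel_eq(2)[OF assms(1)] nevanlinna_kernel_eq(2)[OF assms(2)]
  proof (intro Bochner_Integration.integral_cong refl)
    fix x
    have "1 / a - 1 / b = (b - a) * ((1 / a) * (1 / b))" if "a \<noteq> 0" "b \<noteq> 0" for a b :: complex
      using that by (simp add: field_simps)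
    from this[OF diff_real_neq_0[OF assms(1), of x] diff_real_neq_0[OF assms(2), of x]]
    have "1 / (w1 - of_real x) - 1 / (w2 - of_real x) = (w2 - w1) * ((1 / (w1 - of_real x)) * (1 / (w2 - complex_of_real x)))"
      by simp
    then show "complex_of_real x + of_real (1 + x\<^sup>2) * (1 / (w1 - complex_of_real x)) -
          (of_real x + of_real (1 + x\<^sup>2) * (1 / (w2 - complex_of_real x))) =
         (w2 - w1) * (of_real (1 + x\<^sup>2) * ((1 / (w1 - complex_of_real x)) * (1 / (w2 - complex_of_real x))))"
      by (metis (no_types, lifting) add_diff_cancel_left mult.left_commute right_diff_distrib)
  qed
  finally show ?thesis by (simp only: integral_mult_right_zero)
qed

lemma tendsto_cauchy_transform_cone:
  assumes z: "\<And>n. z n \<in> trunc_cone \<eta> A" "A > 0" "filterlim z at_infinity sequentially"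
  shows "(\<lambda>n. z n * cauchy_transform M (z n)) \<longlonglongrightarrow> measure M UNIV"
proof -
  have "(\<lambda>n. LINT x|M. z n / (z n - complex_of_real x)) \<longlonglongrightarrow> (LINT x|M. 1)"
  proof (rule integral_dominated_convergence[where w="\<lambda>_. 1 + \<eta>"])
    show "AE x in M. (\<lambda>n. z n / (z n - complex_of_real x)) \<longlonglongrightarrow> 1"
      using tendsto_div_diff_real[OF z(3)] by (intro always_eventually) auto
    show "AE x in M. norm (z n / (z n - complex_of_real x)) \<le> 1 + \<eta>" for n
      using cmod_div_le_cone[OF z(1,2)] by (intro always_eventually) auto
  qed (auto simp: measurable_M_eq)
  moreover have "z n * cauchy_transform M (z n) = (LINT x|M. z n / (z n - complex_of_real x))" for n
    unfolding cauchy_transform_def by (subst integral_mult_right_zero[symmetric]) simp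
  ultimately show ?thesis by (simp add: space_M scaleR_conv_of_real)
qed

text \<open>The mass cancels: after division by w, the term - w m contributes - m, while (1 + w^2)
  times the Cauchy transform contributes m in the limit.\<close>

lemma tendsto_nevanlinna_fun_cone:
  assumes "A > 0"
  shows "((\<lambda>w. nevanlinna_fun \<gamma> M w / w) \<longlongrightarrow> 0) (inf at_infinity (principal (trunc_cone \<eta> A)))"
proof (rule tendsto_inf_at_infinityI)
  fix z :: "nat \<Rightarrow> complex"
  assume z: "\<And>n. z n \<in> trunc_cone \<eta> A" and zi: "filterlim z at_infinity sequentially"
  let ?m = "complex_of_real (measure M UNIV)"
  have nz: "z n \<noteq> 0" "Im (z n) \<noteq> 0" for n using z[of n] assms by (auto simp: trunc_cone_def)
  have inv: "(\<lambda>n. 1 / z n) \<longlonglongrightarrow> 0" by (rule tendsto_divide_0[OF tendsto_const zi])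
  have "(\<lambda>n. of_real \<gamma> * (1 / z n) - ?m + ((1 / z n)\<^sup>2 + 1) * (z n * cauchy_transform M (z n)))
      \<longlonglongrightarrow> of_real \<gamma> * 0 - ?m + (0\<^sup>2 + 1) * ?m"
    by (intro tendsto_intros inv tendsto_cauchy_transform_cone[OF z assms zi])
  moreover have "nevanlinna_fun \<gamma> M (z n) / z n = of_real \<gamma> * (1 / z n) - ?m + ((1 / z n)\<^sup>2 + 1) * (z n * cauchy_transform M (z n))" for n
    using nz[of n] by (simp add: nevanlinna_fun_eq field_simps power2_eq_square)
  ultimately show "(\<lambda>n. nevanlinna_fun \<gamma> M (z n) / z n) \<longlonglongrightarrow> 0" by simp
qed

end

lemma filterlim_iy: 
  assumes "\<eta> > 0" "A > 0"
  shows "filterlim (\<lambda>y. \<i> * complex_of_real y) (inf at_infinity (principal (trunc_cone \<eta> A))) at_top"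
  unfolding filterlim_inf filterlim_principal
proof
  show "filterlim (\<lambda>y. \<i> * complex_of_real y) at_infinity at_top"
    unfolding filterlim_at_infinity_conv_norm_at_top
    by (simp add: norm_mult filterlim_abs_real)
  show "\<forall>\<^sub>F y in at_top. \<i> * complex_of_real y \<in> trunc_cone \<eta> A"
    using eventually_gt_at_top[of A] by eventually_elim (use assms in \<open>auto intro: iy_in_trunc_cone\<close>)
qed

text \<open>The functions \<open>w \<mapsto> F\<^sup>-\<^sup>1 w - w\<close> of freely infinitely divisible measures.\<close>

definition free_levy_class :: "(complex \<Rightarrow> complex) set" where
  "free_levy_class = {H. H holomorphic_on uhp \<and> (\<forall>w\<in>uhp. Im (H w) \<le> 0) \<and>
     ((\<lambda>y. H (\<i> * complex_of_real y) / (\<i> * complex_of_real y)) \<longlongrightarrow> 0) at_top}"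

lemma (in finite_borel_measure) nevanlinna_fun_in_class: "nevanlinna_fun \<gamma> M \<in> free_levy_class"
  unfolding free_levy_class_def
  using nevanlinna_fun_holomorphic
    filterlim_compose[OF tendsto_nevanlinna_fun_cone[of 1] filterlim_iy[of 1 1]]
  by (auto simp: Im_nevanlinna_fun(1) intro!: mult_nonneg_nonneg integral_nonneg)

section \<open>The Herglotz and Nevanlinna representations\<close>

abbreviation circ :: "real \<Rightarrow> complex" where "circ t \<equiv> cis (2 * pi * t)"

lemma circlepath_eq_circ: "circlepath 0 1 t = circ t"
  unfolding circlepath cis_conv_exp by (simp add: algebra_simps)

lemma has_integral_circ_Cauchy:
  assumes "g holomorphic_on cball 0 1" "norm z < 1"
  shows "((\<lambda>t. g (circ t) * (circ t / (circ t - z))) has_integral g z) {0..1}"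
proof -
  have "((\<lambda>u. g u / (u - z)) has_contour_integral 2 * of_real pi * \<i> * g z) (circlepath 0 1)"
    using assms by (intro Cauchy_integral_circlepath_simple) auto
  then have "((\<lambda>t. g (circ t) / (circ t - z) * (2 * of_real pi * \<i> * circ t)) has_integral 2 * of_real pi * \<i> * g z) {0..1}"
    unfolding has_contour_integral_def
    by (rule has_integral_eq[rotated])
       (simp add: vector_derivative_circlepath01 circlepath_eq_circ cis_conv_exp mult_ac)
  then have "((\<lambda>t. (g (circ t) / (circ t - z) * (2 * of_real pi * \<i> * circ t)) * (1 / (2 * of_real pi * \<i>)))
      has_integral 2 * of_real pi * \<i> * g z * (1 / (2 * of_real pi * \<i>))) {0..1}"
    by (rule has_integral_mult_left)
  then show ?thesis by (simp add: field_simps)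
qed

lemma circ_diff_neq_0: "norm z < 1 \<Longrightarrow> circ t - z \<noteq> 0"
  using norm_cis[of "2 * pi * t"] by (auto simp del: norm_cis)

text \<open>The Schwarz integral formula, which recovers g from the real part of its boundary values
  and Im (g 0). It averages an integral of g and an integral of its conjugate against the same
  kernel.\<close>

lemma has_integral_circ_Schwarz:
  assumes g: "g holomorphic_on cball 0 1" and z: "norm z < 1"
  shows "((\<lambda>t. of_real (Re (g (circ t))) * ((circ t + z) / (circ t - z))) has_integral
           g z - \<i> * of_real (Im (g 0))) {0..1}"
proof -
  have nz: "circ t - z \<noteq> 0" for t by (rule circ_diff_neq_0[OF z])
  have mean: "((\<lambda>t. h (circ t)) has_integral h 0) {0..1}" if "h holomorphic_on cball 0 1" for h
    using has_integral_circ_Cauchy[OF that, of 0] by simp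
  have P: "(circ t + z) / (circ t - z) = 2 * (circ t / (circ t - z)) - 1" for t
    using nz[of t] by (simp add: field_simps)
  have "((\<lambda>t. 2 * (g (circ t) * (circ t / (circ t - z))) - g (circ t)) has_integral 2 * g z - g 0) {0..1}"
    by (intro has_integral_diff has_integral_mult_right has_integral_circ_Cauchy mean g z)
  then have 1: "((\<lambda>t. g (circ t) * ((circ t + z) / (circ t - z))) has_integral 2 * g z - g 0) {0..1}"
    unfolding P by (simp add: algebra_simps)
  have nz': "1 - cnj z * u \<noteq> 0" if "norm u \<le> 1" for u
  proof
    assume "1 - cnj z * u = 0"
    then have "norm (cnj z * u) = 1" by (metis norm_one right_minus_eq)
    moreover have "norm (cnj z * u) \<le> norm z * 1" unfolding norm_mult using that by (intro mult_mono) auto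
    ultimately show False using z by simp
  qed
  \<comment> \<open>The reflected kernel is holomorphic on the closed disc and equals 1 at 0, so the
    mean is g 0. On the circle, where u * cnj u = 1, its conjugate is the Schwarz kernel.\<close>
  have "((\<lambda>t. g (circ t) * ((1 + cnj z * circ t) / (1 - cnj z * circ t))) has_integral g 0 * ((1 + cnj z * 0) / (1 - cnj z * 0))) {0..1}"
    by (rule mean[of "\<lambda>u. g u * ((1 + cnj z * u) / (1 - cnj z * u))"])
       (intro holomorphic_intros g nz', simp)
  then have "((\<lambda>t. g (circ t) * ((1 + cnj z * circ t) / (1 - cnj z * circ t))) has_integral g 0) {0..1}"
    by simp
  from this[THEN has_integral_cnj[THEN iffD2], unfolded o_def]
  have "((\<lambda>t. cnj (g (circ t) * ((1 + cnj z * circ t) / (1 - cnj z * circ t)))) has_integral cnj (g 0)) {0..1}" .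
  moreover have "cnj (a * ((1 + cnj z * c) / (1 - cnj z * c))) = cnj a * ((c + z) / (c - z))" if c: "c * cnj c = 1" for a c
  proof -
    have "c * (1 + z * cnj c) = c + z" "c * (1 - z * cnj c) = c - z"
      using c by (simp_all add: distrib_left right_diff_distrib mult.left_commute)
    then have "(c + z) / (c - z) = (c * (1 + z * cnj c)) / (c * (1 - z * cnj c))" by (simp only:)
    also have "\<dots> = (1 + z * cnj c) / (1 - z * cnj c)"
      using c by (intro mult_divide_mult_cancel_left) auto
    finally show ?thesis
      by (simp only: complex_cnj_mult complex_cnj_divide complex_cnj_add complex_cnj_diff complex_cnj_one complex_cnj_cnj)
  qed
  moreover have "circ t * cnj (circ t) = 1" for t by (simp add: cis_cnj cis_mult)
  ultimately have 2: "((\<lambda>t. cnj (g (circ t)) * ((circ t + z) / (circ t - z))) has_integral cnj (g 0)) {0..1}"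
    by (simp only:)
  have "((\<lambda>t. (g (circ t) * ((circ t + z) / (circ t - z)) + cnj (g (circ t)) * ((circ t + z) / (circ t - z))) * (1 / 2))
    has_integral (2 * g z - g 0 + cnj (g 0)) * (1 / 2)) {0..1}"
    by (intro has_integral_mult_left has_integral_add 1 2)
  moreover have "(a * q + cnj a * q) * (1 / 2) = of_real (Re a) * q" for a q
    by (simp only: distrib_right[symmetric] complex_add_cnj) simp
  moreover have "(2 * g z - g 0 + cnj (g 0)) * (1 / 2) = g z - \<i> * of_real (Im (g 0))"
    by (simp add: complex_eq_iff)
  ultimately show ?thesis by (simp only:)
qed

lemma norm_circ_kernel_le:
  assumes "norm z < 1"
  shows "norm ((circ t + z) / (circ t - z)) \<le> 2 / (1 - norm z)"
proof -
  have "norm (circ t + z) \<le> 2" using norm_triangle_ineq[of "circ t" z] assms by simp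
  moreover have "norm (circ t - z) \<ge> 1 - norm z" using norm_triangle_ineq2[of "circ t" z] by simp
  ultimately show ?thesis unfolding norm_divide using assms by (intro frac_le) auto
qed

lemma isCont_circ: "isCont circ t"
  unfolding cis_conv_exp by (intro continuous_intros)

lemma isCont_circ_kernel: "norm z < 1 \<Longrightarrow> isCont (\<lambda>t. (circ t + z) / (circ t - z)) t"
  using circ_diff_neq_0[of z t] by (intro continuous_intros isCont_circ) auto

text \<open>For r < 1 the function p (r u) is holomorphic on the closed disc, so its real part on
  the circle is a continuous nonnegative weight, normalised by the mean value property. The set
  \<open>{-1<..1}\<close> contains [0, 1] and has the half-open shape used by
  \<open>tight\<close>.\<close>

lemma Schwarz_measure:
  assumes p: "p holomorphic_on ball 0 1" and Re_p: "\<And>z. norm z < 1 \<Longrightarrow> Re (p z) \<ge> 0"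
    and p0: "Re (p 0) > 0" and r: "0 < r" "r < 1"
  shows "\<exists>m. real_distribution m \<and> measure m {-1<..1} = 1 \<and>
    (\<forall>z. norm z < 1 \<longrightarrow> of_real (Re (p 0)) * (LINT t|m. (circ t + z) / (circ t - z)) = p (of_real r * z) - \<i> * of_real (Im (p 0)))"
proof -
  define d where "d t = Re (p (of_real r * circ t)) / Re (p 0)" for t
  have r_ball: "norm (of_real r * u) < 1" if "norm u \<le> 1" for u :: complex
  proof -
    have "norm (of_real r * u) \<le> r * 1" using that r by (simp add: norm_mult mult_left_le)
    then show ?thesis using r by simp
  qed
  have g: "(\<lambda>u. p (of_real r * u)) holomorphic_on cball 0 1"
  proof -
    have "(p \<circ> (\<lambda>u. of_real r * u)) holomorphic_on cball 0 1"
      by (rule holomorphic_on_compose_gen[OF _ p]) (auto intro!: holomorphic_intros r_ball)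
    then show ?thesis by (simp add: o_def)
  qed
  have d_nonneg: "d t \<ge> 0" for t
    using Re_p[OF r_ball[of "circ t"]] p0 by (simp add: d_def)
  have cont_d: "continuous_on UNIV d"
  proof -
    have "continuous_on UNIV ((\<lambda>u. p (of_real r * u)) \<circ> circ)"
      by (rule continuous_on_compose)
         (auto intro!: continuous_intros continuous_on_subset[OF holomorphic_on_imp_continuous_on[OF g]])
    then show ?thesis unfolding d_def o_def using p0 by (intro continuous_intros) auto
  qed
  have d_meas [measurable]: "d \<in> borel_measurable borel"
    by (rule borel_measurable_continuous_onI[OF cont_d])
  define m where "m = density lborel (\<lambda>t. ennreal (indicator {0..1} t * d t))"
  have intd: "set_integrable lborel {0..1} (\<lambda>t. f t * of_real (d t))" 
    and vald: "(LINT t|m. f t) = integral {0..1} (\<lambda>t. f t * of_real (d t))" if f: "continuous_on UNIV f" for f :: "real \<Rightarrow> complex"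
  proof -
    have f_meas [measurable]: "f \<in> borel_measurable borel"
      by (rule borel_measurable_continuous_onI[OF f])
    show si: "set_integrable lborel {0..1} (\<lambda>t. f t * of_real (d t))"
      by (rule borel_integrable_atLeastAtMost')
         (intro continuous_intros continuous_on_subset[OF f] continuous_on_subset[OF cont_d], auto)
    have "(LINT t|m. f t) = (LINT t|lborel. (indicator {0..1} t * d t) *\<^sub>R f t)"
      unfolding m_def by (rule integral_density) (auto simp: d_nonneg)
    also have "\<dots> = (LINT t:{0..1}|lborel. f t * of_real (d t))"
      unfolding set_lebesgue_integral_def
      by (intro Bochner_Integration.integral_cong) (auto simp: scaleR_conv_of_real indicator_def)
    finally show "(LINT t|m. f t) = integral {0..1} (\<lambda>t. f t * of_real (d t))"
      using set_borel_integral_eq_integral(2)[OF si] by simp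
  qed
  have key: "of_real (Re (p 0)) * (LINT t|m. (circ t + z) / (circ t - z)) = p (of_real r * z) - \<i> * of_real (Im (p 0))"
    if z: "norm z < 1" for z
  proof -
    have "((\<lambda>t. of_real (Re (p (of_real r * circ t))) * ((circ t + z) / (circ t - z))) has_integral
           p (of_real r * z) - \<i> * of_real (Im (p 0))) {0..1}"
      using has_integral_circ_Schwarz[OF g z] by simp
    from has_integral_mult_right[OF this, of "1 / of_real (Re (p 0))"]
    have "((\<lambda>t. (circ t + z) / (circ t - z) * of_real (d t)) has_integral
           (1 / of_real (Re (p 0))) * (p (of_real r * z) - \<i> * of_real (Im (p 0)))) {0..1}"
      by (rule has_integral_eq[rotated]) (simp add: d_def mult.commute)
    then have "integral {0..1} (\<lambda>t. (circ t + z) / (circ t - z) * of_real (d t)) =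
      (1 / of_real (Re (p 0))) * (p (of_real r * z) - \<i> * of_real (Im (p 0)))"
      by (rule integral_unique)
    moreover have "continuous_on UNIV (\<lambda>t. (circ t + z) / (circ t - z))"
      using isCont_circ_kernel[OF z] by (simp add: continuous_on_eq_continuous_at)
    ultimately show ?thesis using p0 by (simp add: vald)
  qed
  have "emeasure m A = ennreal (LINT t:{0..1}|lborel. d t)" if "A \<in> sets borel" "{0..1} \<subseteq> A" for A
  proof -
    have si: "set_integrable lborel {0..1} d"
      by (rule borel_integrable_atLeastAtMost') (rule continuous_on_subset[OF cont_d], simp)
    have "emeasure m A = (\<integral>\<^sup>+t. ennreal (indicator {0..1} t * d t) * indicator A t \<partial>lborel)"
      unfolding m_def using that by (subst emeasure_density) auto
    also have "\<dots> = (\<integral>\<^sup>+t. ennreal (indicator {0..1} t *\<^sub>R d t) \<partial>lborel)"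
      using that by (intro nn_integral_cong) (auto simp: indicator_def)
    also have "\<dots> = ennreal (LINT t|lborel. indicator {0..1} t *\<^sub>R d t)"
      using si d_nonneg by (intro nn_integral_eq_integral) (auto simp: set_integrable_def)
    finally show ?thesis by (simp add: set_lebesgue_integral_def)
  qed
  moreover have "(LINT t:{0..1}|lborel. d t) = 1"
  proof -
    have "((\<lambda>t. p (of_real r * circ t)) has_integral p 0) {0..1}"
      using has_integral_circ_Cauchy[OF g, of 0] by simp
    from has_integral_divide[OF has_integral_Re[OF this], of "Re (p 0)"]
    have "integral {0..1} d = 1" using p0 unfolding d_def by (intro integral_unique) simp
    moreover have "set_integrable lborel {0..1} d"
      by (rule borel_integrable_atLeastAtMost') (rule continuous_on_subset[OF cont_d], simp)
    ultimately show ?thesis by (simp add: set_borel_integral_eq_integral(2))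
  qed
  ultimately have em: "emeasure m A = 1" if "A \<in> sets borel" "{0..1} \<subseteq> A" for A
    using that by simp
  have space_m: "space m = UNIV" by (simp add: m_def)
  have "prob_space m" by (rule prob_spaceI) (simp add: em space_m)
  moreover have "sets m = sets borel" by (simp add: m_def)
  ultimately have "real_distribution m"
    by (simp add: real_distribution_def real_distribution_axioms_def)
  moreover have "measure m {-1<..1} = 1"
    by (simp add: measure_def em subset_iff)
  ultimately show ?thesis using key by blast
qed

lemma finite_borel_measureI:
  "emeasure M (space M) \<noteq> \<infinity> \<Longrightarrow> sets M = sets borel \<Longrightarrow> finite_borel_measure M"
  by (simp add: finite_borel_measure_def finite_borel_measure_axioms_def finite_measureI)

text \<open>All approximating measures live on one bounded interval, so a subsequence converges
  weakly as the radius tends to 1; the kernel is bounded and continuous, and the representation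
  passes to the limit.\<close>

theorem Herglotz_representation:
  assumes p: "p holomorphic_on ball 0 1" and Re_p: "\<And>z. norm z < 1 \<Longrightarrow> Re (p z) \<ge> 0"
  shows "\<exists>M. finite_borel_measure M \<and> (\<forall>z. norm z < 1 \<longrightarrow>
    p z = \<i> * of_real (Im (p 0)) + (LINT t|M. (circ t + z) / (circ t - z)))"
proof (cases "Re (p 0) = 0")
  case True
  \<comment> \<open>A nonconstant p would be open at 0 and take values with negative real part. The
    representing measure is then zero.\<close>
  have "p constant_on ball 0 1"
  proof (rule ccontr)
    assume "\<not> p constant_on ball 0 1"
    then have "open (p ` ball 0 1)"
      using open_mapping_thm[OF p open_ball _ open_ball subset_refl] connected_ball by blast
    then obtain e where e: "e > 0" "ball (p 0) e \<subseteq> p ` ball 0 1"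
      by (meson centre_in_ball image_eqI open_contains_ball zero_less_one)
    have "p 0 - of_real (e / 2) \<in> ball (p 0) e" using e by (simp add: dist_norm)
    then have "p 0 - of_real (e / 2) \<in> p ` ball 0 1" using e by blast
    then obtain z where z: "norm z < 1" "p z = p 0 - of_real (e / 2)" by (rule imageE) simp
    then show False using Re_p[OF z(1)] True e by simp
  qed
  then have c: "p z = p 0" if "norm z < 1" for z
    using that unfolding constant_on_def by (metis centre_in_ball mem_ball_0 zero_less_one)
  have "finite_borel_measure (null_measure borel)"
    by (rule finite_borel_measureI) auto
  moreover have "p z = \<i> * of_real (Im (p 0)) + (LINT t|null_measure borel. (circ t + z) / (circ t - z))" if "norm z < 1" for z
    using c[OF that] True by (simp add: complex_eq_iff)
  ultimately show ?thesis by blast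
next
  case False
  then have p0: "Re (p 0) > 0" using Re_p[of 0] by simp
  \<comment> \<open>The shift by 2 keeps every radius strictly between 0 and 1, including n =
    0.\<close>
  define r where "r n = 1 - 1 / real (n + 2)" for n
  have r: "0 < r n" "r n < 1" for n by (auto simp: r_def field_simps)
  have "\<exists>m. \<forall>n. real_distribution (m n) \<and> measure (m n) {-1<..1} = 1 \<and> (\<forall>z. norm z < 1 \<longrightarrow>
      of_real (Re (p 0)) * (LINT t|m n. (circ t + z) / (circ t - z)) = p (of_real (r n) * z) - \<i> * of_real (Im (p 0)))"
    by (intro choice allI Schwarz_measure p Re_p p0 r)
  then obtain m where "\<forall>n. real_distribution (m n) \<and> measure (m n) {-1<..1} = 1 \<and> (\<forall>z. norm z < 1 \<longrightarrow>
      of_real (Re (p 0)) * (LINT t|m n. (circ t + z) / (circ t - z)) = p (of_real (r n) * z) - \<i> * of_real (Im (p 0)))" ..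
  then have m: "\<And>n. real_distribution (m n)" "\<And>n. measure (m n) {-1<..1} = 1"
    "\<And>n z. norm z < 1 \<Longrightarrow> of_real (Re (p 0)) * (LINT t|m n. (circ t + z) / (circ t - z)) = p (of_real (r n) * z) - \<i> * of_real (Im (p 0))"
    by simp_all
  have "tight m"
    unfolding tight_def
  proof (intro conjI allI impI m)
    fix \<epsilon> :: real assume "\<epsilon> > 0"
    then show "\<exists>a b. a < b \<and> (\<forall>n. 1 - \<epsilon> < measure (m n) {a<..b})"
      by (intro exI[of _ "-1"] exI[of _ 1]) (auto simp: m)
  qed
  from tight_imp_convergent_subsubsequence[OF this strict_mono_id]
  obtain s N where s: "strict_mono s" and N: "real_distribution N" and wc: "weak_conv_m (m \<circ> s) N"
    by (auto simp: o_def)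
  have lim: "of_real (Re (p 0)) * (LINT t|N. (circ t + z) / (circ t - z)) = p z - \<i> * of_real (Im (p 0))"
    if z: "norm z < 1" for z
  proof -
    have "(\<lambda>n. LINT t|(m \<circ> s) n. (circ t + z) / (circ t - z)) \<longlonglongrightarrow> (LINT t|N. (circ t + z) / (circ t - z))"
      by (rule weak_conv_imp_integral_bdd_continuous_conv[OF _ N wc isCont_circ_kernel[OF z] norm_circ_kernel_le[OF z]])
         (simp add: m)
    then have 1: "(\<lambda>n. of_real (Re (p 0)) * (LINT t|(m \<circ> s) n. (circ t + z) / (circ t - z)))
        \<longlonglongrightarrow> of_real (Re (p 0)) * (LINT t|N. (circ t + z) / (circ t - z))"
      by (intro tendsto_intros)
    have "r \<longlonglongrightarrow> 1 - 0"
      unfolding r_def by (intro tendsto_intros LIMSEQ_ignore_initial_segment[OF lim_1_over_n])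
    then have "(\<lambda>n. complex_of_real (r n) * z) \<longlonglongrightarrow> of_real 1 * z"
      by (intro tendsto_intros) simp
    moreover have "isCont p z"
      using holomorphic_on_imp_continuous_on[OF p] z by (auto simp: continuous_on_eq_continuous_at)
    ultimately have "(\<lambda>n. p (complex_of_real (r n) * z)) \<longlonglongrightarrow> p z"
      using isCont_tendsto_compose[of z p] by simp
    from LIMSEQ_subseq_LIMSEQ[OF this s]
    have "(\<lambda>n. p (complex_of_real (r (s n)) * z) - \<i> * of_real (Im (p 0))) \<longlonglongrightarrow> p z - \<i> * of_real (Im (p 0))"
      by (intro tendsto_intros) (simp add: o_def)
    with 1 show ?thesis by (intro LIMSEQ_unique) (auto simp: m(3)[OF z])
  qed
  interpret N: real_distribution N by fact
  define M where "M = density N (\<lambda>_. ennreal (Re (p 0)))"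
  have "finite_borel_measure M"
  proof (rule finite_borel_measureI)
    show "sets M = sets borel" by (simp add: M_def)
    show "emeasure M (space M) \<noteq> \<infinity>"
      by (simp add: M_def emeasure_density nn_integral_cmult_indicator N.emeasure_eq_measure ennreal_mult_eq_top_iff)
  qed
  moreover have "(LINT t|M. (circ t + z) / (circ t - z)) = of_real (Re (p 0)) * (LINT t|N. (circ t + z) / (circ t - z))" if "norm z < 1" for z
  proof -
    have "(\<lambda>t. (circ t + z) / (circ t - z)) \<in> borel_measurable N"
      using isCont_circ_kernel[OF that] unfolding N.measurable_M_eq
      by (intro borel_measurable_continuous_onI) (auto simp: continuous_on_eq_continuous_at)
    then show ?thesis
      unfolding M_def using p0 by (subst integral_density) (simp_all add: scaleR_conv_of_real del: times_divide_eq_right)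
  qed
  ultimately show ?thesis using lim by (intro exI[of _ M]) auto
qed

section \<open>The Cayley transform between the disc and the upper half-plane\<close>

lemma Cayley_in_disc: "Im w > 0 \<Longrightarrow> norm ((w - \<i>) / (w + \<i>)) < 1"
proof -
  assume w: "Im w > 0"
  have "(norm (w - \<i>))\<^sup>2 < (norm (w + \<i>))\<^sup>2"
    using w unfolding cmod_power2 by (simp add: power2_eq_square algebra_simps)
  then have "norm (w - \<i>) < norm (w + \<i>)" by (rule power_less_imp_less_base) simp
  then show ?thesis by (simp add: norm_divide divide_less_eq) 
qed

lemma Im_inverse_Cayley_eq: "Im (\<i> * (1 + z) / (1 - z)) = (1 - (norm z)\<^sup>2) / (norm (1 - z))\<^sup>2"
  by (simp add: Im_divide cmod_power2) (simp add: power2_eq_square algebra_simps)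

lemma Im_inverse_Cayley:
  assumes "norm z < 1" shows "Im (\<i> * (1 + z) / (1 - z)) > 0"
  unfolding Im_inverse_Cayley_eq
proof -
  have "(norm z)\<^sup>2 < 1" using assms abs_square_less_1[of "norm z"] by simp
  moreover have "1 - z \<noteq> 0" using assms by auto
  ultimately show "0 < (1 - (norm z)\<^sup>2) / (norm (1 - z))\<^sup>2" by simp
qed

text \<open>In half-plane coordinates the Schwarz kernel is the Nevanlinna kernel up to the factor -
  \<i>. This is the origin of the numerator 1 + w x.\<close>

lemma Cayley_kernel_eq:
  fixes e z :: complex
  assumes "e \<noteq> 1" "z \<noteq> 1" "e \<noteq> z"
  shows "(1 + (\<i> * (1 + z) / (1 - z)) * (\<i> * (1 + e) / (1 - e))) / (\<i> * (1 + z) / (1 - z) - \<i> * (1 + e) / (1 - e))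
    = - \<i> * ((e + z) / (e - z))"
proof -
  have nz: "1 - e \<noteq> 0" "1 - z \<noteq> 0" "e - z \<noteq> 0" using assms by auto
  have 1: "1 + (\<i> * (1 + z) / (1 - z)) * (\<i> * (1 + e) / (1 - e)) = - 2 * (e + z) / ((1 - z) * (1 - e))"
  proof -
    have "(\<i> * (1 + z) / (1 - z)) * (\<i> * (1 + e) / (1 - e)) = - ((1 + z) * (1 + e)) / ((1 - z) * (1 - e))"
    proof -
      have "\<i> * a * (\<i> * b) = (\<i> * \<i>) * (a * b)" for a b by (simp only: mult_ac)
      then show ?thesis by (simp add: times_divide_times_eq)
    qed
    then show ?thesis using nz by (simp add: divide_simps) (simp add: algebra_simps)
  qed
  have 2: "\<i> * (1 + z) / (1 - z) - \<i> * (1 + e) / (1 - e) = - 2 * \<i> * (e - z) / ((1 - z) * (1 - e))"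
    using nz by (simp add: divide_simps) (simp add: algebra_simps)
  show ?thesis unfolding 1 2 using nz by (simp add: divide_simps) (simp add: algebra_simps)
qed

text \<open>The Cayley map carries the circle without 1 onto the real line and the point 1 to
  infinity. Mass at 1 becomes a linear term, which the growth condition removes; the remaining mass
  is moved to the line.\<close>

theorem Nevanlinna_representation:
  assumes H: "H \<in> free_levy_class"
  shows "\<exists>\<gamma> \<sigma>. finite_borel_measure \<sigma> \<and> (\<forall>w. Im w > 0 \<longrightarrow> H w = nevanlinna_fun \<gamma> \<sigma> w)"
proof -
  have Hh: "H holomorphic_on uhp" and Hi: "\<And>w. Im w > 0 \<Longrightarrow> Im (H w) \<le> 0"
    and Hl: "((\<lambda>y. H (\<i> * complex_of_real y) / (\<i> * complex_of_real y)) \<longlongrightarrow> 0) at_top"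
    using H by (auto simp: free_levy_class_def)
  define \<phi> where "\<phi> z = \<i> * (1 + z) / (1 - z)" for z :: complex
  \<comment> \<open>Multiplication by \<i> turns Im H \<le> 0 into Re p \<ge> 0.\<close>
  define p where "p z = \<i> * H (\<phi> z)" for z
  have "\<phi> holomorphic_on ball 0 1"
    unfolding \<phi>_def by (intro holomorphic_intros) auto
  then have "(H \<circ> \<phi>) holomorphic_on ball 0 1"
    by (rule holomorphic_on_compose_gen[OF _ Hh]) (auto simp: \<phi>_def Im_inverse_Cayley)
  then have ph: "p holomorphic_on ball 0 1"
    unfolding p_def by (intro holomorphic_intros) (simp add: o_def)
  have Rp: "Re (p z) \<ge> 0" if "norm z < 1" for z
    using Hi[of "\<phi> z"] Im_inverse_Cayley[OF that] by (simp add: p_def \<phi>_def)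
  from Herglotz_representation[OF ph Rp] obtain M where M: "finite_borel_measure M"
    and rep: "\<And>z. norm z < 1 \<Longrightarrow> p z = \<i> * of_real (Im (p 0)) + (LINT t|M. (circ t + z) / (circ t - z))"
    by blast
  interpret M: finite_borel_measure M by fact
  note [measurable_cong] = M.M_is_borel
  define X where "X t = Re (\<i> * (1 + circ t) / (1 - circ t))" for t
  \<comment> \<open>The parameters of the boundary point that corresponds to infinity; outside this
    set the Cayley image of \<open>circ t\<close> is real and equals \<open>X t\<close>.\<close>
  define A where "A = {t. circ t = 1}"
  have circ_meas [measurable]: "circ \<in> borel_measurable borel"
    by (intro borel_measurable_continuous_onI continuous_intros)
  have X_meas [measurable]: "X \<in> borel_measurable borel" unfolding X_def by measurable
  have A_meas [measurable]: "A \<in> sets borel" unfolding A_def by measurable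
  have X: "of_real (X t) = \<i> * (1 + circ t) / (1 - circ t)" if "t \<notin> A" for t
  proof -
    have "Im (\<i> * (1 + circ t) / (1 - circ t)) = 0"
      by (simp add: Im_inverse_Cayley_eq)
    then show ?thesis by (simp add: X_def complex_eq_iff)
  qed
  define N where "N = density M (\<lambda>t. ennreal (indicator (- A) t))"
  define \<sigma> where "\<sigma> = distr N borel X"
  have "finite_measure N"
  proof
    have "emeasure N (space N) = (\<integral>\<^sup>+t. ennreal (indicator (- A) t) * indicator (space M) t \<partial>M)"
      by (simp add: N_def emeasure_density)
    also have "\<dots> \<le> (\<integral>\<^sup>+t. 1 \<partial>M)" by (intro nn_integral_mono) (auto simp: indicator_def)
    also have "\<dots> < \<infinity>" by (simp add: less_top[symmetric])
    finally show "emeasure N (space N) \<noteq> \<infinity>" by simp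
  qed
  then have \<sigma>: "finite_borel_measure \<sigma>"
    unfolding \<sigma>_def finite_borel_measure_def finite_borel_measure_axioms_def
    by (auto intro!: finite_measure.finite_measure_distr simp: N_def)
  interpret \<sigma>: finite_borel_measure \<sigma> by fact
  define m0 where "m0 = measure M A"
  define \<gamma> where "\<gamma> = Im (p 0)"
  \<comment> \<open>On \<open>A\<close> the Schwarz kernel times - \<i> is - \<i> (1 + z) / (1 - z)
    = - w, so this part of the measure integrates to the linear term.\<close>
  have eq: "H w = - of_real m0 * w + nevanlinna_fun \<gamma> \<sigma> w" if w: "Im w > 0" for w
  proof -
    define z where "z = (w - \<i>) / (w + \<i>)"
    have z: "norm z < 1" unfolding z_def by (rule Cayley_in_disc[OF w])
    have wi: "w + \<i> \<noteq> 0" using w by (auto simp: complex_eq_iff)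
    have "1 + z = 2 * w / (w + \<i>)" "1 - z = 2 * \<i> / (w + \<i>)"
      using wi by (simp_all add: z_def divide_simps)
    then have "\<phi> z = w" unfolding \<phi>_def using wi by simp
    then have "H w = - \<i> * p z" by (simp add: p_def)
    also have "\<dots> = of_real \<gamma> + - \<i> * (LINT t|M. (circ t + z) / (circ t - z))"
      using rep[OF z] by (simp add: \<gamma>_def algebra_simps)
    also have "- \<i> * (LINT t|M. (circ t + z) / (circ t - z)) = (LINT t|M. - \<i> * ((circ t + z) / (circ t - z)))"
      by (simp only: integral_mult_right_zero)
    also have "\<dots> = (LINT t|M. - w * of_real (indicator A t) + indicator (- A) t *\<^sub>R ((1 + w * of_real (X t)) / (w - of_real (X t))))"
    proof (intro Bochner_Integration.integral_cong refl)
      fix t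
      show "- \<i> * ((circ t + z) / (circ t - z)) = - w * of_real (indicator A t) + indicator (- A) t *\<^sub>R ((1 + w * of_real (X t)) / (w - of_real (X t)))"
      proof (cases "t \<in> A")
        case True
        then show ?thesis using \<open>\<phi> z = w\<close> by (auto simp: A_def \<phi>_def)
      next
        case False
        have ne: "circ t \<noteq> z" using circ_diff_neq_0[OF z, of t] by auto
        have "(1 + w * of_real (X t)) / (w - of_real (X t)) = - \<i> * ((circ t + z) / (circ t - z))"
          unfolding X[OF False] \<open>\<phi> z = w\<close>[symmetric] \<phi>_def
          by (rule Cayley_kernel_eq) (use False z ne in \<open>auto simp: A_def\<close>)
        then show ?thesis using False by simp
      qed
    qed
    also have "\<dots> = (LINT t|M. - w * of_real (indicator A t)) + (LINT t|M. indicator (- A) t *\<^sub>R ((1 + w * of_real (X t)) / (w - of_real (X t))))"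
    proof (intro Bochner_Integration.integral_add)
      show "integrable M (\<lambda>t. - w * complex_of_real (indicator A t))"
        by (rule M.integrable_boundedI[where B="norm w"]) (auto simp: indicator_def)
      have "integrable \<sigma> (\<lambda>x. (1 + w * complex_of_real x) / (w - complex_of_real x))"
        using \<sigma>.integrable_nevanlinna_kernel[of w] w by simp
      then have "integrable N (\<lambda>t. (1 + w * of_real (X t)) / (w - complex_of_real (X t)))"
        unfolding \<sigma>_def by (subst (asm) integrable_distr_eq) (auto simp: N_def)
      then show "integrable M (\<lambda>t. indicator (- A) t *\<^sub>R ((1 + w * of_real (X t)) / (w - complex_of_real (X t))))"
        unfolding N_def by (subst (asm) integrable_density) auto
    qed
    also have "(LINT t|M. - w * of_real (indicator A t)) = - of_real m0 * w"
      unfolding m0_def by (simp add: integral_complex_of_real)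
    also have "(LINT t|M. indicator (- A) t *\<^sub>R ((1 + w * of_real (X t)) / (w - of_real (X t)))) = (LINT x|\<sigma>. (1 + w * of_real x) / (w - of_real x))"
      unfolding \<sigma>_def N_def by (subst integral_distr, simp, simp, subst integral_density) auto
    finally show ?thesis by (simp add: nevanlinna_fun_def)
  qed
  have "((\<lambda>y. - of_real m0 + nevanlinna_fun \<gamma> \<sigma> (\<i> * complex_of_real y) / (\<i> * complex_of_real y)) \<longlongrightarrow> - of_real m0 + 0) at_top"
    by (intro tendsto_intros filterlim_compose[OF \<sigma>.tendsto_nevanlinna_fun_cone[of 1] filterlim_iy[of 1 1]]) auto
  moreover have "\<forall>\<^sub>F y in at_top. - of_real m0 + nevanlinna_fun \<gamma> \<sigma> (\<i> * complex_of_real y) / (\<i> * complex_of_real y) = H (\<i> * complex_of_real y) / (\<i> * complex_of_real y)"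
    using eventually_gt_at_top[of 0] by eventually_elim (simp add: eq diff_divide_distrib)
  ultimately have "((\<lambda>y. H (\<i> * complex_of_real y) / (\<i> * complex_of_real y)) \<longlongrightarrow> - of_real m0) at_top"
    by (auto dest: tendsto_cong[THEN iffD1])
  then have "- complex_of_real m0 = 0" by (rule tendsto_unique[OF _ _ Hl, rotated]) simp
  with eq \<sigma> show ?thesis by (intro exI[of _ \<gamma>] exI[of _ \<sigma>]) auto
qed

section \<open>Measures with prescribed inverse of the reciprocal Cauchy transform\<close>

text \<open>The normalisation at infinity forces 1 + x^2 to have integral 1 against the Nevanlinna
  measure. Weighting that measure by 1 + x^2 gives the law, up to an additive constant of G that
  must vanish.\<close>

theorem cauchy_transform_characterization:
  assumes G: "G holomorphic_on uhp" and Im_G: "\<And>w. Im w > 0 \<Longrightarrow> Im (G w) \<le> 0"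
    and lim: "((\<lambda>y. \<i> * complex_of_real y * G (\<i> * complex_of_real y)) \<longlongrightarrow> 1) at_top"
  shows "\<exists>\<rho>. real_distribution \<rho> \<and> (\<forall>w. Im w > 0 \<longrightarrow> G w = cauchy_transform \<rho> w)"
proof -
  have "((\<lambda>y. (\<i> * complex_of_real y * G (\<i> * complex_of_real y)) * (1 / (\<i> * complex_of_real y))\<^sup>2) \<longlongrightarrow> 1 * 0\<^sup>2) at_top"
  proof (intro tendsto_intros lim tendsto_divide_0[OF tendsto_const])
    show "filterlim (\<lambda>y. \<i> * complex_of_real y) at_infinity at_top"
      using filterlim_iy[of 1 1] by (simp add: filterlim_inf)
  qed
  moreover have "\<forall>\<^sub>F y in at_top. (\<i> * complex_of_real y * G (\<i> * complex_of_real y)) * (1 / (\<i> * complex_of_real y))\<^sup>2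
     = G (\<i> * complex_of_real y) / (\<i> * complex_of_real y)"
    using eventually_gt_at_top[of 0] by eventually_elim (simp add: power2_eq_square)
  ultimately have "((\<lambda>y. G (\<i> * complex_of_real y) / (\<i> * complex_of_real y)) \<longlongrightarrow> 0) at_top"
    using tendsto_cong by fastforce
  then have "G \<in> free_levy_class" using G Im_G by (simp add: free_levy_class_def)
  then obtain \<gamma> \<sigma> where \<sigma>: "finite_borel_measure \<sigma>" and rep: "\<And>w. Im w > 0 \<Longrightarrow> G w = nevanlinna_fun \<gamma> \<sigma> w"
    using Nevanlinna_representation[of G] by blast
  interpret \<sigma>: finite_borel_measure \<sigma> by fact
  note [measurable_cong] = \<sigma>.M_is_borel
  define Y where "Y n = real (Suc n)" for n
  have Y_pos: "Y n > 0" for n by (simp add: Y_def)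
  have Y_lim: "filterlim Y at_top sequentially"
    unfolding Y_def by (rule filterlim_compose[OF filterlim_real_sequentially filterlim_Suc])
  have limY: "(\<lambda>n. \<i> * complex_of_real (Y n) * G (\<i> * complex_of_real (Y n))) \<longlonglongrightarrow> 1"
    by (rule filterlim_compose[OF lim Y_lim])
  \<comment> \<open>This is the weight in the real part of \<i> y G (\<i> y) at y = Y n. It
    increases to 1 + x^2, so monotone convergence computes the second moment without assuming that
    it is finite.\<close>
  define f where "f n x = (1 + x\<^sup>2) * ((Y n)\<^sup>2 / (x\<^sup>2 + (Y n)\<^sup>2))" for n x
  have norm_iY: "(cmod (\<i> * complex_of_real (Y n) - of_real x))\<^sup>2 = x\<^sup>2 + (Y n)\<^sup>2" for n x
    by (simp add: cmod_power2)
  have nn: "(\<integral>\<^sup>+x. ennreal (f n x) \<partial>\<sigma>) = ennreal (Re (\<i> * complex_of_real (Y n) * G (\<i> * complex_of_real (Y n))))" for n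
  proof -
    have im: "Im (\<i> * complex_of_real (Y n)) \<noteq> 0" using Y_pos[of n] by simp
    have eq: "f n x = (Y n)\<^sup>2 * ((1 + x\<^sup>2) / (cmod (\<i> * complex_of_real (Y n) - of_real x))\<^sup>2)" for x
      unfolding f_def norm_iY by simp
    have "integrable \<sigma> (f n)"
      unfolding eq by (intro integrable_mult_right \<sigma>.Im_nevanlinna_fun(2) im)
    moreover have "f n x \<ge> 0" for x by (simp add: f_def)
    ultimately have "(\<integral>\<^sup>+x. ennreal (f n x) \<partial>\<sigma>) = ennreal (LINT x|\<sigma>. f n x)"
      by (intro nn_integral_eq_integral) auto
    also have "(LINT x|\<sigma>. f n x) = (Y n)\<^sup>2 * (LINT x|\<sigma>. (1 + x\<^sup>2) / (cmod (\<i> * complex_of_real (Y n) - of_real x))\<^sup>2)"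
      unfolding eq by (simp only: integral_mult_right_zero)
    also have "\<dots> = - Y n * Im (nevanlinna_fun \<gamma> \<sigma> (\<i> * complex_of_real (Y n)))"
      unfolding \<sigma>.Im_nevanlinna_fun(1)[OF im] by (simp add: power2_eq_square)
    also have "\<dots> = Re (\<i> * complex_of_real (Y n) * G (\<i> * complex_of_real (Y n)))"
      using Y_pos[of n] by (simp add: rep)
    finally show ?thesis .
  qed
  have "(\<lambda>n. \<integral>\<^sup>+x. ennreal (f n x) \<partial>\<sigma>) \<longlonglongrightarrow> (\<integral>\<^sup>+x. ennreal (1 + x\<^sup>2) \<partial>\<sigma>)"
  proof (rule nn_integral_LIMSEQ)
    show "incseq (\<lambda>n x. ennreal (f n x))"
    proof (intro incseq_SucI le_funI ennreal_leI)
      fix n x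
      have "(Y n)\<^sup>2 / (x\<^sup>2 + (Y n)\<^sup>2) \<le> (Y (Suc n))\<^sup>2 / (x\<^sup>2 + (Y (Suc n))\<^sup>2)"
      proof -
        have "(Y n)\<^sup>2 \<le> (Y (Suc n))\<^sup>2" by (intro power_mono) (auto simp: Y_def)
        then have "(Y n)\<^sup>2 * x\<^sup>2 \<le> (Y (Suc n))\<^sup>2 * x\<^sup>2" by (intro mult_right_mono) auto
        moreover have "x\<^sup>2 + (Y n)\<^sup>2 > 0" "x\<^sup>2 + (Y (Suc n))\<^sup>2 > 0"
          by (intro add_nonneg_pos zero_less_power Y_pos zero_le_power2)+
        ultimately show ?thesis by (simp add: divide_le_eq le_divide_eq field_simps)
      qed
      then show "f n x \<le> f (Suc n) x" unfolding f_def by (intro mult_left_mono) auto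
    qed
    show "(\<lambda>x. ennreal (f n x)) \<in> borel_measurable \<sigma>" for n unfolding f_def by measurable
    show "(\<lambda>n. ennreal (f n x)) \<longlonglongrightarrow> ennreal (1 + x\<^sup>2)" for x
    proof (rule tendsto_ennrealI)
      have "(\<lambda>n. (1 + x\<^sup>2) * (1 / ((x / Y n)\<^sup>2 + 1))) \<longlonglongrightarrow> (1 + x\<^sup>2) * (1 / (0\<^sup>2 + 1))"
        by (intro tendsto_intros tendsto_divide_0[OF tendsto_const] filterlim_at_top_imp_at_infinity Y_lim) auto
      moreover have "(1 + x\<^sup>2) * (1 / ((x / Y n)\<^sup>2 + 1)) = f n x" for n
        using Y_pos[of n] by (simp add: f_def field_simps)
      ultimately show "(\<lambda>n. f n x) \<longlonglongrightarrow> 1 + x\<^sup>2" by simp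
    qed
  qed
  moreover have "(\<lambda>n. \<integral>\<^sup>+x. ennreal (f n x) \<partial>\<sigma>) \<longlonglongrightarrow> ennreal 1"
    unfolding nn using tendsto_Re[OF limY] by (intro tendsto_ennrealI) simp
  ultimately have "(\<integral>\<^sup>+x. ennreal (1 + x\<^sup>2) \<partial>\<sigma>) = ennreal 1"
    by (rule LIMSEQ_unique)
  then have mass: "(\<integral>\<^sup>+x. ennreal (1 + x\<^sup>2) \<partial>\<sigma>) = 1"
    by (simp only: ennreal_1)
  define \<rho> where "\<rho> = density \<sigma> (\<lambda>x. ennreal (1 + x\<^sup>2))"
  have "emeasure \<rho> (space \<rho>) = (\<integral>\<^sup>+x. ennreal (1 + x\<^sup>2) \<partial>\<sigma>)"
    unfolding \<rho>_def by (subst emeasure_density) (auto intro!: nn_integral_cong simp: \<sigma>.space_M)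
  then have "prob_space \<rho>"
    by (intro prob_spaceI) (simp only: mass)
  then have rd: "real_distribution \<rho>"
    by (simp add: real_distribution_def real_distribution_axioms_def \<rho>_def \<sigma>.M_is_borel)
  interpret \<rho>: real_distribution \<rho> by fact
  have int2: "integrable \<sigma> (\<lambda>x. 1 + x\<^sup>2)"
    by (rule integrableI_nonneg) (simp, simp, simp only: mass, simp)
  have int1: "integrable \<sigma> (\<lambda>x. x)"
  proof (rule Bochner_Integration.integrable_bound[OF int2])
    have "\<bar>x\<bar> \<le> 1 + x\<^sup>2" for x :: real
      using sum_squares_bound[of "\<bar>x\<bar>" 1] zero_le_power2[of x] by (simp add: power2_abs)
    then show "AE x in \<sigma>. norm x \<le> norm (1 + x\<^sup>2)" by (intro always_eventually) simp
  qed auto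
  define c where "c = complex_of_real (\<gamma> + (LINT x|\<sigma>. x))"
  have G_eq: "G w = c + cauchy_transform \<rho> w" if w: "Im w > 0" for w
  proof -
    have w': "Im w \<noteq> 0" using w by simp
    have "integrable \<rho> (\<lambda>x. 1 / (w - complex_of_real x))" by (rule \<rho>.integrable_cauchy_kernel[OF w'])
    then have i: "integrable \<sigma> (\<lambda>x. (1 + x\<^sup>2) *\<^sub>R (1 / (w - complex_of_real x)))"
      unfolding \<rho>_def by (subst (asm) integrable_density) auto
    have "G w = of_real \<gamma> + (LINT x|\<sigma>. of_real x + (1 + x\<^sup>2) *\<^sub>R (1 / (w - complex_of_real x)))"
      unfolding rep[OF w] nevanlinna_fun_def \<sigma>.nevanlinna_kernel_eq(2)[OF w'] by (simp only: scaleR_conv_of_real)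
    also have "\<dots> = of_real \<gamma> + ((LINT x|\<sigma>. complex_of_real x) + (LINT x|\<sigma>. (1 + x\<^sup>2) *\<^sub>R (1 / (w - complex_of_real x))))"
      by (subst Bochner_Integration.integral_add[OF integrable_of_real[OF int1] i]) simp
    also have "(LINT x|\<sigma>. (1 + x\<^sup>2) *\<^sub>R (1 / (w - complex_of_real x))) = cauchy_transform \<rho> w"
      unfolding \<rho>_def cauchy_transform_def by (subst integral_density) auto
    finally show ?thesis by (simp add: c_def)
  qed
  have "c = 0"
  proof -
    have "(\<lambda>n. \<i> * complex_of_real (Y n) * cauchy_transform \<rho> (\<i> * complex_of_real (Y n))) \<longlonglongrightarrow> complex_of_real (measure \<rho> UNIV)"
    proof (rule \<rho>.tendsto_cauchy_transform_cone[where \<eta>=1 and A="1/2"])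
      show "filterlim (\<lambda>n. \<i> * complex_of_real (Y n)) at_infinity sequentially"
        using filterlim_compose[OF filterlim_iy[of 1 1] Y_lim] by (simp add: filterlim_inf)
      show "\<i> * complex_of_real (Y n) \<in> trunc_cone 1 (1/2)" for n
        by (rule iy_in_trunc_cone) (simp_all add: Y_def)
    qed simp
    moreover have "measure \<rho> UNIV = 1" using \<rho>.prob_space by simp
    \<comment> \<open>Both \<i> y G and \<i> y times the Cauchy transform tend to 1; their
      difference is \<i> y c, so c tends to 0.\<close>
    ultimately have "(\<lambda>n. (\<i> * complex_of_real (Y n) * G (\<i> * complex_of_real (Y n)) -
        \<i> * complex_of_real (Y n) * cauchy_transform \<rho> (\<i> * complex_of_real (Y n))) * (- \<i> * (1 / complex_of_real (Y n)))) \<longlonglongrightarrow> (1 - 1) * (- \<i> * 0)"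
      using limY
      by (intro tendsto_mult tendsto_diff tendsto_const tendsto_divide_0[OF tendsto_const])
         (simp_all add: filterlim_at_infinity_conv_norm_at_top abs_of_pos[OF Y_pos] Y_lim)
    moreover have "(\<i> * complex_of_real (Y n) * G (\<i> * complex_of_real (Y n)) -
        \<i> * complex_of_real (Y n) * cauchy_transform \<rho> (\<i> * complex_of_real (Y n))) * (- \<i> * (1 / complex_of_real (Y n))) = c" for n
      using Y_pos[of n] by (simp add: G_eq field_simps)
    ultimately have "(\<lambda>n. c) \<longlonglongrightarrow> 0" by simp
    then show ?thesis by (simp add: LIMSEQ_const_iff)
  qed
  with G_eq rd show ?thesis by auto
qed

context finite_borel_measure
begin

text \<open>The condition on the integral is \<open>Im (w + H w) \<ge> 0\<close> for \<open>H = nevanlinna_fun \<gamma> M\<close>; it compensates for the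
  lack of control over the tail of \<open>M\<close> when \<open>w\<close> approaches infinity close to the real axis.\<close>

lemma nevanlinna_fun_growth:
  assumes "\<epsilon> > 0" "c > 0"
  shows "\<exists>B. \<forall>w. Im w \<ge> c \<longrightarrow> (LINT x|M. (1 + x\<^sup>2) / (cmod (w - of_real x))\<^sup>2) \<le> 1 \<longrightarrow>
    cmod (nevanlinna_fun \<gamma> M w) \<le> B + \<epsilon> * cmod w"
proof -
  have "(\<lambda>n. measure M {x. \<bar>x\<bar> \<ge> real n}) \<longlonglongrightarrow> measure M (\<Inter>n. {x. \<bar>x\<bar> \<ge> real n})"
    by (rule finite_Lim_measure_decseq) (auto simp: decseq_def M_is_borel)
  moreover have "(\<Inter>n. {x::real. \<bar>x\<bar> \<ge> real n}) = {}"
  proof -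
    have "\<exists>n. \<not> \<bar>x\<bar> \<ge> real n" for x :: real using reals_Archimedean2[of "\<bar>x\<bar>"] by (auto simp: not_le)
    then show ?thesis by blast
  qed
  ultimately have "(\<lambda>n. measure M {x. \<bar>x\<bar> \<ge> real n}) \<longlonglongrightarrow> 0" by simp
  \<comment> \<open>The square is chosen because the tail mass is later multiplied by 1 /
    \<epsilon>.\<close>
  from order_tendstoD(2)[OF this, of "\<epsilon>\<^sup>2"] assms obtain n where n: "measure M {x. \<bar>x\<bar> \<ge> real n} < \<epsilon>\<^sup>2"
    by (auto simp: eventually_sequentially)
  define T where "T = {x. \<bar>x\<bar> \<ge> real n}"
  have T [measurable]: "T \<in> sets borel" unfolding T_def by measurable
  \<comment> \<open>Bounds the kernel for |x| < n through its second decomposition, uniformly in Im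
    w \<ge> c.\<close>
  define C where "C = real n + (1 + (real n)\<^sup>2) / c"
  have bound: "cmod (nevanlinna_fun \<gamma> M w) \<le> (\<bar>\<gamma>\<bar> + C * measure M UNIV + \<epsilon>) + \<epsilon> * cmod w"
    if w: "Im w \<ge> c" and I: "(LINT x|M. (1 + x\<^sup>2) / (cmod (w - of_real x))\<^sup>2) \<le> 1" for w
  proof -
    have w': "Im w \<noteq> 0" using w assms by simp
    let ?q = "\<lambda>x. (1 + x\<^sup>2) / (cmod (w - of_real x))\<^sup>2"
    let ?k = "\<lambda>x. (1 + w * complex_of_real x) / (w - complex_of_real x)"
    let ?b = "\<lambda>x. C + (1 + cmod w) / 2 * (\<epsilon> * ?q x + 1 / \<epsilon> * indicator T x)"
    have k_le: "cmod (?k x) \<le> ?b x" for x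
    proof (cases "x \<in> T")
      case False
      then have x: "\<bar>x\<bar> \<le> real n" by (simp add: T_def)
      have d: "cmod (w - of_real x) \<ge> c" using Im_le_cmod_diff_real[of w x] w by linarith
      have "cmod (?k x) \<le> \<bar>x\<bar> + cmod (of_real (1 + x\<^sup>2) * (1 / (w - complex_of_real x)))"
        unfolding nevanlinna_kernel_eq(2)[OF w'] using norm_triangle_ineq[of "complex_of_real x"] by simp
      also have "cmod (of_real (1 + x\<^sup>2) * (1 / (w - complex_of_real x))) = (1 + x\<^sup>2) / cmod (w - of_real x)"
        by (simp add: norm_mult norm_divide del: of_real_add)
      also have "\<dots> \<le> (1 + (real n)\<^sup>2) / c"
        using d assms x abs_le_square_iff[of x "real n"] by (intro frac_le) auto
      finally have "cmod (?k x) \<le> C" using x by (simp add: C_def)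
      moreover have "(1 + cmod w) / 2 * (\<epsilon> * ?q x + 1 / \<epsilon> * indicator T x) \<ge> 0"
        using assms by (intro mult_nonneg_nonneg add_nonneg_nonneg) auto
      ultimately show ?thesis by linarith
    next
      case True
      define a where "a = sqrt (1 + x\<^sup>2) / cmod (w - of_real x)"
      have a2: "a\<^sup>2 = ?q x" by (simp add: a_def power_divide)
      have "cmod (1 + w * of_real x) \<le> (1 + cmod w) * sqrt (1 + x\<^sup>2)"
      proof -
        have "cmod (1 + w * of_real x) \<le> 1 + cmod w * \<bar>x\<bar>"
          using norm_triangle_ineq[of 1 "w * of_real x"] by (simp add: norm_mult)
        also have "\<dots> \<le> 1 * sqrt (1 + x\<^sup>2) + cmod w * sqrt (1 + x\<^sup>2)"
          by (intro add_mono mult_left_mono) (auto intro: real_le_rsqrt)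
        finally show ?thesis by (simp add: algebra_simps)
      qed
      then have "cmod (?k x) \<le> (1 + cmod w) * a"
        unfolding norm_divide a_def by (simp add: divide_right_mono)
      \<comment> \<open>A weighted arithmetic-geometric mean. The term with a^2 integrates to at
        most \<epsilon> by the hypothesis on the integral, and 1 / \<epsilon> integrates over
        \<open>T\<close> to at most \<epsilon>.\<close>
      also have "a \<le> (\<epsilon> * a\<^sup>2 + 1 / \<epsilon>) / 2"
      proof -
        have "0 \<le> (\<epsilon> * a - 1)\<^sup>2 / \<epsilon>" using assms by simp
        also have "\<dots> = \<epsilon> * a\<^sup>2 + 1 / \<epsilon> - 2 * a" using assms by (simp add: field_simps power2_eq_square)
        finally show ?thesis by simp
      qed
      finally have "cmod (?k x) \<le> (1 + cmod w) * ((\<epsilon> * a\<^sup>2 + 1 / \<epsilon>) / 2)" by (simp add: mult_left_mono)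
      also have "\<dots> = (1 + cmod w) / 2 * (\<epsilon> * ?q x + 1 / \<epsilon> * indicator T x)" using True by (simp add: a2)
      finally have "cmod (?k x) \<le> (1 + cmod w) / 2 * (\<epsilon> * ?q x + 1 / \<epsilon> * indicator T x)" .
      moreover have "C \<ge> 0" using assms by (simp add: C_def)
      ultimately show ?thesis by linarith
    qed
    have iq: "integrable M ?q" by (rule Im_nevanlinna_fun(2)[OF w'])
    have iT: "integrable M (\<lambda>x. indicator T x :: real)"
      by (rule integrable_boundedI[where B=1]) (auto simp: measurable_M_eq indicator_def)
    have "cmod (nevanlinna_fun \<gamma> M w) \<le> \<bar>\<gamma>\<bar> + cmod (LINT x|M. ?k x)"
      unfolding nevanlinna_fun_def using norm_triangle_ineq[of "complex_of_real \<gamma>"] by simp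
    also have "cmod (LINT x|M. ?k x) \<le> (LINT x|M. ?b x)"
    proof (rule Bochner_Integration.integral_norm_bound_integral)
      show "integrable M ?k" by (rule integrable_nevanlinna_kernel[OF w'])
      show "integrable M ?b"
        by (intro Bochner_Integration.integrable_add integrable_mult_right iq iT integrable_const)
    qed (rule k_le)
    also have "(LINT x|M. ?b x) = C * measure M UNIV + (1 + cmod w) / 2 * (\<epsilon> * (LINT x|M. ?q x) + 1 / \<epsilon> * measure M T)"
    proof -
      have "(LINT x|M. ?b x) = (LINT x|M. C) + (LINT x|M. (1 + cmod w) / 2 * (\<epsilon> * ?q x + 1 / \<epsilon> * indicator T x))"
        by (intro Bochner_Integration.integral_add Bochner_Integration.integrable_add integrable_mult_right iq iT integrable_const)
      also have "(LINT x|M. (1 + cmod w) / 2 * (\<epsilon> * ?q x + 1 / \<epsilon> * indicator T x)) =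
          (1 + cmod w) / 2 * (LINT x|M. \<epsilon> * ?q x + 1 / \<epsilon> * indicator T x)"
        by (simp only: integral_mult_right_zero)
      also have "(LINT x|M. \<epsilon> * ?q x + 1 / \<epsilon> * indicator T x) = (LINT x|M. \<epsilon> * ?q x) + (LINT x|M. 1 / \<epsilon> * indicator T x)"
        by (intro Bochner_Integration.integral_add integrable_mult_right iq iT)
      also have "(LINT x|M. 1 / \<epsilon> * indicator T x) = 1 / \<epsilon> * measure M T"
        by (simp add: M_is_borel space_M)
      also have "(LINT x|M. \<epsilon> * ?q x) = \<epsilon> * (LINT x|M. ?q x)" by (simp only: integral_mult_right_zero)
      also have "(LINT x|M. C) = C * measure M UNIV" by (simp add: space_M mult.commute)
      finally show ?thesis .
    qed
    also have "(1 + cmod w) / 2 * (\<epsilon> * (LINT x|M. ?q x) + 1 / \<epsilon> * measure M T) \<le> (1 + cmod w) / 2 * (\<epsilon> * 1 + 1 / \<epsilon> * \<epsilon>\<^sup>2)"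
      using assms I n by (intro mult_left_mono add_mono) (auto simp: T_def)
    also have "\<dots> = \<epsilon> + \<epsilon> * cmod w" using assms by (simp add: power2_eq_square algebra_simps)
    finally show ?thesis by simp
  qed
  then show ?thesis by blast
qed

end

text \<open>On the set where Im (w + H w) > 0 the map is injective, and its image is open and closed
  in the half-plane, hence everything. Every slope \<eta> is offered so that the constructed law can
  share the slope of a given one.\<close>

theorem exists_measure_right_inverse:
  assumes H: "H \<in> free_levy_class"
  shows "\<exists>\<rho>. real_distribution \<rho> \<and> (\<forall>\<eta>>0. \<exists>A>0. right_inverse_on_cone \<rho> \<eta> A (\<lambda>w. w + H w))"
proof -
  obtain \<gamma> \<sigma> where \<sigma>: "finite_borel_measure \<sigma>" and rep: "\<And>w. Im w > 0 \<Longrightarrow> H w = nevanlinna_fun \<gamma> \<sigma> w"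
    using Nevanlinna_representation[OF H] by blast
  interpret \<sigma>: finite_borel_measure \<sigma> by fact
  have H_hol: "H holomorphic_on uhp" and Im_H: "\<And>w. Im w > 0 \<Longrightarrow> Im (H w) \<le> 0"
    using H by (auto simp: free_levy_class_def)
  define K where "K w = w + H w" for w
  \<comment> \<open>Im (K w) = Im w (1 - I w), so membership in \<open>\<Omega>\<close> means I w <
    1. The two-point integral in a difference of values of H is at most the mean of I at the two
    points, hence different from 1: this is injectivity.\<close>
  define I where "I w = (LINT x|\<sigma>. (1 + x\<^sup>2) / (cmod (w - of_real x))\<^sup>2)" for w
  define \<Omega> where "\<Omega> = {w. Im w > 0 \<and> Im (K w) > 0}"
  have K_hol: "K holomorphic_on uhp" unfolding K_def by (intro holomorphic_intros H_hol)
  have Im_K: "Im (K w) = Im w * (1 - I w)" if "Im w > 0" for w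
    using that by (simp add: K_def rep \<sigma>.Im_nevanlinna_fun(1) I_def algebra_simps)
  have I_less: "I w < 1" if "w \<in> \<Omega>" for w
    using that Im_K[of w] by (auto simp: \<Omega>_def zero_less_mult_iff)
  have \<Omega>_uhp: "\<Omega> \<subseteq> uhp" by (auto simp: \<Omega>_def)
  have "open (uhp \<inter> K -` {z. Im z > 0})"
    using holomorphic_on_imp_continuous_on[OF K_hol] open_uhp open_halfspace_Im_gt[of 0]
    by (intro continuous_open_preimage) auto
  then have open_\<Omega>: "open \<Omega>" by (simp add: \<Omega>_def Int_def vimage_def)
  have inj: "inj_on K \<Omega>"
  proof (rule inj_onI)
    fix w1 w2 assume w: "w1 \<in> \<Omega>" "w2 \<in> \<Omega>" "K w1 = K w2"
    have Im: "Im w1 > 0" "Im w2 > 0" using w by (auto simp: \<Omega>_def)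
    define J where "J = (LINT x|\<sigma>. of_real (1 + x\<^sup>2) * ((1 / (w1 - complex_of_real x)) * (1 / (w2 - complex_of_real x))))"
    have "H w1 - H w2 = (w2 - w1) * J"
      unfolding J_def using Im by (simp only: rep, subst \<sigma>.nevanlinna_fun_diff) auto
    moreover have "w1 + H w1 = w2 + H w2" using w by (simp add: K_def)
    then have "H w1 - H w2 = w2 - w1" by (simp add: diff_eq_eq algebra_simps)
    ultimately have eq: "(w2 - w1) * (J - 1) = 0" by (simp add: right_diff_distrib)
    have "cmod J \<le> (LINT x|\<sigma>. 1 / 2 * ((1 + x\<^sup>2) / (cmod (w1 - of_real x))\<^sup>2 + (1 + x\<^sup>2) / (cmod (w2 - of_real x))\<^sup>2))"
      unfolding J_def
    proof (rule Bochner_Integration.integral_norm_bound_integral)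
      fix x
      define a b where "a = 1 / cmod (w1 - of_real x)" and "b = 1 / cmod (w2 - of_real x)"
      have "a * b \<le> 1 / 2 * (a\<^sup>2 + b\<^sup>2)" using sum_squares_bound[of a b] by simp
      then have "(1 + x\<^sup>2) * (a * b) \<le> (1 + x\<^sup>2) * (1 / 2 * (a\<^sup>2 + b\<^sup>2))" by (intro mult_left_mono) auto
      also have "\<dots> = 1 / 2 * ((1 + x\<^sup>2) * a\<^sup>2 + (1 + x\<^sup>2) * b\<^sup>2)" by (simp only: distrib_left mult_ac)
      also have "(1 + x\<^sup>2) * a\<^sup>2 = (1 + x\<^sup>2) / (cmod (w1 - of_real x))\<^sup>2" by (simp add: a_def power_divide)
      also have "(1 + x\<^sup>2) * b\<^sup>2 = (1 + x\<^sup>2) / (cmod (w2 - of_real x))\<^sup>2" by (simp add: b_def power_divide)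
      finally show "norm (of_real (1 + x\<^sup>2) * ((1 / (w1 - complex_of_real x)) * (1 / (w2 - complex_of_real x))))
        \<le> 1 / 2 * ((1 + x\<^sup>2) / (cmod (w1 - of_real x))\<^sup>2 + (1 + x\<^sup>2) / (cmod (w2 - of_real x))\<^sup>2)"
        unfolding norm_mult norm_of_real norm_divide norm_one by (simp add: a_def b_def)
    qed (use Im \<sigma>.integrable_nevanlinna_kernel2 \<sigma>.Im_nevanlinna_fun(2) in auto)
    also have "\<dots> = 1 / 2 * (I w1 + I w2)"
      unfolding I_def integral_mult_right_zero
      by (subst Bochner_Integration.integral_add) (use Im \<sigma>.Im_nevanlinna_fun(2) in auto)
    also have "\<dots> < 1" using I_less[OF w(1)] I_less[OF w(2)] by simp
    finally have "J \<noteq> 1" by auto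
    with eq show "w1 = w2" by auto
  qed
  have cone: "\<exists>A>0. trunc_cone \<eta> A \<subseteq> \<Omega>" if "\<eta> > 0" for \<eta>
  proof -
    have "\<forall>\<^sub>F w in inf at_infinity (principal (trunc_cone \<eta> 1)). dist (nevanlinna_fun \<gamma> \<sigma> w / w) 0 < 1 / (1 + \<eta>)"
      using that by (intro tendstoD[OF \<sigma>.tendsto_nevanlinna_fun_cone]) auto
    then obtain b where b: "\<And>w. norm w \<ge> b \<Longrightarrow> w \<in> trunc_cone \<eta> 1 \<Longrightarrow> norm (nevanlinna_fun \<gamma> \<sigma> w / w) < 1 / (1 + \<eta>)"
      unfolding eventually_inf_principal eventually_at_infinity by auto
    have "w \<in> \<Omega>" if w: "w \<in> trunc_cone \<eta> (max 1 b)" for w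
    proof -
      have w1: "w \<in> trunc_cone \<eta> 1" and Im: "Im w > 0" "Im w > b" using w by (auto simp: trunc_cone_def)
      have "norm w \<ge> b" using Im abs_Im_le_cmod[of w] by linarith
      have w0: "norm w > 0" using Im by auto
      from b[OF \<open>norm w \<ge> b\<close> w1] have "norm (H w) / norm w < 1 / (1 + \<eta>)"
        using Im by (simp add: rep norm_divide)
      then have "norm (H w) < norm w / (1 + \<eta>)"
        unfolding pos_divide_less_eq[OF w0] by simp
      also have "\<dots> \<le> Im w" using cmod_le_cone[OF w1] \<open>\<eta> > 0\<close> by (simp add: field_simps)
      finally have "Im (K w) > 0" using abs_Im_le_cmod[of "H w"] by (simp add: K_def)
      then show ?thesis using Im by (simp add: \<Omega>_def)
    qed
    then show ?thesis by (intro exI[of _ "max 1 b"]) auto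
  qed
  have ImK_le: "Im (K w) \<le> Im w" if "Im w > 0" for w using Im_H[OF that] by (simp add: K_def)
  have "K ` \<Omega> = uhp"
  proof -
    have K_sub: "K ` \<Omega> \<subseteq> uhp" by (auto simp: \<Omega>_def)
    have "open (K ` \<Omega>)"
      by (rule open_mapping_thm3[OF holomorphic_on_subset[OF K_hol \<Omega>_uhp] open_\<Omega> inj])
    then have "openin (top_of_set uhp) (K ` \<Omega>)" using K_sub by (simp only: openin_open_eq[OF open_uhp] simp_thms)
    \<comment> \<open>Properness: preimages of a convergent sequence stay above a fixed height,
      because K lowers imaginary parts, and remain bounded by the growth estimate.\<close>
    moreover have "closedin (top_of_set uhp) (K ` \<Omega>)"
      unfolding closedin_closed
    proof (intro exI[of _ "closure (K ` \<Omega>)"] conjI closed_closure equalityI)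
      show "K ` \<Omega> \<subseteq> uhp \<inter> closure (K ` \<Omega>)" using K_sub closure_subset[of "K ` \<Omega>"] by (rule Int_greatest)
    next
      show "uhp \<inter> closure (K ` \<Omega>) \<subseteq> K ` \<Omega>"
      proof
        fix l assume "l \<in> uhp \<inter> closure (K ` \<Omega>)"
        then have l: "l \<in> uhp" and "\<exists>z. (\<forall>n. z n \<in> K ` \<Omega>) \<and> z \<longlonglongrightarrow> l"
          unfolding closure_sequential[symmetric] by blast+
        then obtain z where z: "\<forall>n. z n \<in> K ` \<Omega>" and lim: "z \<longlonglongrightarrow> l" by blast
        from z have "\<forall>n. \<exists>w. w \<in> \<Omega> \<and> z n = K w" unfolding image_iff Bex_def .
        from choice[OF this] obtain w where "\<forall>n. w n \<in> \<Omega> \<and> z n = K (w n)" ..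
        then have w: "\<And>n. w n \<in> \<Omega>" "\<And>n. K (w n) = z n" by simp_all
        define c where "c = Im l / 2"
        have c: "c > 0" "c < Im l" using l by (auto simp: c_def)
        have "\<forall>\<^sub>F n in sequentially. Im (z n) > c"
          using order_tendstoD(1)[OF tendsto_Im[OF lim] c(2)] .
        then obtain N where N: "\<And>n. n \<ge> N \<Longrightarrow> Im (z n) > c" by (auto simp: eventually_sequentially)
        define v where "v n = w (n + N)" for n
        have v: "v n \<in> \<Omega>" "K (v n) = z (n + N)" "Im (v n) \<ge> c" for n
        proof -
          show "v n \<in> \<Omega>" "K (v n) = z (n + N)" using w by (auto simp: v_def)
          then show "Im (v n) \<ge> c" using ImK_le[of "v n"] N[of "n + N"] by (auto simp: \<Omega>_def)
        qed
        \<comment> \<open>With coefficient 1 / 2 the modulus of the preimage is at most Z + B plus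
          half of itself, and can be absorbed.\<close>
        have "\<exists>B. \<forall>w. Im w \<ge> c \<longrightarrow> I w \<le> 1 \<longrightarrow> cmod (nevanlinna_fun \<gamma> \<sigma> w) \<le> B + 1 / 2 * cmod w"
          unfolding I_def by (rule \<sigma>.nevanlinna_fun_growth) (use c in simp_all)
        then obtain B where "\<forall>w. Im w \<ge> c \<longrightarrow> I w \<le> 1 \<longrightarrow> cmod (nevanlinna_fun \<gamma> \<sigma> w) \<le> B + 1 / 2 * cmod w" ..
        then have B: "\<And>w. Im w \<ge> c \<Longrightarrow> I w \<le> 1 \<Longrightarrow> cmod (nevanlinna_fun \<gamma> \<sigma> w) \<le> B + 1 / 2 * cmod w" by simp
        obtain Z where Z: "\<And>n. cmod (z n) \<le> Z"
          using convergent_imp_Bseq[OF convergentI[OF lim]] by (rule BseqE) blast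
        have bd: "cmod (v n) \<le> 2 * (Z + B)" for n
        proof -
          have "v n = z (n + N) - H (v n)" using v(2)[of n] by (simp add: K_def algebra_simps)
          then have "cmod (v n) = cmod (z (n + N) - H (v n))" by (rule arg_cong)
          also have "\<dots> \<le> cmod (z (n + N)) + cmod (H (v n))" by (rule norm_triangle_ineq4)
          also have "cmod (H (v n)) \<le> B + 1 / 2 * cmod (v n)"
            using B[of "v n"] v[of n] I_less[of "v n"] c by (simp add: rep)
          finally show ?thesis using Z[of "n + N"] by simp
        qed
        define S where "S = cball 0 (2 * (Z + B)) \<inter> {w. Im w \<ge> c}"
        have "compact S" unfolding S_def
          by (intro compact_Int_closed compact_cball closed_halfspace_Im_ge)
        moreover have "\<forall>n. v n \<in> S" using bd v by (auto simp: S_def)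
        ultimately obtain u r where u: "u \<in> S" "strict_mono (r :: nat \<Rightarrow> nat)" "(v \<circ> r) \<longlonglongrightarrow> u"
          by (rule seq_compactE[OF compact_imp_seq_compact])
        have Imu: "Im u > 0" using u c by (auto simp: S_def)
        have "isCont K u"
          using holomorphic_on_imp_continuous_on[OF K_hol] Imu open_uhp by (simp add: continuous_on_eq_continuous_at)
        then have "(\<lambda>n. K ((v \<circ> r) n)) \<longlonglongrightarrow> K u" by (rule isCont_tendsto_compose[OF _ u(3)])
        moreover have "(\<lambda>n. K ((v \<circ> r) n)) \<longlonglongrightarrow> l"
          using LIMSEQ_subseq_LIMSEQ[OF LIMSEQ_ignore_initial_segment[OF lim, of N] u(2)] by (simp add: v o_def)
        ultimately have "K u = l" by (rule LIMSEQ_unique)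
        then show "l \<in> K ` \<Omega>" using Imu l by (auto simp: \<Omega>_def)
      qed
    qed
    moreover have "K ` \<Omega> \<noteq> {}"
    proof -
      obtain A where "A > 0" "trunc_cone 1 A \<subseteq> \<Omega>" using cone[of 1] by auto
      then show ?thesis using trunc_cone_nonempty[of 1 A] by auto
    qed
    ultimately show ?thesis
      using connected_uhp[unfolded connected_clopen, rule_format, of "K ` \<Omega>"] by blast
  qed
  note K_image = this
  obtain F where "F holomorphic_on K ` \<Omega>" and F_K: "\<And>w. w \<in> \<Omega> \<Longrightarrow> F (K w) = w"
    by (rule holomorphic_has_inverse[OF holomorphic_on_subset[OF K_hol \<Omega>_uhp] open_\<Omega> inj], rule that)
  then have F_hol: "F holomorphic_on uhp" by (simp only: K_image)
  have F: "F z \<in> \<Omega>" "K (F z) = z" if "Im z > 0" for z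
  proof -
    have "z \<in> K ` \<Omega>" using that by (simp only: K_image mem_Collect_eq)
    then obtain w where "w \<in> \<Omega>" "z = K w" by (rule imageE) simp
    then show "F z \<in> \<Omega>" "K (F z) = z" by (simp_all add: F_K)
  qed
  have ImF: "Im (F z) \<ge> Im z" "Im (F z) > 0" if "Im z > 0" for z
    using F[OF that] ImK_le[of "F z"] by (auto simp: \<Omega>_def)
  have F_nz: "F z \<noteq> 0" if "Im z > 0" for z using ImF(2)[OF that] by auto
  have G_hol: "(\<lambda>w. 1 / F w) holomorphic_on uhp" by (intro holomorphic_intros F_hol) (auto simp: F_nz)
  have Im_G: "Im (1 / F w) \<le> 0" if "Im w > 0" for w
    using ImF(2)[OF that] by (simp add: Im_divide divide_nonpos_nonneg)
  \<comment> \<open>With w = F (\<i> y) the error is H w / w. The point w is not known to stay in a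
    cone, hence the growth estimate; half of e is spent on absorbing the constant B.\<close>
  have G_lim: "((\<lambda>y. \<i> * complex_of_real y * (1 / F (\<i> * complex_of_real y))) \<longlongrightarrow> 1) at_top"
    proof (rule tendstoI)
      fix e :: real assume e: "e > 0"
      have "\<exists>B. \<forall>w. Im w \<ge> 1 \<longrightarrow> I w \<le> 1 \<longrightarrow> cmod (nevanlinna_fun \<gamma> \<sigma> w) \<le> B + e / 2 * cmod w"
        unfolding I_def by (rule \<sigma>.nevanlinna_fun_growth) (use e in simp_all)
      then obtain B where "\<forall>w. Im w \<ge> 1 \<longrightarrow> I w \<le> 1 \<longrightarrow> cmod (nevanlinna_fun \<gamma> \<sigma> w) \<le> B + e / 2 * cmod w" ..
      then have B: "\<And>w. Im w \<ge> 1 \<Longrightarrow> I w \<le> 1 \<Longrightarrow> cmod (nevanlinna_fun \<gamma> \<sigma> w) \<le> B + e / 2 * cmod w" by simp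
      show "\<forall>\<^sub>F y in at_top. dist (\<i> * complex_of_real y * (1 / F (\<i> * complex_of_real y))) 1 < e"
        using eventually_gt_at_top[of "max 1 (2 * \<bar>B\<bar> / e)"]
      proof eventually_elim
        case (elim y)
        define w where "w = F (\<i> * complex_of_real y)"
        have y: "y > 1" "2 * \<bar>B\<bar> / e < y" using elim by auto
        have w: "w \<in> \<Omega>" "K w = \<i> * complex_of_real y" "Im w \<ge> y" "w \<noteq> 0"
          using F[of "\<i> * complex_of_real y"] ImF[of "\<i> * complex_of_real y"] F_nz[of "\<i> * complex_of_real y"] y
          by (auto simp: w_def)
        have "\<i> * complex_of_real y * (1 / w) - 1 = H w / w"
          using w(4) unfolding w(2)[symmetric] K_def by (simp add: field_simps)
        moreover have "cmod (H w) < e * cmod w"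
        proof -
          have "cmod (H w) \<le> B + e / 2 * cmod w"
            using B[of w] w y I_less[OF w(1)] by (simp add: rep)
          also have "B < e / 2 * cmod w"
          proof -
            have "B \<le> e / 2 * (2 * \<bar>B\<bar> / e)" using e by simp
            also have "\<dots> < e / 2 * cmod w"
              using e y w abs_Im_le_cmod[of w] by (intro mult_strict_left_mono) auto
            finally show ?thesis .
          qed
          finally show ?thesis by simp
        qed
        ultimately show "dist (\<i> * complex_of_real y * (1 / F (\<i> * complex_of_real y))) 1 < e"
          using w(4) unfolding dist_norm w_def[symmetric] by (simp add: norm_divide divide_less_eq)
      qed
    qed
  obtain \<rho> where \<rho>: "real_distribution \<rho>" and G: "\<And>w. Im w > 0 \<Longrightarrow> 1 / F w = cauchy_transform \<rho> w"
    using cauchy_transform_characterization[OF G_hol Im_G G_lim] by blast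
  have recip: "recip_cauchy_transform \<rho> z = F z" if "Im z > 0" for z
    unfolding recip_cauchy_transform_def G[OF that, symmetric] by simp
  have "\<exists>A>0. right_inverse_on_cone \<rho> \<eta> A (\<lambda>w. w + H w)" if "\<eta> > 0" for \<eta>
  proof -
    obtain A where A: "A > 0" "trunc_cone \<eta> A \<subseteq> \<Omega>" using cone[OF \<open>\<eta> > 0\<close>] by blast
    have "((\<lambda>w. 1 + nevanlinna_fun \<gamma> \<sigma> w / w) \<longlongrightarrow> 1 + 0) (inf at_infinity (principal (trunc_cone \<eta> A)))"
      by (intro tendsto_intros \<sigma>.tendsto_nevanlinna_fun_cone A)
    moreover have "\<forall>\<^sub>F w in inf at_infinity (principal (trunc_cone \<eta> A)). 1 + nevanlinna_fun \<gamma> \<sigma> w / w = K w / w"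
      unfolding eventually_inf_principal
    proof (intro always_eventually allI impI)
      fix w assume "w \<in> trunc_cone \<eta> A"
      then have "Im w > 0" using A \<Omega>_uhp by auto
      then show "1 + nevanlinna_fun \<gamma> \<sigma> w / w = K w / w" by (auto simp: K_def rep add_divide_distrib)
    qed
    ultimately have "((\<lambda>w. K w / w) \<longlongrightarrow> 1) (inf at_infinity (principal (trunc_cone \<eta> A)))"
      using tendsto_cong by fastforce
    moreover have "K holomorphic_on trunc_cone \<eta> A"
      using holomorphic_on_subset[OF K_hol] A \<Omega>_uhp by blast
    moreover have "Im (K w) > 0 \<and> recip_cauchy_transform \<rho> (K w) = w" if "w \<in> trunc_cone \<eta> A" for w
    proof -
      have w: "w \<in> \<Omega>" using that A by auto
      then have "Im (K w) > 0" by (simp add: \<Omega>_def)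
      then show ?thesis using recip[of "K w"] F_K[OF w] by simp
    qed
    ultimately have "right_inverse_on_cone \<rho> \<eta> A K"
      using A(1) \<open>\<eta> > 0\<close> by (simp only: right_inverse_on_cone_def) simp
    moreover have "K = (\<lambda>w. w + H w)" by (simp add: K_def fun_eq_iff)
    ultimately show ?thesis using A(1) by blast
  qed
  with \<rho> show ?thesis by auto
qed

section \<open>Free infinite divisibility\<close>

lemma right_inverse_on_cone_cong:
  assumes g: "right_inverse_on_cone M \<eta> A g" and eq: "\<And>w. w \<in> trunc_cone \<eta> A \<Longrightarrow> g w = g' w"
  shows "right_inverse_on_cone M \<eta> A g'"
proof -
  note D = right_inverse_on_coneD[OF g]
  have "g' holomorphic_on trunc_cone \<eta> A"
    by (rule holomorphic_transform[OF D(3) eq])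
  moreover have "\<forall>w\<in>trunc_cone \<eta> A. Im (g' w) > 0 \<and> recip_cauchy_transform M (g' w) = w"
  proof
    fix w assume w: "w \<in> trunc_cone \<eta> A"
    show "Im (g' w) > 0 \<and> recip_cauchy_transform M (g' w) = w"
      using D(4)[OF w] D(5)[OF w] by (simp only: eq[OF w] simp_thms)
  qed
  moreover have "((\<lambda>w. g' w / w) \<longlongrightarrow> 1) (inf at_infinity (principal (trunc_cone \<eta> A)))"
  proof (rule Lim_transform_eventually[OF D(6)])
    show "\<forall>\<^sub>F w in inf at_infinity (principal (trunc_cone \<eta> A)). g w / w = g' w / w"
      unfolding eventually_inf_principal by (intro always_eventually allI impI) (simp only: eq)
  qed
  ultimately show ?thesis
    using D(1,2) unfolding right_inverse_on_cone_def by (intro conjI)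
qed

text \<open>Exponent 1 is a separate alternative because the base rule supplies no cone on which
  \<rho> is invertible. Each further factor may shrink the cone.\<close>

lemma free_convolution_power_cumulant:
  assumes "is_free_convolution_power \<rho> n \<tau>"
  shows "real_distribution \<rho> \<and> real_distribution \<tau> \<and> (n = 1 \<and> \<tau> = \<rho> \<or>
    (\<exists>\<eta> A. invertible_on_cone \<rho> \<eta> A \<and> invertible_on_cone \<tau> \<eta> A \<and>
      (\<forall>z. 1 / z \<in> trunc_cone \<eta> A \<longrightarrow> free_cumulant \<tau> z = of_nat n * free_cumulant \<rho> z)))"
  using assms
proof (induction rule: is_free_convolution_power.induct)
  case one
  then show ?case by simp
next
  case (step n \<tau> \<mu>)
  from step.hyps(2) obtain \<eta> A where *: "real_distribution \<mu>" "invertible_on_cone \<tau> \<eta> A" "invertible_on_cone \<rho> \<eta> A"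
    "invertible_on_cone \<mu> \<eta> A" "\<forall>z. 1 / z \<in> trunc_cone \<eta> A \<longrightarrow> free_cumulant \<mu> z = free_cumulant \<tau> z + free_cumulant \<rho> z"
    unfolding is_free_convolution_def by (elim conjE exE)
  have rd: "real_distribution \<rho>" by (rule conjunct1[OF step.IH])
  have cases: "n = 1 \<and> \<tau> = \<rho> \<or> (\<exists>\<eta> A. invertible_on_cone \<rho> \<eta> A \<and> invertible_on_cone \<tau> \<eta> A \<and>
      (\<forall>z. 1 / z \<in> trunc_cone \<eta> A \<longrightarrow> free_cumulant \<tau> z = of_nat n * free_cumulant \<rho> z))"
    by (rule conjunct2[OF conjunct2[OF step.IH]])
  from cases have "\<exists>\<eta> A. invertible_on_cone \<rho> \<eta> A \<and> invertible_on_cone \<mu> \<eta> A \<and>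
      (\<forall>z. 1 / z \<in> trunc_cone \<eta> A \<longrightarrow> free_cumulant \<mu> z = of_nat (Suc n) * free_cumulant \<rho> z)"
  proof
    assume "n = 1 \<and> \<tau> = \<rho>"
    then show ?thesis using * by (intro exI[of _ \<eta>] exI[of _ A]) simp
  next
    assume "\<exists>\<eta> A. invertible_on_cone \<rho> \<eta> A \<and> invertible_on_cone \<tau> \<eta> A \<and>
      (\<forall>z. 1 / z \<in> trunc_cone \<eta> A \<longrightarrow> free_cumulant \<tau> z = of_nat n * free_cumulant \<rho> z)"
    then obtain \<eta>' A' where **: "invertible_on_cone \<rho> \<eta>' A'"
      "\<forall>z. 1 / z \<in> trunc_cone \<eta>' A' \<longrightarrow> free_cumulant \<tau> z = of_nat n * free_cumulant \<rho> z"
      by (elim conjE exE)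
    have pos: "\<eta> > 0" "\<eta>' > 0" "A > 0" "A' > 0"
      using *(3) **(1) right_inverse_on_coneD(1,2) unfolding invertible_on_cone_def by (elim exE, assumption?; blast)+
    have sub: "trunc_cone (min \<eta> \<eta>') (max A A') \<subseteq> trunc_cone \<eta> A" "trunc_cone (min \<eta> \<eta>') (max A A') \<subseteq> trunc_cone \<eta>' A'"
      by (rule trunc_cone_mono; use pos in simp)+
    have "invertible_on_cone \<rho> (min \<eta> \<eta>') (max A A')" "invertible_on_cone \<mu> (min \<eta> \<eta>') (max A A')"
      by (rule invertible_on_cone_mono[OF *(3)] invertible_on_cone_mono[OF *(4)]; use pos in simp)+
    moreover have "free_cumulant \<mu> z = of_nat (Suc n) * free_cumulant \<rho> z" if "1 / z \<in> trunc_cone (min \<eta> \<eta>') (max A A')" for z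
      using *(5)[rule_format, OF subsetD[OF sub(1) that]] **(2)[rule_format, OF subsetD[OF sub(2) that]]
      by (simp add: algebra_simps)
    ultimately show ?thesis
      by (intro exI[of _ "min \<eta> \<eta>'"] exI[of _ "max A A'"]) simp
  qed
  then show ?case using rd *(1) by simp
qed

text \<open>For n \<ge> 2 a common cone is available, and multiplying the cumulant identity by w = 1
  / z gives the additive form.\<close>

lemma free_convolution_power_right_inverse:
  assumes "is_free_convolution_power \<rho> n \<tau>" "n \<ge> 2"
  shows "\<exists>\<eta> A g h. right_inverse_on_cone \<rho> \<eta> A g \<and> right_inverse_on_cone \<tau> \<eta> A h \<and>
    (\<forall>w\<in>trunc_cone \<eta> A. h w - w = of_nat n * (g w - w))"
proof -
  from free_convolution_power_cumulant[OF assms(1)] assms(2)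
  have rd: "real_distribution \<rho>" "real_distribution \<tau>" and "\<exists>\<eta> A. invertible_on_cone \<rho> \<eta> A \<and> invertible_on_cone \<tau> \<eta> A \<and>
      (\<forall>z. 1 / z \<in> trunc_cone \<eta> A \<longrightarrow> free_cumulant \<tau> z = of_nat n * free_cumulant \<rho> z)"
    by simp_all
  then obtain \<eta> A g h where g: "right_inverse_on_cone \<rho> \<eta> A g" and h: "right_inverse_on_cone \<tau> \<eta> A h"
    and c: "\<forall>z. 1 / z \<in> trunc_cone \<eta> A \<longrightarrow> free_cumulant \<tau> z = of_nat n * free_cumulant \<rho> z"
    unfolding invertible_on_cone_def by (elim conjE exE)
  have "h w - w = of_nat n * (g w - w)" if w: "w \<in> trunc_cone \<eta> A" for w
  proof -
    have w0: "w \<noteq> 0" using subsetD[OF trunc_cone_subset_uhp w] right_inverse_on_coneD(2)[OF g] by auto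
    have w1: "1 / (1 / w) \<in> trunc_cone \<eta> A" using w by simp
    have "1 / w * h (1 / (1 / w)) - 1 = of_nat n * (1 / w * g (1 / (1 / w)) - 1)"
      using c[rule_format, OF w1] real_distribution.free_cumulant_eq[OF rd(1) g w1]
        real_distribution.free_cumulant_eq[OF rd(2) h w1] by (simp only:)
    then have "h w / w - 1 = of_nat n * (g w / w - 1)" by simp
    then have "w * (h w / w - 1) = w * (of_nat n * (g w / w - 1))" by (rule arg_cong)
    then show ?thesis using w0 by (simp add: right_diff_distrib mult.left_commute)
  qed
  then show ?thesis using g h by (intro exI conjI ballI)
qed

text \<open>Subordination: \<open>F\<^sub>\<tau>\<close> is subordinate to \<open>F\<^sub>\<rho>\<close> for an \<open>n\<close>-fold convolution power \<open>\<tau>\<close> of \<open>\<rho>\<close>, and the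
  subordination function is an explicit convex combination of the identity and \<open>F\<^sub>\<tau>\<close>.\<close>

lemma free_convolution_power_subordination:
  assumes "is_free_convolution_power \<rho> n \<tau>" "n \<ge> 2" "Im z > 0"
  defines "\<omega> \<equiv> \<lambda>z. of_real (1 / real n) * z + of_real (1 - 1 / real n) * recip_cauchy_transform \<tau> z"
  shows "recip_cauchy_transform \<rho> (\<omega> z) = recip_cauchy_transform \<tau> z" "Im (\<omega> z) \<ge> Im z"
proof -
  have rd: "real_distribution \<rho>" "real_distribution \<tau>"
    using free_convolution_power_cumulant[OF assms(1)] by simp_all
  interpret \<rho>: real_distribution \<rho> by fact
  interpret \<tau>: real_distribution \<tau> by fact
  let ?F = "recip_cauchy_transform \<tau>"
  from free_convolution_power_right_inverse[OF assms(1,2)] obtain \<eta> A g h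
    where g: "right_inverse_on_cone \<rho> \<eta> A g" and h: "right_inverse_on_cone \<tau> \<eta> A h"
      and gh: "\<forall>w\<in>trunc_cone \<eta> A. h w - w = of_nat n * (g w - w)"
    by (elim conjE exE)
  note gD = right_inverse_on_coneD[OF g] and hD = right_inverse_on_coneD[OF h]
  have Im_\<omega>: "Im (\<omega> z) \<ge> Im z" if "Im z > 0" for z
  proof -
    have "(1 - 1 / real n) * Im z \<le> (1 - 1 / real n) * Im (?F z)"
      using \<tau>.Im_recip_cauchy_transform_ge[OF that] assms(2) by (intro mult_left_mono) auto
    moreover have "Im (\<omega> z) = 1 / real n * Im z + (1 - 1 / real n) * Im (?F z)"
      by (simp only: \<omega>_def plus_complex.sel Im_complex_of_real times_complex.sel Re_complex_of_real; simp)
    moreover have "Im z = 1 / real n * Im z + (1 - 1 / real n) * Im z" by (simp add: algebra_simps)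
    ultimately show ?thesis by linarith
  qed
  show "Im (\<omega> z) \<ge> Im z" by (rule Im_\<omega>[OF assms(3)])
  have \<omega>_hol: "\<omega> holomorphic_on uhp"
    unfolding \<omega>_def by (intro holomorphic_intros \<tau>.recip_cauchy_transform_holomorphic)
  have comp_hol: "(\<lambda>z. recip_cauchy_transform \<rho> (\<omega> z)) holomorphic_on uhp"
    using holomorphic_on_compose_gen[OF \<omega>_hol \<rho>.recip_cauchy_transform_holomorphic] Im_\<omega>
    by (auto simp: o_def intro: less_le_trans)
  \<comment> \<open>The identity is checked at v = h w, where F of \<tau> is w: the relation between
    the inverses makes \<open>\<omega> v\<close> equal to g w, which F of \<rho> also sends to w.
    These v form an open set.\<close>
  show "recip_cauchy_transform \<rho> (\<omega> z) = ?F z"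
  proof (rule analytic_continuation_open[where s="h ` trunc_cone \<eta> A" and s'=uhp and f="\<lambda>z. recip_cauchy_transform \<rho> (\<omega> z)" and g="?F"])
    have "inj_on h (trunc_cone \<eta> A)"
      by (rule inj_on_inverseI[where g="?F"]) (rule hD(5))
    then show "open (h ` trunc_cone \<eta> A)"
      by (rule open_mapping_thm3[OF hD(3) open_trunc_cone])
    show "h ` trunc_cone \<eta> A \<noteq> {}" using trunc_cone_nonempty[OF hD(1,2)] by (simp only: image_is_empty simp_thms)
    show "h ` trunc_cone \<eta> A \<subseteq> uhp" using hD(4) by (intro image_subsetI) simp
    fix v assume "v \<in> h ` trunc_cone \<eta> A"
    then obtain w where w: "w \<in> trunc_cone \<eta> A" "v = h w" by (rule imageE) simp
    have Fv: "?F v = w" using hD(5)[OF w(1)] w(2) by simp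
    have n0: "of_nat n \<noteq> (0 :: complex)" using assms(2) by simp
    have v_eq: "v = w + of_nat n * (g w - w)" using gh w by (simp add: diff_eq_eq)
    have "\<omega> v = of_real (1 / real n) * v + of_real (1 - 1 / real n) * w"
      by (simp only: \<omega>_def Fv)
    also have "\<dots> = of_real (1 / real n) * (w + of_nat n * (g w - w)) + of_real (1 - 1 / real n) * w"
      by (subst v_eq) (rule refl)
    also have "\<dots> = g w" using n0 by (simp add: field_simps)
    finally show "recip_cauchy_transform \<rho> (\<omega> v) = ?F v" using gD(5)[OF w(1)] Fv by simp
  qed (use comp_hol \<tau>.recip_cauchy_transform_holomorphic connected_uhp open_uhp assms(3) in simp_all)
qed

text \<open>For an N-th root the reciprocal transform is close to w - H w / N, so N (w - F w) should
  approximate H. Its value at the moving point \<open>\<omega> n z\<close> is exactly z - F z, and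
  that point tends to F z; locally uniform convergence identifies the limit on the range of F, which
  contains a cone.\<close>

theorem free_inf_divisible_right_inverse:
  assumes "\<mu> \<in> free_inf_divisible"
  shows "\<exists>H\<in>free_levy_class. \<exists>\<eta> A. right_inverse_on_cone \<mu> \<eta> A (\<lambda>w. w + H w)"
proof -
  have \<mu>: "real_distribution \<mu>" and ex: "\<forall>n\<ge>1. \<exists>\<rho>. real_distribution \<rho> \<and> is_free_convolution_power \<rho> n \<mu>"
    using assms by (simp_all add: free_inf_divisible_def)
  interpret \<mu>: real_distribution \<mu> by fact
  let ?F = "recip_cauchy_transform \<mu>"
  \<comment> \<open>Subordination is available for exponents from 2 on.\<close>
  define N where "N n = real (n + 2)" for n
  have "\<forall>n. \<exists>\<rho>. real_distribution \<rho> \<and> is_free_convolution_power \<rho> (n + 2) \<mu>"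
    using ex by simp
  from choice[OF this] obtain \<rho> where \<rho>: "\<forall>n. real_distribution (\<rho> n) \<and> is_free_convolution_power (\<rho> n) (n + 2) \<mu>" ..
  have \<rho>_rd: "real_distribution (\<rho> n)" and \<rho>_pow: "is_free_convolution_power (\<rho> n) (n + 2) \<mu>" for n
    using \<rho> by simp_all
  define \<omega> where "\<omega> n z = of_real (1 / N n) * z + of_real (1 - 1 / N n) * ?F z" for n z
  have F\<omega>: "recip_cauchy_transform (\<rho> n) (\<omega> n z) = ?F z" if "Im z > 0" for n z
    unfolding \<omega>_def N_def by (rule free_convolution_power_subordination(1)[OF \<rho>_pow _ that]) simp
  have Im_\<omega>: "Im (\<omega> n z) \<ge> Im z" if "Im z > 0" for n z
    unfolding \<omega>_def N_def by (rule free_convolution_power_subordination(2)[OF \<rho>_pow _ that]) simp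
  define h where "h n w = of_real (N n) * (w - recip_cauchy_transform (\<rho> n) w)" for n w
  have N_pos: "N n > 0" for n by (simp add: N_def)
  have Im_h: "Im (h n w) \<le> 0" if "Im w > 0" for n w
    using real_distribution.Im_recip_cauchy_transform_ge[OF \<rho>_rd that, of n] N_pos[of n]
    by (simp add: h_def mult_le_0_iff)
  have h_norm: "norm (h n w - \<i>) \<ge> 1" if "Im w > 0" for n w
    using abs_Im_le_cmod[of "h n w - \<i>"] Im_h[OF that, of n] by simp
  \<comment> \<open>The values of h lie in the closed lower half-plane, at distance at least 1 from
    \<i>, so u has modulus at most 1 and Montel applies.\<close>
  define u where "u n w = 1 / (h n w - \<i>)" for n w
  have h_nz: "h n w - \<i> \<noteq> 0" if "Im w > 0" for n w using h_norm[OF that, of n] by auto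
  have u_hol: "u n holomorphic_on uhp" for n
    unfolding u_def h_def
    by (intro holomorphic_intros real_distribution.recip_cauchy_transform_holomorphic \<rho>_rd)
       (use h_nz in \<open>simp add: h_def\<close>)
  have u_norm: "norm (u n w) \<le> 1" if "Im w > 0" for n w
    using h_norm[OF that, of n] by (simp add: u_def norm_divide divide_le_eq)
  have u_nz: "u n w \<noteq> 0" if "Im w > 0" for n w using h_nz[OF that] by (simp add: u_def)
  obtain g r where g_hol: "g holomorphic_on uhp" and r: "strict_mono (r :: nat \<Rightarrow> nat)"
    and g_lim: "\<And>w. w \<in> uhp \<Longrightarrow> (\<lambda>n. u (r n) w) \<longlonglongrightarrow> g w"
    and g_unif: "\<And>K. compact K \<Longrightarrow> K \<subseteq> uhp \<Longrightarrow> uniform_limit K (u \<circ> r) g sequentially"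
  proof (rule Montel[of uhp "{f. f holomorphic_on uhp \<and> (\<forall>w\<in>uhp. norm (f w) \<le> 1)}" u])
    show "\<exists>B. \<forall>h\<in>{f. f holomorphic_on uhp \<and> (\<forall>w\<in>uhp. norm (f w) \<le> 1)}. \<forall>z\<in>K. norm (h z) \<le> B"
      if "compact K" "K \<subseteq> uhp" for K
      using that(2) by (intro exI[of _ 1]) (auto simp: subset_iff)
    show "range u \<subseteq> {f. f holomorphic_on uhp \<and> (\<forall>w\<in>uhp. norm (f w) \<le> 1)}"
      using u_hol u_norm by auto
    show "f holomorphic_on uhp" if "f \<in> {f. f holomorphic_on uhp \<and> (\<forall>w\<in>uhp. norm (f w) \<le> 1)}" for f
      using that by simp
    show "open uhp" by (rule open_uhp)
  qed (rule that)
  have g_F: "g (?F z) = 1 / (z - ?F z - \<i>)" if z: "Im z > 0" for z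
  proof -
    define w where "w = ?F z"
    have w: "Im w > 0" using \<mu>.Im_recip_cauchy_transform_ge[OF z] z by (simp add: w_def)
    have val: "u n (\<omega> n z) = 1 / (z - w - \<i>)" for n
    proof -
      have "h n (\<omega> n z) = of_real (N n) * (\<omega> n z - w)" unfolding h_def F\<omega>[OF z] w_def ..
      also have "\<dots> = z - w" using N_pos[of n] by (simp add: \<omega>_def w_def[symmetric] field_simps)
      finally show ?thesis by (simp add: u_def)
    qed
    have "(\<lambda>n. 1 / N n) \<longlonglongrightarrow> 0"
      unfolding N_def by (rule LIMSEQ_ignore_initial_segment[OF lim_1_over_n])
    then have "(\<lambda>n. \<omega> n z) \<longlonglongrightarrow> of_real 0 * z + of_real (1 - 0) * w"
      unfolding \<omega>_def w_def by (intro tendsto_intros)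
    then have \<omega>_lim: "(\<lambda>n. \<omega> (r n) z) \<longlonglongrightarrow> w"
      using LIMSEQ_subseq_LIMSEQ[OF _ r] by (simp add: o_def)
    obtain e where e: "e > 0" "cball w e \<subseteq> uhp"
      using open_contains_cball[of uhp] open_uhp w by auto
    have ev: "\<forall>\<^sub>F n in sequentially. \<omega> (r n) z \<in> cball w e"
      using tendstoD[OF \<omega>_lim e(1)] by eventually_elim (simp add: dist_commute less_imp_le)
    have "isCont g w"
      using holomorphic_on_imp_continuous_on[OF g_hol] w open_uhp by (simp add: continuous_on_eq_continuous_at)
    then have 1: "(\<lambda>n. g (\<omega> (r n) z)) \<longlonglongrightarrow> g w" by (rule isCont_tendsto_compose[OF _ \<omega>_lim])
    have 2: "(\<lambda>n. g (\<omega> (r n) z)) \<longlonglongrightarrow> 1 / (z - w - \<i>)"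
    proof (rule tendstoI)
      fix \<epsilon> :: real assume "\<epsilon> > 0"
      from uniform_limitD[OF g_unif[OF compact_cball e(2)] this]
      have "\<forall>\<^sub>F n in sequentially. \<forall>x\<in>cball w e. dist ((u \<circ> r) n x) (g x) < \<epsilon>" .
      with ev show "\<forall>\<^sub>F n in sequentially. dist (g (\<omega> (r n) z)) (1 / (z - w - \<i>)) < \<epsilon>"
      proof eventually_elim
        case (elim n)
        have "dist ((u \<circ> r) n (\<omega> (r n) z)) (g (\<omega> (r n) z)) < \<epsilon>" using elim by (intro bspec[OF elim(2) elim(1)])
        then show ?case by (simp only: o_def val dist_commute)
      qed
    qed
    show ?thesis using LIMSEQ_unique[OF 1 2] by (simp add: w_def)
  qed
  \<comment> \<open>Hurwitz handles a nonconstant limit. A constant limit takes the value known at F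
    \<i>, a reciprocal of a nonzero number.\<close>
  have g_nz: "g w \<noteq> 0" if w: "Im w > 0" for w
  proof (cases "g constant_on uhp")
    case True
    have i: "Im (?F \<i>) > 0" using \<mu>.Im_recip_cauchy_transform_ge[of \<i>] by simp
    from True obtain c where c: "\<forall>w\<in>uhp. g w = c" unfolding constant_on_def ..
    have "g w = g (?F \<i>)" using c w i by simp
    also have "\<dots> = 1 / (\<i> - ?F \<i> - \<i>)" by (rule g_F) simp
    also have "\<dots> \<noteq> 0" using i by auto
    finally show ?thesis .
  next
    case False
    show ?thesis
      by (rule Hurwitz_no_zeros[OF open_uhp connected_uhp _ g_hol g_unif False])
         (use u_hol u_nz w in \<open>simp_all add: o_def\<close>)
  qed
  define H where "H w = 1 / g w + \<i>" for w
  have H_hol: "H holomorphic_on uhp"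
    unfolding H_def by (intro holomorphic_intros g_hol) (simp add: g_nz)
  have Im_H: "Im (H w) \<le> 0" if w: "Im w > 0" for w
  proof -
    have "(\<lambda>n. 1 / u (r n) w + \<i>) \<longlonglongrightarrow> H w"
      unfolding H_def using g_lim[of w] w g_nz[OF w] by (intro tendsto_intros) simp_all
    then have "(\<lambda>n. h (r n) w) \<longlonglongrightarrow> H w" by (simp add: u_def)
    from tendsto_Im[OF this] show ?thesis
      by (rule LIMSEQ_le_const2) (use Im_h[OF w] in simp)
  qed
  have H_F: "H (?F z) = z - ?F z" if "Im z > 0" for z
    by (simp add: H_def g_F[OF that])
  \<comment> \<open>Writing \<mu> as a second power supplies a cone on which its own right inverse
    exists.\<close>
  from free_convolution_power_right_inverse[OF \<rho>_pow[of 0] le_add2]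
  obtain \<eta> A f where f: "right_inverse_on_cone \<mu> \<eta> A f" by (elim exE conjE)
  note fD = right_inverse_on_coneD[OF f]
  have fH: "f w = w + H w" if "w \<in> trunc_cone \<eta> A" for w
    using H_F[OF fD(4)[OF that]] by (simp add: fD(5)[OF that])
  have ri: "right_inverse_on_cone \<mu> \<eta> A (\<lambda>w. w + H w)"
    by (rule right_inverse_on_cone_cong[OF f fH])
  have "((\<lambda>y. f (\<i> * complex_of_real y) / (\<i> * complex_of_real y) - 1) \<longlongrightarrow> 1 - 1) at_top"
    by (intro tendsto_intros filterlim_compose[OF fD(6) filterlim_iy[OF fD(1,2)]])
  moreover have "\<forall>\<^sub>F y in at_top. f (\<i> * complex_of_real y) / (\<i> * complex_of_real y) - 1 = H (\<i> * complex_of_real y) / (\<i> * complex_of_real y)"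
    using eventually_gt_at_top[of A]
  proof eventually_elim
    case (elim y)
    have "\<i> * complex_of_real y \<noteq> 0" using elim fD(2) by simp
    then show ?case using fH[OF iy_in_trunc_cone[OF fD(1,2) elim]] by (simp add: add_divide_distrib)
  qed
  ultimately have "((\<lambda>y. H (\<i> * complex_of_real y) / (\<i> * complex_of_real y)) \<longlongrightarrow> 0) at_top"
    using Lim_transform_eventually by fastforce
  then have "H \<in> free_levy_class"
    using H_hol Im_H by (simp add: free_levy_class_def)
  then show ?thesis using ri by blast
qed

lemma free_levy_class_scale:
  assumes "H \<in> free_levy_class" "c \<ge> 0"
  shows "(\<lambda>w. of_real c * H w) \<in> free_levy_class"
proof -
  have "((\<lambda>y. of_real c * (H (\<i> * complex_of_real y) / (\<i> * complex_of_real y))) \<longlongrightarrow> of_real c * 0) at_top"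
    using assms(1) unfolding free_levy_class_def by (intro tendsto_intros) simp
  moreover have "(\<lambda>w. of_real c * H w) holomorphic_on uhp"
    using assms(1) unfolding free_levy_class_def by (intro holomorphic_intros) simp
  ultimately show ?thesis
    using assms by (simp add: free_levy_class_def mult_nonneg_nonpos)
qed

lemma is_free_convolution_right_inverseI:
  assumes rd: "real_distribution \<tau>1" "real_distribution \<tau>2" "real_distribution \<tau>"
    and g1: "right_inverse_on_cone \<tau>1 \<eta> A1 (\<lambda>w. w + H1 w)"
    and g2: "right_inverse_on_cone \<tau>2 \<eta> A2 (\<lambda>w. w + H2 w)"
    and g: "right_inverse_on_cone \<tau> \<eta> A3 (\<lambda>w. w + (H1 w + H2 w))"
  shows "is_free_convolution \<tau>1 \<tau>2 \<tau>"
proof -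
  define A where "A = max A1 (max A2 A3)"
  have \<eta>: "\<eta> > 0" by (rule right_inverse_on_coneD(1)[OF g])
  have r: "right_inverse_on_cone \<tau>1 \<eta> A (\<lambda>w. w + H1 w)" "right_inverse_on_cone \<tau>2 \<eta> A (\<lambda>w. w + H2 w)"
    "right_inverse_on_cone \<tau> \<eta> A (\<lambda>w. w + (H1 w + H2 w))"
    by (rule right_inverse_on_cone_mono[OF g1 \<eta>] right_inverse_on_cone_mono[OF g2 \<eta>]
          right_inverse_on_cone_mono[OF g \<eta>]; simp add: A_def)+
  have "free_cumulant \<tau> z = free_cumulant \<tau>1 z + free_cumulant \<tau>2 z" if z: "1 / z \<in> trunc_cone \<eta> A" for z
  proof -
    have "z \<noteq> 0" using subsetD[OF trunc_cone_subset_uhp z] right_inverse_on_coneD(2)[OF r(1)] by auto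
    then show ?thesis
      unfolding real_distribution.free_cumulant_eq[OF rd(1) r(1) z] real_distribution.free_cumulant_eq[OF rd(2) r(2) z]
        real_distribution.free_cumulant_eq[OF rd(3) r(3) z]
      by (simp add: distrib_left)
  qed
  moreover have "invertible_on_cone \<tau>1 \<eta> A" "invertible_on_cone \<tau>2 \<eta> A" "invertible_on_cone \<tau> \<eta> A"
    unfolding invertible_on_cone_def by (rule exI, rule r)+
  ultimately show ?thesis
    unfolding is_free_convolution_def using rd by (intro conjI exI[of _ \<eta>] exI[of _ A] allI impI)
qed

text \<open>The laws belonging to (k / n) H form a chain in which each step convolves with the law
  for k = 1, because the functions H add.\<close>

theorem free_inf_divisibleI:
  assumes \<mu>: "real_distribution \<mu>" and H: "H \<in> free_levy_class"
    and g: "right_inverse_on_cone \<mu> \<eta> A (\<lambda>w. w + H w)"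
  shows "\<mu> \<in> free_inf_divisible"
proof -
  have \<eta>: "\<eta> > 0" by (rule right_inverse_on_coneD(1)[OF g])
  have "\<exists>\<rho>. real_distribution \<rho> \<and> is_free_convolution_power \<rho> n \<mu>" if n: "n \<ge> 1" for n
  proof -
    \<comment> \<open>The member k = n is prescribed to be \<mu>, so that the chain passes through
      the given law and not merely through some law with the same H.\<close>
    have "\<forall>k. \<exists>\<tau>. (k = n \<longrightarrow> \<tau> = \<mu>) \<and> real_distribution \<tau> \<and>
        (\<exists>A. right_inverse_on_cone \<tau> \<eta> A (\<lambda>w. w + of_real (real k / real n) * H w))"
    proof
      fix k
      show "\<exists>\<tau>. (k = n \<longrightarrow> \<tau> = \<mu>) \<and> real_distribution \<tau> \<and>
        (\<exists>A. right_inverse_on_cone \<tau> \<eta> A (\<lambda>w. w + of_real (real k / real n) * H w))"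
      proof (cases "k = n")
        case True
        have "right_inverse_on_cone \<mu> \<eta> A (\<lambda>w. w + of_real (real k / real n) * H w)"
          using g True n by simp
        then show ?thesis using \<mu> by blast
      next
        case False
        have "\<exists>\<rho>. real_distribution \<rho> \<and> (\<forall>\<eta>>0. \<exists>A>0. right_inverse_on_cone \<rho> \<eta> A (\<lambda>w. w + of_real (real k / real n) * H w))"
          by (intro exists_measure_right_inverse free_levy_class_scale H) simp
        then show ?thesis using \<eta> False by blast
      qed
    qed
    from choice[OF this] obtain R where R: "\<forall>k. (k = n \<longrightarrow> R k = \<mu>) \<and> real_distribution (R k) \<and>
        (\<exists>A. right_inverse_on_cone (R k) \<eta> A (\<lambda>w. w + of_real (real k / real n) * H w))" ..
    have "is_free_convolution_power (R 1) (Suc k) (R (Suc k))" for k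
    proof (induction k)
      case 0
      then show ?case using is_free_convolution_power.one[of "R 1"] R by simp
    next
      case (Suc k)
      obtain A1 A2 A3 where
        a1: "right_inverse_on_cone (R (Suc k)) \<eta> A1 (\<lambda>w. w + of_real (real (Suc k) / real n) * H w)" and
        a2: "right_inverse_on_cone (R 1) \<eta> A2 (\<lambda>w. w + of_real (real 1 / real n) * H w)" and
        a3: "right_inverse_on_cone (R (Suc (Suc k))) \<eta> A3 (\<lambda>w. w + of_real (real (Suc (Suc k)) / real n) * H w)"
        using R by meson
      have "of_real (real (Suc (Suc k)) / real n) * H w = of_real (real (Suc k) / real n) * H w + of_real (real 1 / real n) * H w" for w
        by (simp add: add_divide_distrib algebra_simps)
      then have "is_free_convolution (R (Suc k)) (R 1) (R (Suc (Suc k)))"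
        using a3 by (intro is_free_convolution_right_inverseI[OF _ _ _ a1 a2]) (use R in simp_all)
      with Suc show ?case by (rule is_free_convolution_power.step)
    qed
    from this[of "n - 1"] have "is_free_convolution_power (R 1) n \<mu>" using R n by simp
    then show ?thesis using R by blast
  qed
  then show ?thesis using \<mu> by (simp add: free_inf_divisible_def)
qed

section \<open>Reflections\<close>

lemma (in finite_borel_measure) cauchy_transform_distr_uminus:
  assumes "Im z \<noteq> 0"
  shows "cauchy_transform (distr M borel uminus) z = - cnj (cauchy_transform M (- cnj z))"
proof -
  note [measurable_cong] = M_is_borel
  have "cauchy_transform (distr M borel uminus) z = (LINT x|M. 1 / (z - complex_of_real (- x)))"
    unfolding cauchy_transform_def by (rule integral_distr) auto
  also have "\<dots> = (LINT x|M. - cnj (1 / (- cnj z - complex_of_real x)))"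
  proof (intro Bochner_Integration.integral_cong refl)
    fix x
    have "- cnj (1 / (- cnj z - complex_of_real x)) = - (1 / (- z - complex_of_real x))" by simp
    also have "\<dots> = 1 / (- (- z - complex_of_real x))" by (rule minus_divide_right)
    finally show "1 / (z - complex_of_real (- x)) = - cnj (1 / (- cnj z - complex_of_real x))" by simp
  qed
  also have "\<dots> = - (LINT x|M. cnj (1 / (- cnj z - complex_of_real x)))" by simp
  also have "(LINT x|M. cnj (1 / (- cnj z - complex_of_real x))) = cnj (cauchy_transform M (- cnj z))"
    unfolding cauchy_transform_def
    by (rule integral_bounded_linear[OF bounded_linear_cnj integrable_cauchy_kernel]) (use assms in simp)
  finally show ?thesis .
qed

lemma symmetric_iff_distr_uminus:
  assumes "real_distribution \<mu>"
  shows "(\<forall>B\<in>sets borel. measure \<mu> B = measure \<mu> (uminus ` B)) \<longleftrightarrow> distr \<mu> borel uminus = \<mu>"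
proof -
  interpret real_distribution \<mu> by fact
  have vim: "uminus -` B = uminus ` B" for B :: "real set"
  proof (intro set_eqI iffI)
    fix x assume "x \<in> uminus -` B"
    then show "x \<in> uminus ` B" by (intro image_eqI[of x uminus "- x"]) simp_all
  qed auto
  have em: "emeasure (distr \<mu> borel uminus) B = emeasure \<mu> (uminus ` B)" if "B \<in> sets borel" for B
    using that by (subst emeasure_distr) (simp_all add: vim)
  show ?thesis
  proof
    assume L: "\<forall>B\<in>sets borel. measure \<mu> B = measure \<mu> (uminus ` B)"
    show "distr \<mu> borel uminus = \<mu>"
    proof (rule measure_eqI)
      fix B assume "B \<in> sets (distr \<mu> borel uminus)"
      then have B: "B \<in> sets borel" by simp
      show "emeasure (distr \<mu> borel uminus) B = emeasure \<mu> B"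
        unfolding em[OF B] using bspec[OF L B] by (simp only: emeasure_eq_measure)
    qed simp
  next
    assume R: "distr \<mu> borel uminus = \<mu>"
    show "\<forall>B\<in>sets borel. measure \<mu> B = measure \<mu> (uminus ` B)"
    proof
      fix B :: "real set" assume B: "B \<in> sets borel"
      show "measure \<mu> B = measure \<mu> (uminus ` B)"
        using em[OF B] unfolding R by (simp add: measure_def)
    qed
  qed
qed

lemma real_distribution_distr_uminus: "real_distribution \<mu> \<Longrightarrow> real_distribution (distr \<mu> borel uminus)"
proof -
  assume "real_distribution \<mu>"
  then interpret real_distribution \<mu> .
  show ?thesis by (rule real_distribution_distr) simp
qed

lemma minus_cnj_holomorphic:
  assumes "H holomorphic_on uhp"
  shows "(\<lambda>w. - cnj (H (- cnj w))) holomorphic_on uhp"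
proof -
  have "(\<lambda>w. H (- w)) holomorphic_on cnj ` uhp"
  proof -
    have "uminus ` cnj ` uhp \<subseteq> uhp" by auto
    from holomorphic_on_compose_gen[OF holomorphic_on_minus[OF holomorphic_on_ident] assms this]
    show ?thesis by (simp only: o_def)
  qed
  from holomorphic_on_compose_cnj_cnj[OF this open_uhp]
  have "(\<lambda>w. cnj (H (- cnj w))) holomorphic_on uhp" by (simp add: o_def)
  then show ?thesis by (rule holomorphic_on_minus)
qed

text \<open>Reflection of \<open>\<mu>\<close> turns the inverse \<open>g\<close> of its reciprocal Cauchy transform into
  \<open>w \<mapsto> - cnj (g (- cnj w))\<close>.\<close>

lemma symmetric_imp_odd:
  assumes \<mu>: "real_distribution \<mu>" and sym: "distr \<mu> borel uminus = \<mu>"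
    and H: "H holomorphic_on uhp" and g: "right_inverse_on_cone \<mu> \<eta> A (\<lambda>w. w + H w)"
    and w: "w \<in> trunc_cone \<eta> A"
  shows "H (- cnj w) = - cnj (H w)"
proof -
  interpret real_distribution \<mu> by fact
  note D = right_inverse_on_coneD[OF g]
  have uhp: "Im v > 0" if "v \<in> trunc_cone \<eta> A" for v
    using subsetD[OF trunc_cone_subset_uhp[OF D(2)] that] by simp
  have F: "recip_cauchy_transform \<mu> (- cnj v) = - cnj (recip_cauchy_transform \<mu> v)" if "Im v > 0" for v
  proof -
    have "cauchy_transform \<mu> (- cnj v) = - cnj (cauchy_transform \<mu> v)"
      using cauchy_transform_distr_uminus[of "- cnj v"] that by (simp add: sym)
    then show ?thesis by (simp add: recip_cauchy_transform_def)
  qed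
  have "right_inverse_on_cone \<mu> \<eta> A (\<lambda>w. w + (- cnj (H (- cnj w))))"
    unfolding right_inverse_on_cone_def
  proof (intro conjI D(1,2) ballI)
    show "(\<lambda>w. w + (- cnj (H (- cnj w)))) holomorphic_on trunc_cone \<eta> A"
      by (intro holomorphic_intros holomorphic_on_subset[OF minus_cnj_holomorphic[OF H] trunc_cone_subset_uhp[OF D(2)]])
  next
    fix v assume v: "v \<in> trunc_cone \<eta> A"
    then have v': "- cnj v \<in> trunc_cone \<eta> A" by (simp only: trunc_cone_minus_cnj)
    have eq: "v + (- cnj (H (- cnj v))) = - cnj (- cnj v + H (- cnj v))" by simp
    show "Im (v + (- cnj (H (- cnj v)))) > 0" unfolding eq using D(4)[OF v'] by simp
    show "recip_cauchy_transform \<mu> (v + (- cnj (H (- cnj v)))) = v"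
      unfolding eq F[OF D(4)[OF v']] D(5)[OF v'] by simp
  next
    show "((\<lambda>w. (w + (- cnj (H (- cnj w)))) / w) \<longlongrightarrow> 1) (inf at_infinity (principal (trunc_cone \<eta> A)))"
    proof (rule tendsto_inf_at_infinityI)
      fix z :: "nat \<Rightarrow> complex"
      assume z: "\<And>n. z n \<in> trunc_cone \<eta> A" and zi: "filterlim z at_infinity sequentially"
      have "filterlim (\<lambda>n. - cnj (z n)) at_infinity sequentially"
        using zi by (simp add: filterlim_at_infinity_conv_norm_at_top)
      then have "(\<lambda>n. (- cnj (z n) + H (- cnj (z n))) / (- cnj (z n))) \<longlonglongrightarrow> 1"
        by (intro tendsto_inf_at_infinityD[OF D(6)]) (simp add: trunc_cone_minus_cnj z)
      note lim = tendsto_cnj[OF this, unfolded complex_cnj_one]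
      show "(\<lambda>n. (z n + (- cnj (H (- cnj (z n))))) / z n) \<longlonglongrightarrow> 1"
      proof (rule Lim_transform_eventually[OF lim])
        have "cnj ((- cnj a + b) / (- cnj a)) = (a + (- cnj b)) / a" for a b
          by (cases "a = 0") (simp_all add: field_simps)
        then show "\<forall>\<^sub>F n in sequentially. cnj ((- cnj (z n) + H (- cnj (z n))) / (- cnj (z n))) = (z n + (- cnj (H (- cnj (z n))))) / z n"
          by (intro always_eventually allI)
      qed
    qed
  qed
  from right_inverse_on_cone_unique[OF g this w w]
  have "H w = - cnj (H (- cnj w))" by simp
  then have "cnj (H w) = cnj (- cnj (H (- cnj w)))" by (rule arg_cong)
  then show ?thesis by simp
qed

text \<open>At g w the Cauchy transform of \<mu> is 1 / w. Oddness gives - cnj (g w) = g (- cnj w),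
  so the reflected law has the same value there, and these points form an open set.\<close>

lemma odd_imp_symmetric:
  assumes \<mu>: "real_distribution \<mu>" and g: "right_inverse_on_cone \<mu> \<eta> A (\<lambda>w. w + H w)"
    and odd: "\<And>w. w \<in> trunc_cone \<eta> A \<Longrightarrow> H (- cnj w) = - cnj (H w)"
  shows "distr \<mu> borel uminus = \<mu>"
proof -
  interpret real_distribution \<mu> by fact
  interpret D: real_distribution "distr \<mu> borel uminus"
    by (rule real_distribution_distr_uminus[OF \<mu>])
  note D = right_inverse_on_coneD[OF g]
  let ?g = "\<lambda>w. w + H w"
  have G_g: "cauchy_transform \<mu> (?g w) = 1 / w" if "w \<in> trunc_cone \<eta> A" for w
  proof -
    have "1 / recip_cauchy_transform \<mu> (?g w) = cauchy_transform \<mu> (?g w)"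
      by (simp add: recip_cauchy_transform_def)
    then show ?thesis unfolding D(5)[OF that] by simp
  qed
  have "cauchy_transform (distr \<mu> borel uminus) z = cauchy_transform \<mu> z" if "Im z > 0" for z
  proof (rule analytic_continuation_open[where s="?g ` trunc_cone \<eta> A" and s'=uhp
        and f="cauchy_transform (distr \<mu> borel uminus)" and g="cauchy_transform \<mu>"])
    have "inj_on ?g (trunc_cone \<eta> A)"
      by (rule inj_on_inverseI[where g="recip_cauchy_transform \<mu>"]) (rule D(5))
    then show "open (?g ` trunc_cone \<eta> A)"
      by (rule open_mapping_thm3[OF D(3) open_trunc_cone])
    show "?g ` trunc_cone \<eta> A \<noteq> {}" using trunc_cone_nonempty[OF D(1,2)] by (simp only: image_is_empty simp_thms)
    show "?g ` trunc_cone \<eta> A \<subseteq> uhp" using D(4) by (intro image_subsetI) simp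
    fix v assume "v \<in> ?g ` trunc_cone \<eta> A"
    then obtain w where w: "w \<in> trunc_cone \<eta> A" "v = ?g w" by (rule imageE) simp
    have w': "- cnj w \<in> trunc_cone \<eta> A" using w by (simp only: trunc_cone_minus_cnj)
    have "Im v \<noteq> 0" using D(4)[OF w(1)] w(2) by simp
    from cauchy_transform_distr_uminus[OF this]
    have "cauchy_transform (distr \<mu> borel uminus) v = - cnj (cauchy_transform \<mu> (- cnj v))" .
    also have "- cnj v = ?g (- cnj w)" by (simp add: w(2) odd[OF w(1)])
    also have "- cnj (cauchy_transform \<mu> (?g (- cnj w))) = 1 / w" unfolding G_g[OF w'] by simp
    also have "\<dots> = cauchy_transform \<mu> v" unfolding w(2) G_g[OF w(1)] ..
    finally show "cauchy_transform (distr \<mu> borel uminus) v = cauchy_transform \<mu> v" .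
  qed (use that cauchy_transform_holomorphic_on_uhp D.cauchy_transform_holomorphic_on_uhp connected_uhp open_uhp in simp_all)
  then show ?thesis
    by (rule cauchy_transform_eq_imp_eq[OF D.finite_borel_measure_M finite_borel_measure_M])
qed

section \<open>Free regular transforms\<close>

lemma power2_notin_nonneg_Reals: "Im z \<noteq> 0 \<Longrightarrow> z\<^sup>2 \<notin> \<real>\<^sub>\<ge>\<^sub>0"
  by (auto simp: complex_nonneg_Reals_iff power2_eq_square mult_le_0_iff)

lemma inverse_notin_nonneg_Reals: "z \<notin> \<real>\<^sub>\<ge>\<^sub>0 \<Longrightarrow> 1 / z \<notin> \<real>\<^sub>\<ge>\<^sub>0" for z :: complex
  using nonneg_Reals_divide_I[of 1 "1 / z"] by auto

lemma one_minus_neq_0: "z \<notin> \<real>\<^sub>\<ge>\<^sub>0 \<Longrightarrow> 0 \<le> u \<Longrightarrow> 1 - z * complex_of_real u \<noteq> 0"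
proof
  assume z: "z \<notin> \<real>\<^sub>\<ge>\<^sub>0" and u: "0 \<le> u" and "1 - z * complex_of_real u = 0"
  then have "z * complex_of_real u = 1" by simp
  moreover from this have "u \<noteq> 0" by auto
  ultimately have "z = complex_of_real (1 / u)" by (simp add: field_simps)
  with z u show False by (simp add: complex_nonneg_Reals_iff)
qed

text \<open>The free regular formula with its Levy measure replaced by a finite measure: 1 / (1 - z
  u) - 1 = z u / (1 - z u), and u / (1 + u) is absorbed into the measure. At u = 0 the kernel is z,
  so an atom there acts as drift.\<close>

definition regular_fun :: "real \<Rightarrow> real measure \<Rightarrow> complex \<Rightarrow> complex" where
  "regular_fun b \<kappa> z =
     of_real b * z + (LINT u|\<kappa>. z * of_real (1 + u) / (1 - z * of_real u))"

locale regular_measure = finite_borel_measure +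
  assumes AE_nonneg: "AE u in M. 0 \<le> u"
begin

lemma AE_in_nonneg_Reals: "AE u in M. complex_of_real u \<in> \<real>\<^sub>\<ge>\<^sub>0"
  using AE_nonneg by eventually_elim (simp add: complex_nonneg_Reals_iff)

lemma integrable_cauchy_kernel_nonneg:
  assumes "w \<notin> \<real>\<^sub>\<ge>\<^sub>0"
  shows "integrable M (\<lambda>u. 1 / (w - complex_of_real u))"
proof -
  obtain d where d: "d > 0" "ball w d \<subseteq> - \<real>\<^sub>\<ge>\<^sub>0"
    using assms closed_nonneg_Reals_complex open_contains_ball[of "- \<real>\<^sub>\<ge>\<^sub>0"] by (auto simp: closed_def)
  show ?thesis
  proof (rule integrable_const_bound[where B="1 / d"])
    show "AE u in M. norm (1 / (w - complex_of_real u)) \<le> 1 / d"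
      using AE_in_nonneg_Reals
    proof eventually_elim
      case (elim u)
      then have "complex_of_real u \<notin> ball w d" using d by blast
      then have "norm (w - complex_of_real u) \<ge> d" by (simp add: dist_norm)
      then show ?case using d(1) by (auto simp: norm_divide intro!: frac_le)
    qed
  qed (simp add: measurable_M_eq)
qed

lemma regular_kernel_eq:
  assumes "z \<notin> \<real>\<^sub>\<ge>\<^sub>0" "0 \<le> u"
  shows "z * of_real (1 + u) / (1 - z * of_real u) = - 1 + (1 + 1 / z) * (1 / (1 / z - complex_of_real u))"
proof -
  have "z \<noteq> 0" using assms(1) by auto
  then have "1 / z - of_real u = (1 - z * of_real u) / z" by (simp add: field_simps)
  then show ?thesis using one_minus_neq_0[OF assms] \<open>z \<noteq> 0\<close> by (simp add: field_simps)
qed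

lemma
  assumes z: "z \<notin> \<real>\<^sub>\<ge>\<^sub>0"
  shows integrable_regular_kernel: "integrable M (\<lambda>u. z * of_real (1 + u) / (1 - z * of_real u))"
    and regular_fun_eq: "regular_fun b M z = of_real b * z - of_real (measure M UNIV) + (1 + 1 / z) * cauchy_transform M (1 / z)"
proof -
  have AE: "AE u in M. z * of_real (1 + u) / (1 - z * of_real u) = - 1 + (1 + 1 / z) * (1 / (1 / z - complex_of_real u))"
    using AE_nonneg by eventually_elim (rule regular_kernel_eq[OF z])
  have int: "integrable M (\<lambda>u. 1 / (1 / z - complex_of_real u))"
    by (rule integrable_cauchy_kernel_nonneg[OF inverse_notin_nonneg_Reals[OF z]])
  have int': "integrable M (\<lambda>u. - 1 + (1 + 1 / z) * (1 / (1 / z - complex_of_real u)))"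
    by (intro Bochner_Integration.integrable_add integrable_mult_right int integrable_const)
  show "integrable M (\<lambda>u. z * of_real (1 + u) / (1 - z * of_real u))"
    by (rule iffD2[OF integrable_cong_AE[OF _ _ AE] int']) (simp_all add: measurable_M_eq)
  have "(LINT u|M. z * of_real (1 + u) / (1 - z * of_real u)) = (LINT u|M. - 1 + (1 + 1 / z) * (1 / (1 / z - complex_of_real u)))"
    by (rule integral_cong_AE[OF _ _ AE]) (simp_all add: measurable_M_eq)
  also have "\<dots> = (LINT u|M. - 1) + (LINT u|M. (1 + 1 / z) * (1 / (1 / z - complex_of_real u)))"
    by (intro Bochner_Integration.integral_add integrable_mult_right int integrable_const)
  also have "(LINT u|M. (1 + 1 / z) * (1 / (1 / z - complex_of_real u))) = (1 + 1 / z) * cauchy_transform M (1 / z)"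
    unfolding cauchy_transform_def by (simp only: integral_mult_right_zero)
  also have "(LINT u|M. - 1 :: complex) = - of_real (measure M UNIV)"
    by (simp add: space_M scaleR_conv_of_real)
  finally show "regular_fun b M z = of_real b * z - of_real (measure M UNIV) + (1 + 1 / z) * cauchy_transform M (1 / z)"
    by (simp add: regular_fun_def)
qed

lemma regular_fun_cnj:
  assumes "z \<notin> \<real>\<^sub>\<ge>\<^sub>0"
  shows "regular_fun b M (cnj z) = cnj (regular_fun b M z)"
proof -
  have "(LINT u|M. cnj (z * of_real (1 + u) / (1 - z * of_real u))) = cnj (LINT u|M. z * of_real (1 + u) / (1 - z * of_real u))"
    by (rule integral_bounded_linear[OF bounded_linear_cnj integrable_regular_kernel[OF assms]])
  then show ?thesis by (simp add: regular_fun_def)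
qed

text \<open>Squaring moves nonreal points off the nonnegative half-line, where the Cauchy transform
  of a measure carried by that half-line is holomorphic. This function becomes the two-sided
  extension for the symmetric law.\<close>

lemma regular_fun_square_holomorphic: "(\<lambda>z. regular_fun b M (z\<^sup>2)) holomorphic_on - \<real>"
proof -
  have "(cauchy_transform M \<circ> (\<lambda>z. 1 / z\<^sup>2)) holomorphic_on - \<real>"
  proof (rule holomorphic_on_compose_gen)
    show "(\<lambda>z::complex. 1 / z\<^sup>2) holomorphic_on - \<real>" by (intro holomorphic_intros) auto
    show "cauchy_transform M holomorphic_on - \<real>\<^sub>\<ge>\<^sub>0"
      by (rule cauchy_transform_holomorphic_on[OF closed_nonneg_Reals_complex AE_in_nonneg_Reals])
    show "(\<lambda>z::complex. 1 / z\<^sup>2) ` (- \<real>) \<subseteq> - \<real>\<^sub>\<ge>\<^sub>0"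
    proof (rule image_subsetI)
      fix z :: complex assume "z \<in> - \<real>"
      then have "Im z \<noteq> 0" by (simp add: complex_is_Real_iff)
      then show "1 / z\<^sup>2 \<in> - \<real>\<^sub>\<ge>\<^sub>0"
        using inverse_notin_nonneg_Reals[OF power2_notin_nonneg_Reals] by simp
    qed
  qed
  then have comp: "(\<lambda>z. cauchy_transform M (1 / z\<^sup>2)) holomorphic_on - \<real>" by (simp only: o_def)
  have "(\<lambda>z. of_real b * z\<^sup>2 - of_real (measure M UNIV) + (1 + 1 / z\<^sup>2) * cauchy_transform M (1 / z\<^sup>2)) holomorphic_on - \<real>"
    by (intro holomorphic_intros comp) auto
  then show ?thesis
    by (rule holomorphic_transform)
       (simp add: regular_fun_eq[OF power2_notin_nonneg_Reals] complex_is_Real_iff)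
qed

text \<open>The function \<open>w \<mapsto> F\<^sup>-\<^sup>1 w - w\<close> of the free regular measure with the given transform.\<close>

lemma regular_fun_in_class:
  assumes b: "b \<ge> 0"
  shows "(\<lambda>w. w * regular_fun b M (1 / w)) \<in> free_levy_class"
proof -
  have nn: "w \<notin> \<real>\<^sub>\<ge>\<^sub>0" "1 / w \<notin> \<real>\<^sub>\<ge>\<^sub>0" "w \<noteq> 0" if "Im w > 0" for w
  proof -
    show 1: "w \<notin> \<real>\<^sub>\<ge>\<^sub>0" using that by (simp add: complex_nonneg_Reals_iff)
    show "1 / w \<notin> \<real>\<^sub>\<ge>\<^sub>0" by (rule inverse_notin_nonneg_Reals[OF 1])
    show "w \<noteq> 0" using that by auto
  qed
  have eq: "w * regular_fun b M (1 / w) = of_real b - w * of_real (measure M UNIV) + (w + w * w) * cauchy_transform M w"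
    if "Im w > 0" for w
    using nn(3)[OF that] by (simp add: regular_fun_eq[OF nn(2)[OF that]] algebra_simps)
  have "(\<lambda>w. of_real b - w * of_real (measure M UNIV) + (w + w * w) * cauchy_transform M w) holomorphic_on uhp"
    by (intro holomorphic_intros cauchy_transform_holomorphic_on_uhp)
  then have hol: "(\<lambda>w. w * regular_fun b M (1 / w)) holomorphic_on uhp"
    by (rule holomorphic_transform) (simp add: eq)
  have Im: "Im (w * regular_fun b M (1 / w)) \<le> 0" if w: "Im w > 0" for w
  proof -
    have int: "integrable M (\<lambda>u. w * (1 / w * of_real (1 + u) / (1 - 1 / w * of_real u)))"
      by (intro integrable_mult_right integrable_regular_kernel nn w)
    have "w * regular_fun b M (1 / w) = of_real b + (LINT u|M. w * (1 / w * of_real (1 + u) / (1 - 1 / w * of_real u)))"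
      using nn(3)[OF w] unfolding regular_fun_def integral_mult_right_zero by (simp add: distrib_left)
    then have "Im (w * regular_fun b M (1 / w)) = Im (LINT u|M. w * (1 / w * of_real (1 + u) / (1 - 1 / w * of_real u)))"
      by simp
    also have "\<dots> = (LINT u|M. Im (w * (1 / w * of_real (1 + u) / (1 - 1 / w * of_real u))))"
      by (rule integral_bounded_linear[OF bounded_linear_Im int, symmetric])
    also have "\<dots> \<le> 0"
    proof -
      have "0 \<le> (LINT u|M. - Im (w * (1 / w * of_real (1 + u) / (1 - 1 / w * of_real u))))"
      proof (rule integral_nonneg_AE)
        show "AE u in M. 0 \<le> - Im (w * (1 / w * of_real (1 + u) / (1 - 1 / w * of_real u)))"
          using AE_nonneg
        proof eventually_elim
          case (elim u)
          have "w * (1 / w * of_real (1 + u) / (1 - 1 / w * of_real u)) = of_real (1 + u) * (w / (w - of_real u))"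
            using nn(3)[OF w] diff_real_neq_0[of w u] w by (simp add: field_simps)
          \<comment> \<open>The sign is governed by u, so u \<ge> 0 keeps the values in the closed
            lower half-plane.\<close>
          moreover have "Im (w / (w - of_real u)) = - (u * Im w) / (cmod (w - of_real u))\<^sup>2"
            by (simp add: Im_divide cmod_power2 algebra_simps)
          moreover have "Im (of_real (1 + u) * v) = (1 + u) * Im v" for v by simp
          ultimately have "- Im (w * (1 / w * of_real (1 + u) / (1 - 1 / w * of_real u))) = (1 + u) * (u * Im w / (cmod (w - of_real u))\<^sup>2)"
            by (simp only:; simp)
          also have "\<dots> \<ge> 0" using elim w by (intro mult_nonneg_nonneg divide_nonneg_nonneg) auto
          finally show ?case .
        qed
      qed
      then show ?thesis by simp
    qed
    finally show ?thesis .
  qed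
  have "((\<lambda>y. w y * regular_fun b M (1 / w y) / w y) \<longlongrightarrow> 0) at_top" if w_def: "w = (\<lambda>y. \<i> * complex_of_real y)" for w
  proof (rule tendsto_at_topI_sequentially)
    fix X :: "nat \<Rightarrow> real" assume X: "filterlim X at_top sequentially"
    have wi: "filterlim (\<lambda>n. w (X n)) (inf at_infinity (principal (trunc_cone 1 1))) sequentially"
      unfolding w_def by (rule filterlim_compose[OF filterlim_iy X]) simp_all
    then have wi': "filterlim (\<lambda>n. w (X n)) at_infinity sequentially"
      and ev: "\<forall>\<^sub>F n in sequentially. w (X n) \<in> trunc_cone 1 1"
      by (simp_all add: filterlim_inf filterlim_principal)
    from ev obtain N where "\<forall>n\<ge>N. w (X n) \<in> trunc_cone 1 1" unfolding eventually_sequentially ..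
    then have N: "\<And>n. n \<ge> N \<Longrightarrow> w (X n) \<in> trunc_cone 1 1" by simp
    define v where "v n = w (X (n + N))" for n
    have v: "v n \<in> trunc_cone 1 1" for n unfolding v_def by (rule N) simp
    have vi: "filterlim v at_infinity sequentially"
      unfolding v_def by (rule filterlim_compose[OF wi' filterlim_add_const_nat_at_top])
    have vu: "Im (v n) > 0" for n using subsetD[OF trunc_cone_subset_uhp v, of n] by simp
    have inv: "(\<lambda>n. 1 / v n) \<longlonglongrightarrow> 0" by (rule tendsto_divide_0[OF tendsto_const vi])
    have "(\<lambda>n. of_real b * (1 / v n) - of_real (measure M UNIV) + (1 / v n + 1) * (v n * cauchy_transform M (v n)))
      \<longlonglongrightarrow> of_real b * 0 - of_real (measure M UNIV) + (0 + 1) * of_real (measure M UNIV)"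
      by (intro tendsto_intros inv tendsto_cauchy_transform_cone[OF v _ vi]) simp
    moreover have "of_real b * (1 / v n) - of_real (measure M UNIV) + (1 / v n + 1) * (v n * cauchy_transform M (v n))
        = v n * regular_fun b M (1 / v n) / v n" for n
      unfolding eq[OF vu] using nn(3)[OF vu] by (simp add: field_simps)
    ultimately have "(\<lambda>n. v n * regular_fun b M (1 / v n) / v n) \<longlonglongrightarrow> 0" by simp
    then show "(\<lambda>n. w (X n) * regular_fun b M (1 / w (X n)) / w (X n)) \<longlonglongrightarrow> 0"
      unfolding v_def by (rule LIMSEQ_offset)
  qed
  from this[OF refl] show ?thesis
    using hol Im by (simp add: free_levy_class_def)
qed

end

lemma regular_measure_distr_square:
  assumes "finite_borel_measure \<sigma>"
  shows "regular_measure (distr \<sigma> borel (\<lambda>x. x\<^sup>2))"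
proof -
  interpret finite_borel_measure \<sigma> by fact
  note [measurable_cong] = M_is_borel
  have "finite_borel_measure (distr \<sigma> borel (\<lambda>x. x\<^sup>2))"
    unfolding finite_borel_measure_def finite_borel_measure_axioms_def by (simp add: finite_measure_distr)
  moreover have "AE u in distr \<sigma> borel (\<lambda>x. x\<^sup>2). 0 \<le> u"
    by (subst AE_distr_iff) auto
  ultimately show ?thesis by (simp add: regular_measure_def regular_measure_axioms_def)
qed

lemma nevanlinna_kernel_symmetrization:
  assumes "Im w > 0"
  shows "(1 + w * complex_of_real x) / (w - complex_of_real x) + (1 + w * complex_of_real (- x)) / (w - complex_of_real (- x))
    = 2 * (w * ((1 / w\<^sup>2) * of_real (1 + x\<^sup>2) / (1 - 1 / w\<^sup>2 * of_real (x\<^sup>2))))"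
proof -
  have nz: "w - of_real x \<noteq> 0" "w + of_real x \<noteq> 0" "w \<noteq> 0"
    using diff_real_neq_0[of w x] diff_real_neq_0[of w "- x"] assms by auto
  have f: "w\<^sup>2 - of_real (x\<^sup>2) = (w - of_real x) * (w + of_real x)" by (simp add: algebra_simps power2_eq_square)
  have "w * ((1 / w\<^sup>2) * of_real (1 + x\<^sup>2) / (1 - 1 / w\<^sup>2 * of_real (x\<^sup>2))) = w * of_real (1 + x\<^sup>2) / (w\<^sup>2 - of_real (x\<^sup>2))"
  proof -
    have "1 - 1 / w\<^sup>2 * of_real (x\<^sup>2) = (w\<^sup>2 - of_real (x\<^sup>2)) / w\<^sup>2" using nz(3) by (simp add: field_simps)
    then show ?thesis using nz(3) by simp
  qed
  also have "2 * \<dots> = 2 * w * of_real (1 + x\<^sup>2) / ((w - of_real x) * (w + of_real x))" unfolding f by simp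
  also have "\<dots> = (1 + w * complex_of_real x) / (w - complex_of_real x) + (1 + w * complex_of_real (- x)) / (w - complex_of_real (- x))"
  proof -
    have "(1 + w * complex_of_real x) / (w - complex_of_real x) + (1 + w * complex_of_real (- x)) / (w - complex_of_real (- x))
      = ((1 + w * of_real x) * (w + of_real x) + (1 - w * of_real x) * (w - of_real x)) / ((w - of_real x) * (w + of_real x))"
      using nz by (simp add: add_frac_eq)
    also have "(1 + w * of_real x) * (w + of_real x) + (1 - w * of_real x) * (w - of_real x) = 2 * w * of_real (1 + x\<^sup>2)"
      by (simp add: algebra_simps power2_eq_square)
    finally show ?thesis ..
  qed
  finally show ?thesis ..
qed

lemma free_levy_class_add:
  assumes "H1 \<in> free_levy_class" "H2 \<in> free_levy_class"
  shows "(\<lambda>w. H1 w + H2 w) \<in> free_levy_class"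
proof -
  have "((\<lambda>y. H1 (\<i> * complex_of_real y) / (\<i> * complex_of_real y) + H2 (\<i> * complex_of_real y) / (\<i> * complex_of_real y)) \<longlongrightarrow> 0 + 0) at_top"
    using assms unfolding free_levy_class_def by (intro tendsto_add) simp_all
  moreover have "(\<lambda>w. H1 w + H2 w) holomorphic_on uhp"
    using assms unfolding free_levy_class_def by (intro holomorphic_on_add) simp_all
  ultimately show ?thesis
    using assms by (simp add: free_levy_class_def add_divide_distrib add_nonpos_nonpos)
qed

lemma free_levy_class_inverse:
  assumes "b \<ge> 0"
  shows "(\<lambda>w. of_real b / w) \<in> free_levy_class"
proof -
  have inf: "filterlim (\<lambda>y. \<i> * complex_of_real y) at_infinity at_top"
    using filterlim_iy[of 1 1] by (simp add: filterlim_inf)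
  have "((\<lambda>y. (of_real b / (\<i> * complex_of_real y)) * (1 / (\<i> * complex_of_real y))) \<longlongrightarrow> 0 * 0) at_top"
    by (intro tendsto_mult tendsto_divide_0[OF tendsto_const inf])
  moreover have "(\<lambda>w. of_real b / w :: complex) holomorphic_on uhp" by (intro holomorphic_intros) auto
  moreover have "Im (of_real b / w) \<le> 0" if "Im w > 0" for w
    using that assms by (simp add: Im_divide divide_nonpos_nonneg)
  ultimately show ?thesis by (simp add: free_levy_class_def)
qed

text \<open>The symmetrization is undone: the function is b / w plus half the sum of the Nevanlinna
  functions of the images under the two square roots, and the class is closed under sums and
  nonnegative multiples.\<close>

lemma (in regular_measure) regular_fun_square_in_class:
  assumes b: "b \<ge> 0"
  shows "(\<lambda>w. w * regular_fun b M (1 / w\<^sup>2)) \<in> free_levy_class"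
proof -
  note [measurable_cong] = M_is_borel
  define P where "P = distr M borel sqrt"
  define N where "N = distr M borel (\<lambda>u. - sqrt u)"
  interpret P: finite_borel_measure P
    unfolding finite_borel_measure_def finite_borel_measure_axioms_def P_def by (simp add: finite_measure_distr)
  interpret N: finite_borel_measure N
    unfolding finite_borel_measure_def finite_borel_measure_axioms_def N_def by (simp add: finite_measure_distr)
  let ?H = "\<lambda>w. of_real b / w + of_real (1 / 2) * (nevanlinna_fun 0 P w + nevanlinna_fun 0 N w)"
  have H: "?H \<in> free_levy_class"
    by (intro free_levy_class_add free_levy_class_inverse b free_levy_class_scale P.nevanlinna_fun_in_class N.nevanlinna_fun_in_class) simp
  have eq: "?H w = w * regular_fun b M (1 / w\<^sup>2)" if w: "Im w > 0" for w
  proof -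
    let ?k = "\<lambda>x. (1 + w * complex_of_real x) / (w - complex_of_real x)"
    have w0: "Im w \<noteq> 0" "w \<noteq> 0" using w by auto
    have intP: "integrable M (\<lambda>u. ?k (sqrt u))"
      using P.integrable_nevanlinna_kernel[OF w0(1)] unfolding P_def by (subst (asm) integrable_distr_eq) auto
    have intN: "integrable M (\<lambda>u. ?k (- sqrt u))"
      using N.integrable_nevanlinna_kernel[OF w0(1)] unfolding N_def by (subst (asm) integrable_distr_eq) auto
    have "nevanlinna_fun 0 P w + nevanlinna_fun 0 N w = (LINT u|M. ?k (sqrt u)) + (LINT u|M. ?k (- sqrt u))"
      unfolding nevanlinna_fun_def P_def N_def by (subst integral_distr, simp, simp)+ simp
    also have "\<dots> = (LINT u|M. ?k (sqrt u) + ?k (- sqrt u))"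
      by (rule Bochner_Integration.integral_add[OF intP intN, symmetric])
    also have "\<dots> = (LINT u|M. 2 * (w * ((1 / w\<^sup>2) * of_real (1 + u) / (1 - 1 / w\<^sup>2 * of_real u))))"
    proof (rule integral_cong_AE)
      show "AE u in M. ?k (sqrt u) + ?k (- sqrt u) = 2 * (w * ((1 / w\<^sup>2) * of_real (1 + u) / (1 - 1 / w\<^sup>2 * of_real u)))"
        using AE_nonneg
      proof eventually_elim
        case (elim u)
        show ?case using nevanlinna_kernel_symmetrization[OF w, of "sqrt u"] unfolding real_sqrt_pow2[OF elim] .
      qed
    qed (auto simp: measurable_M_eq)
    also have "\<dots> = 2 * (w * (LINT u|M. (1 / w\<^sup>2) * of_real (1 + u) / (1 - 1 / w\<^sup>2 * of_real u)))"
      by (simp only: integral_mult_right_zero)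
    finally have "of_real (1 / 2) * (nevanlinna_fun 0 P w + nevanlinna_fun 0 N w) = w * (LINT u|M. (1 / w\<^sup>2) * of_real (1 + u) / (1 - 1 / w\<^sup>2 * of_real u))"
      by simp
    moreover have "w * (of_real b * (1 / w\<^sup>2)) = of_real b / w" using w0 by (simp add: power2_eq_square)
    ultimately show ?thesis unfolding regular_fun_def distrib_left by (simp only:)
  qed
  have "(\<lambda>w. w * regular_fun b M (1 / w\<^sup>2)) holomorphic_on uhp"
  proof (rule holomorphic_transform)
    show "?H holomorphic_on uhp" using H by (simp only: free_levy_class_def mem_Collect_eq)
  qed (rule eq, simp)
  moreover have "((\<lambda>y. \<i> * complex_of_real y * regular_fun b M (1 / (\<i> * complex_of_real y)\<^sup>2) / (\<i> * complex_of_real y)) \<longlongrightarrow> 0) at_top"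
  proof (rule Lim_transform_eventually)
    show "((\<lambda>y. ?H (\<i> * complex_of_real y) / (\<i> * complex_of_real y)) \<longlongrightarrow> 0) at_top"
      using H by (simp only: free_levy_class_def mem_Collect_eq)
    show "\<forall>\<^sub>F y in at_top. ?H (\<i> * complex_of_real y) / (\<i> * complex_of_real y) =
        \<i> * complex_of_real y * regular_fun b M (1 / (\<i> * complex_of_real y)\<^sup>2) / (\<i> * complex_of_real y)"
      using eventually_gt_at_top[of 0] by eventually_elim (subst eq, simp_all)
  qed
  moreover have "Im (w * regular_fun b M (1 / w\<^sup>2)) \<le> 0" if w: "Im w > 0" for w
    using H w unfolding eq[OF w, symmetric] by (simp only: free_levy_class_def mem_Collect_eq)
  ultimately show ?thesis by (simp add: free_levy_class_def)
qed

section \<open>Half sums of measures\<close>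

text \<open>Given by its values on Borel sets, with the factor 1 / 2 in the extended nonnegative
  reals, so that infinite Levy measures are covered.\<close>

definition half_sum :: "real measure \<Rightarrow> real measure \<Rightarrow> real measure" where
  "half_sum M N = measure_of UNIV (sets borel) (\<lambda>A. (1 / 2) * (emeasure M A + emeasure N A))"

lemma sets_half_sum [simp]: "sets (half_sum M N) = sets borel"
  using sets.sets_measure_of_eq[of "borel :: real measure"] by (simp add: half_sum_def)

locale half_sum_measures =
  fixes M N :: "real measure"
  assumes sets_M: "sets M = sets borel" and sets_N: "sets N = sets borel"
begin

lemma measurable_M: "borel_measurable M = borel_measurable borel"
  and measurable_N: "borel_measurable N = borel_measurable borel"
  and measurable_half: "borel_measurable (half_sum M N) = borel_measurable borel"
  by (rule measurable_cong_sets; simp add: sets_M sets_N)+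

lemma emeasure_half_sum:
  assumes "A \<in> sets borel"
  shows "emeasure (half_sum M N) A = (1 / 2) * (emeasure M A + emeasure N A)"
proof (rule emeasure_measure_of[OF half_sum_def])
  show "countably_additive (sets (half_sum M N)) (\<lambda>A. (1 / 2) * (emeasure M A + emeasure N A))"
  proof (rule countably_additiveI)
    fix A :: "nat \<Rightarrow> real set"
    assume A: "range A \<subseteq> sets (half_sum M N)" "disjoint_family A"
    have "(\<Sum>i. emeasure M (A i) + emeasure N (A i)) = (\<Sum>i. emeasure M (A i)) + (\<Sum>i. emeasure N (A i))"
      by (intro suminf_add[symmetric] summableI)
    also have "\<dots> = emeasure M (\<Union>i. A i) + emeasure N (\<Union>i. A i)"
      using A by (simp add: suminf_emeasure sets_M sets_N)
    finally show "(\<Sum>i. (1 / 2) * (emeasure M (A i) + emeasure N (A i))) = (1 / 2) * (emeasure M (\<Union>i. A i) + emeasure N (\<Union>i. A i))"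
      by (simp only: ennreal_suminf_cmult)
  qed
qed (use assms in \<open>auto simp: positive_def\<close>)

lemma nn_integral_half_sum:
  assumes "f \<in> borel_measurable borel"
  shows "(\<integral>\<^sup>+x. f x \<partial>half_sum M N) = (1 / 2) * ((\<integral>\<^sup>+x. f x \<partial>M) + (\<integral>\<^sup>+x. f x \<partial>N))"
  using assms
proof (induction rule: borel_measurable_induct)
  case (cong f g)
  have "(\<lambda>x. f x) = (\<lambda>x. g x)" using cong by (intro ext) simp
  then show ?case using cong by (simp only:)
next
  case (set A)
  then show ?case by (simp add: emeasure_half_sum sets_M sets_N)
next
  case (mult u c)
  then show ?case
    by (simp add: nn_integral_cmult measurable_M measurable_N measurable_half distrib_left mult.left_commute)
next
  case (add u v)
  then show ?case
    by (simp add: nn_integral_add measurable_M measurable_N measurable_half distrib_left add_ac)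
next
  case (seq U)
  have "(\<integral>\<^sup>+x. (SUP i. U i) x \<partial>L) = (SUP i. \<integral>\<^sup>+x. U i x \<partial>L)" if "(borel_measurable L :: (real \<Rightarrow> ennreal) set) = borel_measurable borel" for L :: "real measure"
  proof -
    have "(\<lambda>x. (SUP i. U i) x) = (\<lambda>x. SUP i. U i x)" by (intro ext SUP_apply)
    moreover have "(\<integral>\<^sup>+x. (SUP i. U i x) \<partial>L) = (SUP i. \<integral>\<^sup>+x. U i x \<partial>L)"
      by (rule nn_integral_monotone_convergence_SUP) (use seq that in simp_all)
    ultimately show ?thesis by (simp only:)
  qed
  note L = this[OF measurable_M] this[OF measurable_N] this[OF measurable_half]
  have inc: "incseq (\<lambda>i. \<integral>\<^sup>+x. U i x \<partial>L)" for L :: "real measure"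
    using seq by (intro monoI nn_integral_mono) (auto dest: monoD le_funD)
  show ?case unfolding L seq.IH
    by (subst ennreal_SUP_add[OF inc inc, symmetric]) (simp add: SUP_mult_left_ennreal)
qed

lemma
  fixes f :: "real \<Rightarrow> real"
  assumes M: "integrable M f" and N: "integrable N f"
  shows integrable_half_sum_real: "integrable (half_sum M N) f"
    and integral_half_sum_real: "integral\<^sup>L (half_sum M N) f = (integral\<^sup>L M f + integral\<^sup>L N f) / 2"
proof -
  have f [measurable]: "f \<in> borel_measurable borel" using M by (auto simp: measurable_M)
  have fin: "(\<integral>\<^sup>+x. ennreal (f x) \<partial>M) < \<infinity>" "(\<integral>\<^sup>+x. ennreal (- f x) \<partial>M) < \<infinity>"
    "(\<integral>\<^sup>+x. ennreal (f x) \<partial>N) < \<infinity>" "(\<integral>\<^sup>+x. ennreal (- f x) \<partial>N) < \<infinity>"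
    using M N by (auto simp: real_integrable_def less_top)
  have half: "(1 / 2) * (a + b) < \<infinity>" "enn2real ((1 / 2) * (a + b)) = (enn2real a + enn2real b) / 2"
    if "a < \<infinity>" "b < \<infinity>" for a b :: ennreal
  proof -
    have h: "(1 / 2 :: ennreal) = ennreal (1 / 2)" using divide_ennreal[of 1 2] by simp
    have "(1 / 2 :: ennreal) < \<infinity>" unfolding h by (simp only: infinity_ennreal_def ennreal_less_top)
    then show "(1 / 2) * (a + b) < \<infinity>" using that by (simp add: ennreal_mult_less_top)
    have "enn2real ((1 / 2) * (a + b)) = enn2real (1 / 2) * enn2real (a + b)" by (rule enn2real_mult)
    also have "enn2real (1 / 2 :: ennreal) = 1 / 2"
      unfolding h by (rule enn2real_ennreal) simp
    also have "enn2real (a + b) = enn2real a + enn2real b" using that by (intro enn2real_plus) auto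
    finally show "enn2real ((1 / 2) * (a + b)) = (enn2real a + enn2real b) / 2" by simp
  qed
  have nn: "(\<integral>\<^sup>+x. ennreal (f x) \<partial>half_sum M N) = (1 / 2) * ((\<integral>\<^sup>+x. ennreal (f x) \<partial>M) + (\<integral>\<^sup>+x. ennreal (f x) \<partial>N))"
    "(\<integral>\<^sup>+x. ennreal (- f x) \<partial>half_sum M N) = (1 / 2) * ((\<integral>\<^sup>+x. ennreal (- f x) \<partial>M) + (\<integral>\<^sup>+x. ennreal (- f x) \<partial>N))"
    by (rule nn_integral_half_sum; measurable)+
  show I: "integrable (half_sum M N) f"
    unfolding real_integrable_def nn using half(1)[OF fin(1,3)] half(1)[OF fin(2,4)]
    by (simp add: measurable_half less_top)
  show "integral\<^sup>L (half_sum M N) f = (integral\<^sup>L M f + integral\<^sup>L N f) / 2"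
    unfolding real_lebesgue_integral_def[OF I] real_lebesgue_integral_def[OF M] real_lebesgue_integral_def[OF N]
      nn half(2)[OF fin(1,3)] half(2)[OF fin(2,4)] by (simp add: diff_divide_distrib add_divide_distrib)
qed

lemma
  fixes f :: "real \<Rightarrow> complex"
  assumes M: "integrable M f" and N: "integrable N f"
  shows integrable_half_sum: "integrable (half_sum M N) f"
    and integral_half_sum: "integral\<^sup>L (half_sum M N) f = (integral\<^sup>L M f + integral\<^sup>L N f) / 2"
proof -
  have Re: "integrable M (\<lambda>x. Re (f x))" "integrable N (\<lambda>x. Re (f x))"
    and Im: "integrable M (\<lambda>x. Im (f x))" "integrable N (\<lambda>x. Im (f x))"
    using M N by simp_all
  show I: "integrable (half_sum M N) f"
  proof -
    have "integrable (half_sum M N) (\<lambda>x. of_real (Re (f x)) + \<i> * of_real (Im (f x)))"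
      by (intro Bochner_Integration.integrable_add integrable_mult_right integrable_of_real
          integrable_half_sum_real Re Im)
    then show ?thesis by (simp only: complex_eq[symmetric])
  qed
  note re = integral_bounded_linear[OF bounded_linear_Re] and im = integral_bounded_linear[OF bounded_linear_Im]
  show "integral\<^sup>L (half_sum M N) f = (integral\<^sup>L M f + integral\<^sup>L N f) / 2"
    using integral_half_sum_real[OF Re] integral_half_sum_real[OF Im]
    unfolding re[OF M] re[OF N] re[OF I] im[OF M] im[OF N] im[OF I]
    by (simp add: complex_eq_iff)
qed

end

section \<open>Uniqueness of the free L\'evy measure\<close>

locale levy_measure =
  fixes \<nu> :: "real measure"
  assumes sets_levy: "sets \<nu> = sets borel" and null_0: "emeasure \<nu> {0} = 0"
    and finite_levy: "(\<integral>\<^sup>+x. ennreal (min 1 (x\<^sup>2)) \<partial>\<nu>) < \<infinity>"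
begin

lemma measurable_levy: "borel_measurable \<nu> = borel_measurable borel"
  by (rule measurable_cong_sets) (simp_all add: sets_levy)

lemma AE_neq_0: "AE x in \<nu>. x \<noteq> 0"
proof -
  have "{0} \<in> null_sets \<nu>" using null_0 by (simp add: null_sets_def sets_levy)
  from AE_not_in[OF this] show ?thesis by simp
qed

lemma integrable_levyI:
  fixes f :: "real \<Rightarrow> 'b::{banach, second_countable_topology}"
  assumes "f \<in> borel_measurable borel" "\<And>x. norm (f x) \<le> C * min 1 (x\<^sup>2)" "C \<ge> 0"
  shows "integrable \<nu> f"
proof (rule integrableI_bounded)
  have "(\<integral>\<^sup>+x. ennreal (norm (f x)) \<partial>\<nu>) \<le> (\<integral>\<^sup>+x. ennreal C * ennreal (min 1 (x\<^sup>2)) \<partial>\<nu>)"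
    using assms by (intro nn_integral_mono) (simp add: ennreal_mult[symmetric] ennreal_leI)
  also have "\<dots> = ennreal C * (\<integral>\<^sup>+x. ennreal (min 1 (x\<^sup>2)) \<partial>\<nu>)"
    by (rule nn_integral_cmult) (simp add: measurable_levy)
  also have "\<dots> < \<infinity>" using finite_levy by (simp add: ennreal_mult_less_top)
  finally show "(\<integral>\<^sup>+x. ennreal (norm (f x)) \<partial>\<nu>) < \<infinity>" .
qed (simp add: measurable_levy assms)

text \<open>The weight is comparable with min 1 (x^2), so the measure is finite; it is the measure
  of the Nevanlinna representation apart from an atom at 0.\<close>

definition levy_finite :: "real measure" where
  "levy_finite = density \<nu> (\<lambda>x. ennreal (x\<^sup>2 / (1 + x\<^sup>2)))"

text \<open>The Nevanlinna kernel centres with x / (1 + x^2), the Levy-Khintchine formula with x on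
  [-1, 1]; this is the resulting shift of the linear coefficient.\<close>

definition levy_drift :: real where
  "levy_drift = (LINT x|\<nu>. x * indicat_real {-1..1} x - x / (1 + x\<^sup>2))"

lemma finite_borel_measure_levy_finite: "finite_borel_measure levy_finite"
proof (rule finite_borel_measureI)
  have "emeasure levy_finite (space levy_finite) = (\<integral>\<^sup>+x. ennreal (x\<^sup>2 / (1 + x\<^sup>2)) * indicator (space \<nu>) x \<partial>\<nu>)"
    unfolding levy_finite_def by (subst emeasure_density) (simp_all add: measurable_levy)
  also have "\<dots> \<le> (\<integral>\<^sup>+x. ennreal (min 1 (x\<^sup>2)) \<partial>\<nu>)"
  proof (rule nn_integral_mono)
    fix x :: real
    have p: "1 + x\<^sup>2 > 0" by (rule add_pos_nonneg) simp_all
    have "x\<^sup>2 * 1 \<le> x\<^sup>2 * (1 + x\<^sup>2)" by (intro mult_left_mono) simp_all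
    then have "x\<^sup>2 / (1 + x\<^sup>2) \<le> min 1 (x\<^sup>2)" using p by (simp add: divide_le_eq)
    then show "ennreal (x\<^sup>2 / (1 + x\<^sup>2)) * indicator (space \<nu>) x \<le> ennreal (min 1 (x\<^sup>2))"
      by (auto simp: indicator_def intro: ennreal_leI)
  qed
  finally show "emeasure levy_finite (space levy_finite) \<noteq> \<infinity>" using finite_levy by (auto simp: less_top)
  show "sets levy_finite = sets borel" by (simp add: levy_finite_def sets_levy)
qed

sublocale F: finite_borel_measure levy_finite by (rule finite_borel_measure_levy_finite)

lemma AE_levy_finite_neq_0: "AE x in levy_finite. x \<noteq> 0"
proof -
  have "AE x in \<nu>. 0 < ennreal (x\<^sup>2 / (1 + x\<^sup>2)) \<longrightarrow> x \<noteq> 0" using AE_neq_0 by eventually_elim simp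
  then show ?thesis unfolding levy_finite_def by (subst AE_density) (simp_all only: measurable_levy, measurable)
qed

text \<open>The weight can be inverted off 0, and 0 is a null set. Uniqueness of the finite measure
  thereby yields uniqueness of \<nu>.\<close>

lemma levy_eq_density: "\<nu> = density levy_finite (\<lambda>x. ennreal ((1 + x\<^sup>2) / x\<^sup>2))"
proof -
  have "density levy_finite (\<lambda>x. ennreal ((1 + x\<^sup>2) / x\<^sup>2)) = density \<nu> (\<lambda>x. ennreal (x\<^sup>2 / (1 + x\<^sup>2)) * ennreal ((1 + x\<^sup>2) / x\<^sup>2))"
    unfolding levy_finite_def by (rule density_density_eq) (simp_all add: measurable_levy)
  also have "\<dots> = density \<nu> (\<lambda>_. 1)"
  proof (rule density_cong)
    show "AE x in \<nu>. ennreal (x\<^sup>2 / (1 + x\<^sup>2)) * ennreal ((1 + x\<^sup>2) / x\<^sup>2) = 1"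
      using AE_neq_0
    proof eventually_elim
      case (elim x)
      have "1 + x\<^sup>2 \<noteq> 0" by (metis add_pos_nonneg less_irrefl zero_le_power2 zero_less_one)
      then have "(x\<^sup>2 / (1 + x\<^sup>2)) * ((1 + x\<^sup>2) / x\<^sup>2) = 1" using elim by simp
      then show ?case by (subst ennreal_mult[symmetric]) simp_all
    qed
  qed (simp_all add: measurable_levy)
  also have "\<dots> = \<nu>" by (rule density_1)
  finally show ?thesis ..
qed

lemma integrable_drift_kernel: "integrable \<nu> (\<lambda>x. x * indicat_real {-1..1} x - x / (1 + x\<^sup>2))"
proof (rule integrable_levyI[where C=1])
  fix x :: real
  have p: "1 + x\<^sup>2 > 0" by (rule add_pos_nonneg) simp_all
  show "norm (x * indicat_real {-1..1} x - x / (1 + x\<^sup>2)) \<le> 1 * min 1 (x\<^sup>2)"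
  proof (cases "\<bar>x\<bar> \<le> 1")
    case True
    then have i: "indicat_real {-1..1} x = 1" by (simp add: abs_le_iff indicator_def) 
    have "x - x / (1 + x\<^sup>2) = x * (x\<^sup>2 / (1 + x\<^sup>2))" using p by (simp add: field_simps)
    then have "norm (x * indicat_real {-1..1} x - x / (1 + x\<^sup>2)) = \<bar>x\<bar> * (x\<^sup>2 / (1 + x\<^sup>2))"
      using p by (simp add: i abs_mult)
    also have "\<dots> \<le> 1 * (x\<^sup>2 / 1)" using True p by (intro mult_mono frac_le) simp_all
    also have "\<dots> = min 1 (x\<^sup>2)" using True by (simp add: abs_square_le_1)
    finally show ?thesis by simp
  next
    case False
    then have i: "indicat_real {-1..1} x = 0" by (auto simp: indicator_def)
    have sq: "x\<^sup>2 > 1" using False by (simp add: abs_square_less_1 not_le flip: not_le abs_square_le_1)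
    have "\<bar>x\<bar> \<le> 1 + x\<^sup>2" using sum_squares_bound[of "\<bar>x\<bar>" 1] zero_le_power2[of x] by simp
    then have "\<bar>x\<bar> / (1 + x\<^sup>2) \<le> 1" using p by (simp add: divide_le_eq)
    then show ?thesis using sq p by (simp add: i)
  qed
qed simp_all

lemma levy_kernel_eq:
  assumes z: "Im z \<noteq> 0"
  shows "1 / (1 - z * complex_of_real x) - 1 - z * complex_of_real x * complex_of_real (indicat_real {-1..1} x)
    = z * ((x\<^sup>2 / (1 + x\<^sup>2)) *\<^sub>R ((1 + (1 / z) * of_real x) / (1 / z - of_real x)))
      - z * of_real (x * indicat_real {-1..1} x - x / (1 + x\<^sup>2))"
proof -
  have z0: "z \<noteq> 0" using z by auto
  have nz: "1 - z * of_real x \<noteq> 0" 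
  proof
    assume "1 - z * complex_of_real x = 0"
    then have "z * complex_of_real x = 1" by simp
    then have "Im (z * complex_of_real x) = 0" "x \<noteq> 0" by auto
    then show False using z by simp
  qed
  have p: "1 + (complex_of_real x)\<^sup>2 \<noteq> 0"
  proof -
    have "1 + x\<^sup>2 > 0" by (rule add_pos_nonneg) simp_all
    then have "complex_of_real (1 + x\<^sup>2) \<noteq> 0" unfolding of_real_eq_0_iff by simp
    then show ?thesis by simp
  qed
  have k: "(1 + (1 / z) * of_real x) / (1 / z - of_real x) = (z + of_real x) / (1 - z * of_real x)"
  proof -
    have "1 + (1 / z) * of_real x = (z + of_real x) / z" "1 / z - of_real x = (1 - z * of_real x) / z"
      using z0 by (simp_all add: field_simps)
    then show ?thesis using z0 by simp
  qed
  define X where "X = complex_of_real x"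
  have "1 / (1 - z * X) - 1 = z * (X\<^sup>2 / (1 + X\<^sup>2) * ((z + X) / (1 - z * X))) + z * (X / (1 + X\<^sup>2))"
    using nz p unfolding X_def[symmetric] by (simp add: divide_simps) (simp add: algebra_simps power2_eq_square)
  then show ?thesis
    unfolding k scaleR_conv_of_real by (simp add: X_def algebra_simps)
qed

lemma integrable_levy_finite_kernel:
  assumes "Im w \<noteq> 0"
  shows "integrable \<nu> (\<lambda>x. (x\<^sup>2 / (1 + x\<^sup>2)) *\<^sub>R ((1 + w * complex_of_real x) / (w - of_real x)))"
  using F.integrable_nevanlinna_kernel[OF assms] unfolding levy_finite_def
  by (subst (asm) integrable_density) (simp_all add: measurable_levy)

lemma Im_inverse_neq_0: "Im z \<noteq> 0 \<Longrightarrow> Im (1 / z) \<noteq> 0"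
  by (auto simp: Im_divide complex_eq_iff sum_power2_eq_zero_iff)

lemma integrable_levy_kernel:
  assumes z: "Im z \<noteq> 0"
  shows "integrable \<nu> (\<lambda>x. 1 / (1 - z * complex_of_real x) - 1 - z * complex_of_real x * complex_of_real (indicat_real {-1..1} x))"
  unfolding levy_kernel_eq[OF z]
  by (intro Bochner_Integration.integrable_diff integrable_mult_right integrable_of_real
      integrable_levy_finite_kernel Im_inverse_neq_0 z integrable_drift_kernel)

text \<open>With w = 1 / z the summand a z is a / w. Since 1 / w is the Nevanlinna kernel at x = 0,
  the coefficient a is an atom at 0 kept apart from the Levy measure.\<close>

lemma levy_khintchine_eq:
  assumes z: "Im z \<noteq> 0"
  shows "levy_khintchine a \<nu> b z = z * (nevanlinna_fun (b - levy_drift) levy_finite (1 / z) + of_real a * z)"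
proof -
  let ?k = "\<lambda>x. (x\<^sup>2 / (1 + x\<^sup>2)) *\<^sub>R ((1 + (1 / z) * complex_of_real x) / (1 / z - of_real x))"
  let ?d = "\<lambda>x. x * indicat_real {-1..1} x - x / (1 + x\<^sup>2)"
  have "(LINT x|\<nu>. z * ?k x - z * of_real (?d x)) = (LINT x|\<nu>. z * ?k x) - (LINT x|\<nu>. z * of_real (?d x))"
    by (intro Bochner_Integration.integral_diff integrable_mult_right integrable_of_real
        integrable_levy_finite_kernel Im_inverse_neq_0 z integrable_drift_kernel)
  also have "(LINT x|\<nu>. z * ?k x) = z * (LINT x|\<nu>. ?k x)" by (simp only: integral_mult_right_zero)
  also have "(LINT x|\<nu>. ?k x) = (LINT x|levy_finite. (1 + (1 / z) * complex_of_real x) / (1 / z - of_real x))"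
    unfolding levy_finite_def by (subst integral_density) (simp_all add: measurable_levy)
  also have "(LINT x|\<nu>. z * of_real (?d x)) = z * (LINT x|\<nu>. of_real (?d x))" by (simp only: integral_mult_right_zero)
  also have "(LINT x|\<nu>. complex_of_real (?d x)) = of_real levy_drift"
    unfolding levy_drift_def by (rule integral_complex_of_real)
  finally show ?thesis
    unfolding levy_khintchine_def levy_kernel_eq[OF z] nevanlinna_fun_def
    by (simp add: algebra_simps power2_eq_square)
qed

end

text \<open>The limit of w H w along the imaginary axis towards 0 reads off the atom at 0, which is
  absent here. It separates a from the Levy measure in the uniqueness proof.\<close>

lemma (in finite_borel_measure) tendsto_nevanlinna_fun_0:
  assumes "AE x in M. x \<noteq> 0"
  shows "(\<lambda>n. (\<i> * of_real (1 / real (Suc n))) * nevanlinna_fun \<gamma> M (\<i> * of_real (1 / real (Suc n)))) \<longlonglongrightarrow> 0"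
proof -
  define y where "y n = 1 / real (Suc n)" for n
  define w where "w n = \<i> * complex_of_real (y n)" for n
  have y: "y n > 0" "y n \<le> 1" for n by (simp_all add: y_def)
  have y_lim: "y \<longlonglongrightarrow> 0" unfolding y_def by (intro LIMSEQ_Suc lim_1_over_n)
  have "(\<lambda>n. \<i> * complex_of_real (y n)) \<longlonglongrightarrow> \<i> * of_real 0"
    by (intro tendsto_intros y_lim)
  then have w_lim: "w \<longlonglongrightarrow> 0" by (simp add: w_def[abs_def])
  have "(\<lambda>n. LINT x|M. w n * ((1 + w n * complex_of_real x) / (w n - of_real x))) \<longlonglongrightarrow> (LINT x|M. 0)"
  proof (rule integral_dominated_convergence[where w="\<lambda>_. 2"])
    show "AE x in M. (\<lambda>n. w n * ((1 + w n * complex_of_real x) / (w n - of_real x))) \<longlonglongrightarrow> 0"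
      using assms
    proof eventually_elim
      case (elim x)
      have "(\<lambda>n. w n * ((1 + w n * complex_of_real x) / (w n - of_real x))) \<longlonglongrightarrow> 0 * ((1 + 0 * complex_of_real x) / (0 - of_real x))"
        using elim by (intro tendsto_intros w_lim) simp
      then show ?case by simp
    qed
    \<comment> \<open>The numerator is at most y + y^2 |x| with y \<le> 1, and both y and |x| are at
      most the distance |w - x|; each summand contributes 1.\<close>
    show "AE x in M. norm (w n * ((1 + w n * complex_of_real x) / (w n - of_real x))) \<le> 2" for n
    proof (intro always_eventually allI)
      fix x
      have wx: "y n \<le> cmod (w n - of_real x)" "\<bar>x\<bar> \<le> cmod (w n - of_real x)"
        using abs_Im_le_cmod[of "w n - of_real x"] abs_Re_le_cmod[of "w n - of_real x"] y[of n]
        by (simp_all add: w_def)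
      have pos: "cmod (w n - of_real x) > 0" using wx y[of n] by linarith
      have "cmod (w n * (1 + w n * of_real x)) \<le> y n * (1 + y n * \<bar>x\<bar>)"
        using norm_triangle_ineq[of 1 "w n * of_real x"] y[of n]
        by (simp add: norm_mult w_def)
      also have "\<dots> = y n + (y n * y n) * \<bar>x\<bar>" by (simp add: algebra_simps)
      also have "\<dots> \<le> cmod (w n - of_real x) + 1 * cmod (w n - of_real x)"
        using wx y[of n] by (intro add_mono mult_mono) (simp_all add: mult_le_one)
      finally show "norm (w n * ((1 + w n * complex_of_real x) / (w n - of_real x))) \<le> 2"
        using pos by (simp add: norm_divide norm_mult divide_le_eq)
    qed
  qed (simp_all add: measurable_M_eq)
  then have "(\<lambda>n. w n * of_real \<gamma> + (LINT x|M. w n * ((1 + w n * complex_of_real x) / (w n - of_real x)))) \<longlonglongrightarrow> 0 * of_real \<gamma> + 0"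
    by (intro tendsto_intros w_lim) simp
  moreover have "w n * of_real \<gamma> + (LINT x|M. w n * ((1 + w n * complex_of_real x) / (w n - of_real x))) = w n * nevanlinna_fun \<gamma> M (w n)" for n
    unfolding nevanlinna_fun_def integral_mult_right_zero by (simp only: distrib_left)
  ultimately show ?thesis by (simp add: w_def y_def)
qed

text \<open>Behaviour at 0 identifies a and a', the value at \<i> identifies the constants and
  masses, and what remains is an equality of Cauchy transforms off \<i>.\<close>

lemma nevanlinna_fun_unique:
  assumes "finite_borel_measure M" "finite_borel_measure N"
    and null: "AE x in M. x \<noteq> 0" "AE x in N. x \<noteq> 0"
    and eq: "\<And>w. Im w > 0 \<Longrightarrow> nevanlinna_fun \<gamma> M w + of_real a / w = nevanlinna_fun \<gamma>' N w + of_real a' / w"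
  shows "M = N"
proof -
  interpret M: finite_borel_measure M by fact
  interpret N: finite_borel_measure N by fact
  define w where "w n = \<i> * complex_of_real (1 / real (Suc n))" for n
  have w: "Im (w n) > 0" "w n \<noteq> 0" for n
  proof -
    show "Im (w n) > 0" by (simp add: w_def)
    then show "w n \<noteq> 0" by auto
  qed
  have 1: "(\<lambda>n. w n * nevanlinna_fun \<gamma> M (w n) + of_real a) \<longlonglongrightarrow> 0 + of_real a"
    unfolding w_def by (intro tendsto_intros M.tendsto_nevanlinna_fun_0 null)
  have 2: "(\<lambda>n. w n * nevanlinna_fun \<gamma>' N (w n) + of_real a') \<longlonglongrightarrow> 0 + of_real a'"
    unfolding w_def by (intro tendsto_intros N.tendsto_nevanlinna_fun_0 null)
  have "w n * nevanlinna_fun \<gamma> M (w n) + of_real a = w n * nevanlinna_fun \<gamma>' N (w n) + of_real a'" for n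
    using arg_cong[OF eq[OF w(1)[of n]], of "\<lambda>v. w n * v"] w(2)[of n] by (simp add: distrib_left)
  with 1 have "(\<lambda>n. w n * nevanlinna_fun \<gamma>' N (w n) + of_real a') \<longlonglongrightarrow> 0 + of_real a" by (simp only:)
  from LIMSEQ_unique[OF this 2] have "a = a'" by simp
  then have eq': "nevanlinna_fun \<gamma> M w = nevanlinna_fun \<gamma>' N w" if "Im w > 0" for w
    using eq[OF that] by simp
  \<comment> \<open>At \<i> the factor 1 + w^2 of the Cauchy transform vanishes; real and imaginary
    parts give two equations.\<close>
  have i: "complex_of_real \<gamma> - \<i> * of_real (measure M UNIV) = of_real \<gamma>' - \<i> * of_real (measure N UNIV)"
    using eq'[of \<i>] by (simp add: M.nevanlinna_fun_eq N.nevanlinna_fun_eq)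
  then have gm: "\<gamma> = \<gamma>'" "measure M UNIV = measure N UNIV" by (simp_all add: complex_eq_iff)
  have G: "cauchy_transform M w = cauchy_transform N w" if w: "Im w > 0" "w \<noteq> \<i>" for w
  proof -
    have "1 + w\<^sup>2 = (w - \<i>) * (w + \<i>)" by (simp add: algebra_simps power2_eq_square)
    moreover have "w + \<i> \<noteq> 0" using w by (auto simp: complex_eq_iff)
    ultimately have "1 + w\<^sup>2 \<noteq> 0" using w by simp
    moreover have "(1 + w\<^sup>2) * cauchy_transform M w = (1 + w\<^sup>2) * cauchy_transform N w"
      using eq'[OF w(1)] w(1) gm by (simp add: M.nevanlinna_fun_eq N.nevanlinna_fun_eq)
    ultimately show ?thesis by (simp only: mult_cancel_left simp_thms)
  qed
  show ?thesis
  proof (rule cauchy_transform_eq_imp_eq[OF assms(1,2)])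
    fix z :: complex assume z: "Im z > 0"
    show "cauchy_transform M z = cauchy_transform N z"
    proof (rule analytic_continuation_open[where s="uhp - {\<i>}" and s'=uhp
          and f="cauchy_transform M" and g="cauchy_transform N"])
      show "open (uhp - {\<i>})" by (intro open_delete open_uhp)
      have "2 * \<i> \<in> uhp - {\<i>}" by (simp add: complex_eq_iff)
      then show "uhp - {\<i>} \<noteq> {}" by (metis empty_iff)
    qed (use G z open_uhp connected_uhp M.cauchy_transform_holomorphic_on_uhp N.cauchy_transform_holomorphic_on_uhp in simp_all)
  qed
qed

section \<open>Passage between cumulant formulas and right inverses; consequences for
  uniqueness\<close>

lemma cumulant_right_inverse:
  assumes \<mu>: "real_distribution \<mu>" and inv: "invertible_on_cone \<mu> \<eta> A"
    and C: "\<forall>z. 1 / z \<in> trunc_cone \<eta> A \<longrightarrow> free_cumulant \<mu> z = C z"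
  shows "right_inverse_on_cone \<mu> \<eta> A (\<lambda>w. w + w * C (1 / w))"
proof -
  from inv obtain g where g: "right_inverse_on_cone \<mu> \<eta> A g" unfolding invertible_on_cone_def ..
  show ?thesis
  proof (rule right_inverse_on_cone_cong[OF g])
    fix w assume w: "w \<in> trunc_cone \<eta> A"
    have w0: "w \<noteq> 0" using subsetD[OF trunc_cone_subset_uhp w] right_inverse_on_coneD(2)[OF g] by auto
    have w1: "1 / (1 / w) \<in> trunc_cone \<eta> A" using w by simp
    have "C (1 / w) = 1 / w * g w - 1"
      using C[rule_format, OF w1] real_distribution.free_cumulant_eq[OF \<mu> g w1] by simp
    then show "g w = w + w * C (1 / w)" using w0 by (simp add: right_diff_distrib)
  qed
qed

lemma right_inverse_cumulant:
  assumes \<mu>: "real_distribution \<mu>" and g: "right_inverse_on_cone \<mu> \<eta> A (\<lambda>w. w + w * C (1 / w))"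
  shows "invertible_on_cone \<mu> \<eta> A" "\<forall>z. 1 / z \<in> trunc_cone \<eta> A \<longrightarrow> free_cumulant \<mu> z = C z"
proof -
  show "invertible_on_cone \<mu> \<eta> A" unfolding invertible_on_cone_def by (rule exI, rule g)
  show "\<forall>z. 1 / z \<in> trunc_cone \<eta> A \<longrightarrow> free_cumulant \<mu> z = C z"
  proof (intro allI impI)
    fix z assume z: "1 / z \<in> trunc_cone \<eta> A"
    have "z \<noteq> 0" using subsetD[OF trunc_cone_subset_uhp z] right_inverse_on_coneD(2)[OF g] by auto
    then show "free_cumulant \<mu> z = C z"
      unfolding real_distribution.free_cumulant_eq[OF \<mu> g z] by (simp add: distrib_left)
  qed
qed

lemma inverse_in_cone_imp_Im_neg:
  assumes "1 / z \<in> trunc_cone \<eta> A" "A > 0"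
  shows "Im z < 0"
proof -
  have "Im (1 / z) > 0" using subsetD[OF trunc_cone_subset_uhp[OF assms(2)] assms(1)] by simp
  then show ?thesis by (auto simp: Im_divide divide_less_0_iff not_sum_power2_lt_zero)
qed

lemma free_triplet_levy_measure: "free_triplet \<mu> a \<nu> b \<Longrightarrow> levy_measure \<nu>"
  by (simp add: free_triplet_def levy_measure_def)

text \<open>Both triplets describe the same right inverse on a common cone, so their Nevanlinna
  forms agree on the half-plane and their finite measures coincide.\<close>

lemma free_triplet_unique:
  assumes \<mu>: "real_distribution \<mu>" and t: "free_triplet \<mu> a \<nu> b" "free_triplet \<mu> a' \<nu>' b'"
  shows "\<nu> = \<nu>'"
proof -
  interpret \<mu>: real_distribution \<mu> by fact
  interpret N: levy_measure \<nu> by (rule free_triplet_levy_measure[OF t(1)])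
  interpret N': levy_measure \<nu>' by (rule free_triplet_levy_measure[OF t(2)])
  from t(1) obtain \<eta> A where "invertible_on_cone \<mu> \<eta> A" "\<forall>z. 1 / z \<in> trunc_cone \<eta> A \<longrightarrow> free_cumulant \<mu> z = levy_khintchine a \<nu> b z"
    unfolding free_triplet_def by (elim conjE exE)
  note r = cumulant_right_inverse[OF \<mu> this]
  from t(2) obtain \<eta>' A' where "invertible_on_cone \<mu> \<eta>' A'" "\<forall>z. 1 / z \<in> trunc_cone \<eta>' A' \<longrightarrow> free_cumulant \<mu> z = levy_khintchine a' \<nu>' b' z"
    unfolding free_triplet_def by (elim conjE exE)
  note r' = cumulant_right_inverse[OF \<mu> this]
  note D = right_inverse_on_coneD[OF r] and D' = right_inverse_on_coneD[OF r']
  let ?f = "\<lambda>w. nevanlinna_fun (b - N.levy_drift) N.levy_finite w + of_real a / w"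
  let ?f' = "\<lambda>w. nevanlinna_fun (b' - N'.levy_drift) N'.levy_finite w + of_real a' / w"
  have eq: "?f w = ?f' w" if w: "w \<in> trunc_cone \<eta> A \<inter> trunc_cone \<eta>' A'" for w
  proof -
    have w0: "Im w > 0" "w \<noteq> 0" using w subsetD[OF trunc_cone_subset_uhp, of A w \<eta>] D(2) by auto
    then have "Im (1 / w) \<noteq> 0" by (intro N.Im_inverse_neq_0) simp
    have "w + w * levy_khintchine a \<nu> b (1 / w) = w + w * levy_khintchine a' \<nu>' b' (1 / w)"
      using \<mu>.right_inverse_on_cone_unique[OF r r'] w by simp
    then show ?thesis
      using w0 unfolding N.levy_khintchine_eq[OF \<open>Im (1 / w) \<noteq> 0\<close>] N'.levy_khintchine_eq[OF \<open>Im (1 / w) \<noteq> 0\<close>]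
      by simp
  qed
  have "?f w = ?f' w" if "Im w > 0" for w
  proof (rule analytic_continuation_open[where s="trunc_cone \<eta> A \<inter> trunc_cone \<eta>' A'" and s'=uhp and f="?f" and g="?f'"])
    show "open (trunc_cone \<eta> A \<inter> trunc_cone \<eta>' A')" by (intro open_Int open_trunc_cone)
    show "trunc_cone \<eta> A \<inter> trunc_cone \<eta>' A' \<noteq> {}"
      unfolding trunc_cone_Int[OF D(2) D'(2)] using D(1,2) D'(1,2) by (intro trunc_cone_nonempty) simp_all
    show "trunc_cone \<eta> A \<inter> trunc_cone \<eta>' A' \<subseteq> uhp" using trunc_cone_subset_uhp[OF D(2)] by blast
    show "?f holomorphic_on uhp" by (intro holomorphic_intros N.F.nevanlinna_fun_holomorphic) auto
    show "?f' holomorphic_on uhp" by (intro holomorphic_intros N'.F.nevanlinna_fun_holomorphic) auto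
  qed (use eq that open_uhp connected_uhp in simp_all)
  then have "N.levy_finite = N'.levy_finite"
    by (rule nevanlinna_fun_unique[OF N.finite_borel_measure_levy_finite N'.finite_borel_measure_levy_finite
          N.AE_levy_finite_neq_0 N'.AE_levy_finite_neq_0])
  then show ?thesis using N.levy_eq_density N'.levy_eq_density by simp
qed

lemma free_levy_measure_eq:
  assumes "real_distribution \<mu>" "free_triplet \<mu> a \<nu> b"
  shows "free_levy_measure \<mu> = \<nu>"
  unfolding free_levy_measure_def
proof (rule the_equality)
  show "\<exists>a b. free_triplet \<mu> a \<nu> b" using assms(2) by (intro exI)
  show "\<nu>' = \<nu>" if "\<exists>a b. free_triplet \<mu> a \<nu>' b" for \<nu>'
    using that by (elim exE) (rule free_triplet_unique[OF assms(1) _ assms(2)])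
qed

text \<open>Reciprocals of a cone form a nonempty open part of the lower half-plane, where the
  identity theorem applies. The upper half-plane is a separate component and is reached through the
  conjugation condition.\<close>

lemma free_cumulant_ext_eq:
  assumes f: "free_cumulant_extension \<mu> f" and z: "Im z \<noteq> 0"
  shows "free_cumulant_ext \<mu> z = f z"
  unfolding free_cumulant_ext_def
proof (rule the_equality)
  show "\<exists>f'. free_cumulant_extension \<mu> f' \<and> f z = f' z" using f by (intro exI conjI) simp_all
  fix u assume "\<exists>f'. free_cumulant_extension \<mu> f' \<and> u = f' z"
  then obtain f' where f': "free_cumulant_extension \<mu> f'" "u = f' z" by (elim exE conjE)
  from f obtain \<eta> A where h: "f holomorphic_on - \<real>" "\<forall>z\<in>- \<real>. f (cnj z) = cnj (f z)" "invertible_on_cone \<mu> \<eta> A"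
    "\<forall>z. 1 / z \<in> trunc_cone \<eta> A \<longrightarrow> f z = free_cumulant \<mu> z"
    unfolding free_cumulant_extension_def by (elim conjE exE)
  from f'(1) obtain \<eta>' A' where h': "f' holomorphic_on - \<real>" "\<forall>z\<in>- \<real>. f' (cnj z) = cnj (f' z)" "invertible_on_cone \<mu> \<eta>' A'"
    "\<forall>z. 1 / z \<in> trunc_cone \<eta>' A' \<longrightarrow> f' z = free_cumulant \<mu> z"
    unfolding free_cumulant_extension_def by (elim conjE exE)
  from h(3) obtain g where g: "right_inverse_on_cone \<mu> \<eta> A g" unfolding invertible_on_cone_def ..
  from h'(3) obtain g' where g': "right_inverse_on_cone \<mu> \<eta>' A' g'" unfolding invertible_on_cone_def ..
  note D = right_inverse_on_coneD(1,2)[OF g] and D' = right_inverse_on_coneD(1,2)[OF g']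
  let ?L = "{z. Im z < 0}"
  let ?S = "{z. Im z < 0} \<inter> (\<lambda>z. 1 / z) -` trunc_cone (min \<eta> \<eta>') (max A A')"
  have openL: "open ?L" by (rule open_halfspace_Im_lt)
  have sub: "?L \<subseteq> - \<real>" by (auto simp: complex_is_Real_iff)
  have low: "f v = f' v" if "Im v < 0" for v
  proof (rule analytic_continuation_open[where s="?S" and s'="?L" and f=f and g=f'])
    have "continuous_on ?L (\<lambda>z. 1 / z)" by (intro continuous_intros) auto
    then show "open ?S" by (rule continuous_open_preimage[OF _ openL open_trunc_cone])
    have "trunc_cone (min \<eta> \<eta>') (max A A') \<noteq> {}"
      by (rule trunc_cone_nonempty) (use D D' in simp_all)
    then obtain w where w: "w \<in> trunc_cone (min \<eta> \<eta>') (max A A')" by blast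
    have "1 / (1 / w) \<in> trunc_cone (min \<eta> \<eta>') (max A A')" using w by simp
    then have "1 / w \<in> ?S" using inverse_in_cone_imp_Im_neg[of "1 / w" "min \<eta> \<eta>'" "max A A'"] D by simp
    then show "?S \<noteq> {}" by (metis empty_iff)
    show "connected ?L" by (intro convex_connected convex_halfspace_Im_lt)
    fix x assume "x \<in> ?S"
    then have "1 / x \<in> trunc_cone \<eta> A \<inter> trunc_cone \<eta>' A'" unfolding trunc_cone_Int[OF D(2) D'(2)] by simp
    then show "f x = f' x" using h(4) h'(4) by simp
  qed (use that openL sub h(1) h'(1) in \<open>auto intro: holomorphic_on_subset\<close>)
  have "f z = f' z"
  proof (cases "Im z < 0")
    case True
    then show ?thesis by (rule low)
  next
    case False
    then have "f (cnj z) = f' (cnj z)" using z by (intro low) simp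
    then have "cnj (f z) = cnj (f' z)"
      using bspec[OF h(2), of z] bspec[OF h'(2), of z] z by (simp add: complex_is_Real_iff)
    then show ?thesis by simp
  qed
  then show "u = f z" using f'(2) by simp
qed

section \<open>Free regular pairs\<close>

text \<open>For u > 0 the weight u / (1 + u) is at most min 1 u, so integrability of the latter
  makes the weighted measure finite.\<close>

lemma regular_pair_imp_regular_fun:
  assumes sets_\<nu>: "sets \<nu> = sets borel" and fin: "(\<integral>\<^sup>+x\<in>{0..}. ennreal (min 1 x) \<partial>\<nu>) < \<infinity>"
  shows "\<exists>\<kappa>. regular_measure \<kappa> \<and> (\<forall>z. z \<notin> \<real>\<^sub>\<ge>\<^sub>0 \<longrightarrow> levy_khintchine_regular \<nu> b z = regular_fun b \<kappa> z)"
proof -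
  note [measurable_cong] = sets_\<nu>
  define r where "r u = (if 0 < u then u / (1 + u) else 0)" for u :: real
  have r_meas [measurable]: "r \<in> borel_measurable borel" unfolding r_def by measurable
  have r_nonneg: "r u \<ge> 0" for u by (simp add: r_def)
  define \<kappa> where "\<kappa> = density \<nu> (\<lambda>u. ennreal (r u))"
  have "finite_borel_measure \<kappa>"
  proof (rule finite_borel_measureI)
    have "emeasure \<kappa> (space \<kappa>) = (\<integral>\<^sup>+u. ennreal (r u) * indicator (space \<nu>) u \<partial>\<nu>)"
      unfolding \<kappa>_def by (subst emeasure_density) simp_all
    also have "\<dots> \<le> (\<integral>\<^sup>+x\<in>{0..}. ennreal (min 1 x) \<partial>\<nu>)"
      by (intro nn_integral_mono) (auto simp: r_def indicator_def divide_le_eq intro!: ennreal_leI)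
    finally show "emeasure \<kappa> (space \<kappa>) \<noteq> \<infinity>" using fin by (auto simp: less_top)
    show "sets \<kappa> = sets borel" by (simp add: \<kappa>_def sets_\<nu>)
  qed
  moreover have "AE u in \<kappa>. 0 \<le> u"
    unfolding \<kappa>_def by (subst AE_density) (auto simp: r_def)
  ultimately have "regular_measure \<kappa>" by (simp add: regular_measure_def regular_measure_axioms_def)
  moreover have "levy_khintchine_regular \<nu> b z = regular_fun b \<kappa> z" if z: "z \<notin> \<real>\<^sub>\<ge>\<^sub>0" for z
  proof -
    have "(LINT u|\<kappa>. z * of_real (1 + u) / (1 - z * of_real u)) = (LINT u|\<nu>. r u *\<^sub>R (z * of_real (1 + u) / (1 - z * of_real u)))"
      unfolding \<kappa>_def by (rule integral_density) (simp_all add: r_nonneg)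
    also have "\<dots> = (LINT u|\<nu>. indicator {0..} u *\<^sub>R (1 / (1 - z * of_real u) - 1))"
    proof (intro Bochner_Integration.integral_cong refl)
      fix u
      show "r u *\<^sub>R (z * of_real (1 + u) / (1 - z * of_real u)) = indicator {0..} u *\<^sub>R (1 / (1 - z * complex_of_real u) - 1)"
      proof (cases "0 < u")
        case True
        then have nz: "1 - z * of_real u \<noteq> 0" by (intro one_minus_neq_0[OF z]) simp
        have p: "complex_of_real (1 + u) \<noteq> 0" using True by (simp only: of_real_eq_0_iff)
        have "r u *\<^sub>R (z * of_real (1 + u) / (1 - z * of_real u)) = (of_real u / of_real (1 + u)) * (z * of_real (1 + u) / (1 - z * of_real u))"
          using True by (simp add: r_def scaleR_conv_of_real del: of_real_add)
        also have "\<dots> = of_real u * z / (1 - z * of_real u)" using p by (simp del: of_real_add)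
        also have "\<dots> = 1 / (1 - z * of_real u) - 1" using nz by (simp add: field_simps)
        finally show ?thesis using True by simp
      next
        case False
        then show ?thesis by (cases "u = 0") (simp_all add: r_def)
      qed
    qed
    finally show ?thesis by (simp add: levy_khintchine_regular_def regular_fun_def set_lebesgue_integral_def)
  qed
  ultimately show ?thesis by blast
qed

text \<open>The inverse weight (1 + u) / u recovers a Levy measure on the positive half-line; the
  mass of \<kappa> at 0 has no place there and turns into drift.\<close>

lemma regular_fun_imp_regular_pair:
  assumes \<kappa>: "regular_measure \<kappa>"
  shows "\<exists>\<nu> b. b \<ge> 0 \<and> sets \<nu> = sets borel \<and> emeasure \<nu> {..0} = 0 \<and> (\<integral>\<^sup>+x\<in>{0..}. ennreal (min 1 x) \<partial>\<nu>) < \<infinity> \<and>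
    (\<forall>z. z \<notin> \<real>\<^sub>\<ge>\<^sub>0 \<longrightarrow> levy_khintchine_regular \<nu> b z = regular_fun 0 \<kappa> z)"
proof -
  interpret regular_measure \<kappa> by fact
  note [measurable_cong] = M_is_borel
  define s where "s u = (if 0 < u then (1 + u) / u else 0)" for u :: real
  have s_meas [measurable]: "s \<in> borel_measurable borel" unfolding s_def by measurable
  have s_nonneg: "s u \<ge> 0" for u by (simp add: s_def)
  define \<nu> where "\<nu> = density \<kappa> (\<lambda>u. ennreal (s u))"
  \<comment> \<open>The kernel at u = 0 equals z, so the atom contributes z times its mass.\<close>
  define b where "b = measure \<kappa> {0}"
  have sets_\<nu>: "sets \<nu> = sets borel" by (simp add: \<nu>_def M_is_borel)
  have "emeasure \<nu> {..0} = (\<integral>\<^sup>+u. ennreal (s u) * indicator {..0} u \<partial>\<kappa>)"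
    unfolding \<nu>_def by (subst emeasure_density) simp_all
  also have "\<dots> = (\<integral>\<^sup>+u. 0 \<partial>\<kappa>)" by (intro nn_integral_cong) (simp add: s_def indicator_def)
  finally have null: "emeasure \<nu> {..0} = 0" by simp
  have "(\<integral>\<^sup>+x\<in>{0..}. ennreal (min 1 x) \<partial>\<nu>) = (\<integral>\<^sup>+u. ennreal (s u) * (ennreal (min 1 u) * indicator {0..} u) \<partial>\<kappa>)"
    unfolding \<nu>_def by (rule nn_integral_density) simp_all
  also have "\<dots> \<le> (\<integral>\<^sup>+u. ennreal 2 \<partial>\<kappa>)"
  proof (rule nn_integral_mono)
    fix u :: real
    have "s u * min 1 u \<le> 2"
    proof (cases "0 < u")
      case True
      show ?thesis
      proof (cases "u \<le> 1")
        case True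
        with \<open>0 < u\<close> show ?thesis by (simp add: s_def)
      next
        case False
        with \<open>0 < u\<close> show ?thesis by (simp add: s_def divide_le_eq)
      qed
    qed (simp add: s_def)
    then show "ennreal (s u) * (ennreal (min 1 u) * indicator {0..} u) \<le> ennreal 2"
    proof (cases "0 \<le> u")
      case True
      have "ennreal (s u) * ennreal (min 1 u) = ennreal (s u * min 1 u)"
        using True s_nonneg[of u] by (intro ennreal_mult[symmetric]) simp_all
      also have "\<dots> \<le> ennreal 2" by (rule ennreal_leI) fact
      finally show ?thesis using True by (simp add: indicator_def del: ennreal_numeral)
    qed (simp add: indicator_def)
  qed
  also have "\<dots> < \<infinity>" by (simp add: less_top[symmetric] ennreal_mult_eq_top_iff)
  finally have fin: "(\<integral>\<^sup>+x\<in>{0..}. ennreal (min 1 x) \<partial>\<nu>) < \<infinity>" .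
  have "levy_khintchine_regular \<nu> b z = regular_fun 0 \<kappa> z" if z: "z \<notin> \<real>\<^sub>\<ge>\<^sub>0" for z
  proof -
    let ?k = "\<lambda>u. z * complex_of_real (1 + u) / (1 - z * of_real u)"
    let ?g = "\<lambda>u. s u *\<^sub>R (indicator {0..} u *\<^sub>R (1 / (1 - z * complex_of_real u) - 1))"
    have AE: "AE u in \<kappa>. ?g u = ?k u - z * of_real (indicator {0} u)"
      using AE_nonneg
    proof eventually_elim
      case (elim u)
      show ?case
      proof (cases "u = 0")
        case False
        then have u: "u > 0" using elim by simp
        have nz: "1 - z * of_real u \<noteq> 0" by (rule one_minus_neq_0[OF z elim])
        have e: "1 / (1 - z * of_real u) - 1 = of_real u * (z / (1 - z * of_real u))" using nz by (simp add: field_simps)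
        have "?g u = (of_real (1 + u) / of_real u) * (of_real u * (z / (1 - z * of_real u)))"
          unfolding e using u by (simp add: s_def scaleR_conv_of_real del: of_real_add)
        also have "(of_real (1 + u) / of_real u) * (of_real u * (z / (1 - z * of_real u))) = ?k u"
          using u by (simp del: of_real_add)
        finally show ?thesis using u by simp
      qed (simp add: s_def)
    qed
    have i0: "integrable \<kappa> (\<lambda>u. complex_of_real (indicator {0} u))"
      by (rule integrable_boundedI[where B=1]) (auto simp: indicator_def)
    have "(LINT u|\<nu>. indicator {0..} u *\<^sub>R (1 / (1 - z * complex_of_real u) - 1)) = (LINT u|\<kappa>. ?g u)"
      unfolding \<nu>_def by (rule integral_density) (simp_all add: s_nonneg)
    also have "\<dots> = (LINT u|\<kappa>. ?k u - z * of_real (indicator {0} u))"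
      by (rule integral_cong_AE[OF _ _ AE]) simp_all
    also have "\<dots> = (LINT u|\<kappa>. ?k u) - (LINT u|\<kappa>. z * of_real (indicator {0} u))"
      by (intro Bochner_Integration.integral_diff integrable_regular_kernel[OF z] integrable_mult_right i0)
    also have "(LINT u|\<kappa>. z * of_real (indicator {0} u)) = z * of_real b"
      unfolding integral_mult_right_zero by (simp add: integral_complex_of_real b_def space_M)
    finally show ?thesis
      by (simp add: levy_khintchine_regular_def regular_fun_def set_lebesgue_integral_def mult.commute)
  qed
  then show ?thesis using null fin sets_\<nu> by (intro exI[of _ \<nu>] exI[of _ b]) (simp add: b_def)
qed

text \<open>Integrability of min 1 x allows the truncation term to be split off the integral and
  moved to the drift. Thus \<open>free_levy_measure\<close> of \<sigma> is the measure of the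
  pair.\<close>

lemma free_regular_pair_triplet:
  assumes "free_regular_pair \<sigma> \<nu> b"
  shows "free_triplet \<sigma> 0 \<nu> (b + (LINT x|\<nu>. x * indicat_real {-1..1} x))"
proof -
  from assms have sets_\<nu>: "sets \<nu> = sets borel" and null: "emeasure \<nu> {..0} = 0"
    and fin: "(\<integral>\<^sup>+x\<in>{0..}. ennreal (min 1 x) \<partial>\<nu>) < \<infinity>"
    by (simp_all add: free_regular_pair_def)
  from assms obtain \<eta> A where inv: "invertible_on_cone \<sigma> \<eta> A"
    and C: "\<forall>z. 1 / z \<in> trunc_cone \<eta> A \<longrightarrow> free_cumulant \<sigma> z = levy_khintchine_regular \<nu> b z"
    unfolding free_regular_pair_def by (elim conjE exE)
  note [measurable_cong] = sets_\<nu>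
  have "{..0} \<in> null_sets \<nu>" using null by (simp add: null_sets_def sets_\<nu>)
  from AE_not_in[OF this] have AE: "AE x in \<nu>. 0 < x" by eventually_elim simp
  have "emeasure \<nu> {0} \<le> emeasure \<nu> {..0}" by (rule emeasure_mono) (simp_all add: sets_\<nu>)
  then have null0: "emeasure \<nu> {0} = 0" using null by simp
  have fin': "(\<integral>\<^sup>+x. ennreal \<bar>x * indicat_real {-1..1} x\<bar> \<partial>\<nu>) < \<infinity>" "(\<integral>\<^sup>+x. ennreal (min 1 (x\<^sup>2)) \<partial>\<nu>) < \<infinity>"
  proof -
    have "(\<integral>\<^sup>+x. ennreal \<bar>x * indicat_real {-1..1} x\<bar> \<partial>\<nu>) \<le> (\<integral>\<^sup>+x\<in>{0..}. ennreal (min 1 x) \<partial>\<nu>)"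
      by (rule nn_integral_mono_AE) (use AE in \<open>eventually_elim, auto simp: indicator_def intro!: ennreal_leI\<close>)
    then show "(\<integral>\<^sup>+x. ennreal \<bar>x * indicat_real {-1..1} x\<bar> \<partial>\<nu>) < \<infinity>" using fin by (rule le_less_trans)
    have "(\<integral>\<^sup>+x. ennreal (min 1 (x\<^sup>2)) \<partial>\<nu>) \<le> (\<integral>\<^sup>+x\<in>{0..}. ennreal (min 1 x) \<partial>\<nu>)"
    proof (rule nn_integral_mono_AE)
      show "AE x in \<nu>. ennreal (min 1 (x\<^sup>2)) \<le> ennreal (min 1 x) * indicator {0..} x"
        using AE
      proof eventually_elim
        case (elim x)
        have "min 1 (x\<^sup>2) \<le> min 1 x"
        proof (cases "x \<le> 1")
          case True
          then have "x\<^sup>2 \<le> x" using elim by (simp add: power2_eq_square mult_left_le)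
          then show ?thesis by simp
        qed simp
        then show ?case using elim by (simp add: ennreal_leI)
      qed
    qed
    then show "(\<integral>\<^sup>+x. ennreal (min 1 (x\<^sup>2)) \<partial>\<nu>) < \<infinity>" using fin by (rule le_less_trans)
  qed
  interpret levy_measure \<nu> using sets_\<nu> null0 fin'(2) by unfold_locales
  have int: "integrable \<nu> (\<lambda>x. x * indicat_real {-1..1} x)"
    by (rule integrableI_bounded) (use fin'(1) in simp_all)
  have eq: "levy_khintchine_regular \<nu> b z = levy_khintchine 0 \<nu> (b + (LINT x|\<nu>. x * indicat_real {-1..1} x)) z"
    if z: "Im z \<noteq> 0" for z
  proof -
    let ?k = "\<lambda>x. 1 / (1 - z * complex_of_real x) - 1 - z * complex_of_real x * complex_of_real (indicat_real {-1..1} x)"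
    have "(LINT x:{0..}|\<nu>. 1 / (1 - z * complex_of_real x) - 1) = (LINT x|\<nu>. ?k x + z * of_real (x * indicat_real {-1..1} x))"
      unfolding set_lebesgue_integral_def
    proof (rule integral_cong_AE)
      show "AE x in \<nu>. indicator {0..} x *\<^sub>R (1 / (1 - z * complex_of_real x) - 1) = ?k x + z * of_real (x * indicat_real {-1..1} x)"
        using AE by eventually_elim simp
    qed simp_all
    also have "\<dots> = (LINT x|\<nu>. ?k x) + (LINT x|\<nu>. z * of_real (x * indicat_real {-1..1} x))"
      by (intro Bochner_Integration.integral_add integrable_levy_kernel[OF z] integrable_mult_right integrable_of_real int)
    also have "(LINT x|\<nu>. z * of_real (x * indicat_real {-1..1} x)) = z * of_real (LINT x|\<nu>. x * indicat_real {-1..1} x)"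
      unfolding integral_mult_right_zero integral_complex_of_real ..
    finally show ?thesis
      unfolding levy_khintchine_regular_def levy_khintchine_def by (simp add: algebra_simps)
  qed
  have A: "A > 0" using inv right_inverse_on_coneD(2) unfolding invertible_on_cone_def by (elim exE)
  have "free_cumulant \<sigma> z = levy_khintchine 0 \<nu> (b + (LINT x|\<nu>. x * indicat_real {-1..1} x)) z"
    if "1 / z \<in> trunc_cone \<eta> A" for z
    using C[rule_format, OF that] eq[of z] inverse_in_cone_imp_Im_neg[OF that A] by simp
  then show ?thesis
    unfolding free_triplet_def using sets_\<nu> null0 fin'(2) inv by (intro conjI exI[of _ \<eta>] exI[of _ A] allI impI) simp_all
qed

lemma free_regular_pair_unique:
  assumes \<sigma>: "real_distribution \<sigma>" and p: "free_regular_pair \<sigma> \<nu> b" and p': "free_regular_pair \<sigma> \<nu>' b'"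
  shows "\<nu> = \<nu>'" "b = b'"
proof -
  show \<nu>: "\<nu> = \<nu>'"
    by (rule free_triplet_unique[OF \<sigma> free_regular_pair_triplet[OF p] free_regular_pair_triplet[OF p']])
  from p obtain \<eta> A where h: "invertible_on_cone \<sigma> \<eta> A"
    "\<forall>z. 1 / z \<in> trunc_cone \<eta> A \<longrightarrow> free_cumulant \<sigma> z = levy_khintchine_regular \<nu> b z"
    unfolding free_regular_pair_def by (elim conjE exE)
  from p' obtain \<eta>' A' where h': "invertible_on_cone \<sigma> \<eta>' A'"
    "\<forall>z. 1 / z \<in> trunc_cone \<eta>' A' \<longrightarrow> free_cumulant \<sigma> z = levy_khintchine_regular \<nu>' b' z"
    unfolding free_regular_pair_def by (elim conjE exE)
  from h(1) obtain g where g: "right_inverse_on_cone \<sigma> \<eta> A g" unfolding invertible_on_cone_def ..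
  from h'(1) obtain g' where g': "right_inverse_on_cone \<sigma> \<eta>' A' g'" unfolding invertible_on_cone_def ..
  note D = right_inverse_on_coneD(1,2)[OF g] and D' = right_inverse_on_coneD(1,2)[OF g']
  \<comment> \<open>With the measures already equal, one point common to both cones determines the
    drift.\<close>
  define w where "w = \<i> * complex_of_real (max A A' + 1)"
  have w: "w \<in> trunc_cone \<eta> A" "w \<in> trunc_cone \<eta>' A'"
    unfolding w_def by (rule iy_in_trunc_cone; use D D' in simp)+
  have w0: "w \<noteq> 0" using subsetD[OF trunc_cone_subset_uhp[OF D(2)] w(1)] by auto
  have "1 / (1 / w) \<in> trunc_cone \<eta> A" "1 / (1 / w) \<in> trunc_cone \<eta>' A'" using w by simp_all
  then have "levy_khintchine_regular \<nu> b (1 / w) = levy_khintchine_regular \<nu> b' (1 / w)"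
    using h(2)[rule_format, of "1 / w"] h'(2)[rule_format, of "1 / w"] \<nu> by simp
  then have "of_real b * (1 / w) = of_real b' * (1 / w)" unfolding levy_khintchine_regular_def by (simp only: add_right_cancel)
  then show "b = b'" using w0 by simp
qed

lemma free_cumulant_regular_eq:
  assumes \<sigma>: "real_distribution \<sigma>" and p: "free_regular_pair \<sigma> \<nu> b"
  shows "free_cumulant_regular \<sigma> z = levy_khintchine_regular \<nu> b z"
  unfolding free_cumulant_regular_def
proof (rule the_equality)
  show "\<exists>\<nu>' b'. free_regular_pair \<sigma> \<nu>' b' \<and> levy_khintchine_regular \<nu> b z = levy_khintchine_regular \<nu>' b' z"
    using p by (intro exI conjI) simp_all
  fix u assume "\<exists>\<nu>' b'. free_regular_pair \<sigma> \<nu>' b' \<and> u = levy_khintchine_regular \<nu>' b' z"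
  then obtain \<nu>' b' where p': "free_regular_pair \<sigma> \<nu>' b'" "u = levy_khintchine_regular \<nu>' b' z" by (elim exE conjE)
  then show "u = levy_khintchine_regular \<nu> b z"
    using free_regular_pair_unique[OF \<sigma> p p'(1)] by simp
qed

section \<open>Symmetric and free regular laws\<close>

locale positive_levy_measure =
  fixes \<nu> :: "real measure"
  assumes sets_pos: "sets \<nu> = sets borel" and null_nonpos: "emeasure \<nu> {..0} = 0"
    and finite_pos: "(\<integral>\<^sup>+x\<in>{0..}. ennreal (min 1 x) \<partial>\<nu>) < \<infinity>"
begin

lemma measurable_pos: "borel_measurable \<nu> = borel_measurable borel"
  by (rule measurable_cong_sets) (simp_all add: sets_pos)

lemma space_pos: "space \<nu> = UNIV"
  using sets_eq_imp_space_eq[OF sets_pos] by simp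

lemma emeasure_sqrt_image:
  assumes B: "B \<in> sets borel"
  shows "emeasure (sqrt_image_pos \<nu>) B = emeasure \<nu> {u. 0 < u \<and> sqrt u \<in> B}"
    and "emeasure (sqrt_image_neg \<nu>) B = emeasure \<nu> {u. 0 < u \<and> - sqrt u \<in> B}"
proof -
  note [measurable_cong] = sets_pos
  have m: "f \<in> restrict_space \<nu> {0<..} \<rightarrow>\<^sub>M borel" if "f \<in> borel_measurable borel" for f :: "real \<Rightarrow> real"
    using that by (intro measurable_restrict_space1) (simp add: measurable_pos)
  have e: "emeasure (distr (restrict_space \<nu> {0<..}) borel f) B = emeasure \<nu> {u. 0 < u \<and> f u \<in> B}"
    if "f \<in> borel_measurable borel" for f
  proof -
    have "emeasure (distr (restrict_space \<nu> {0<..}) borel f) B = emeasure (restrict_space \<nu> {0<..}) (f -` B \<inter> space (restrict_space \<nu> {0<..}))"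
      by (rule emeasure_distr[OF m[OF that] B])
    also have "f -` B \<inter> space (restrict_space \<nu> {0<..}) = {u. 0 < u \<and> f u \<in> B}"
      by (auto simp: space_restrict_space space_pos)
    also have "emeasure (restrict_space \<nu> {0<..}) {u. 0 < u \<and> f u \<in> B} = emeasure \<nu> {u. 0 < u \<and> f u \<in> B}"
      by (rule emeasure_restrict_space) (auto simp: sets_pos)
    finally show ?thesis .
  qed
  show "emeasure (sqrt_image_pos \<nu>) B = emeasure \<nu> {u. 0 < u \<and> sqrt u \<in> B}"
    "emeasure (sqrt_image_neg \<nu>) B = emeasure \<nu> {u. 0 < u \<and> - sqrt u \<in> B}"
    unfolding sqrt_image_pos_def sqrt_image_neg_def by (rule e; measurable)+
qed

lemma sets_sqrt_image: "sets (sqrt_image_pos \<nu>) = sets borel" "sets (sqrt_image_neg \<nu>) = sets borel"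
  by (simp_all add: sqrt_image_pos_def sqrt_image_neg_def)

sublocale half_sum_measures "sqrt_image_pos \<nu>" "sqrt_image_neg \<nu>"
  by unfold_locales (rule sets_sqrt_image)+

lemma measurable_sqrt_restrict:
  "sqrt \<in> restrict_space \<nu> {0<..} \<rightarrow>\<^sub>M borel" "(\<lambda>x. - sqrt x) \<in> restrict_space \<nu> {0<..} \<rightarrow>\<^sub>M borel"
  by (intro measurable_restrict_space1; simp add: measurable_pos)+

text \<open>Under either square root min 1 (x^2) becomes min 1 u: the integrability required of a
  Levy measure is the one required of a free regular pair.\<close>

lemma levy_measure_sqrt_image: "levy_measure (sqrt_image_pos \<nu>)" "levy_measure (sqrt_image_neg \<nu>)"
proof -
  have l: "levy_measure (distr (restrict_space \<nu> {0<..}) borel f)"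
    if m: "f \<in> restrict_space \<nu> {0<..} \<rightarrow>\<^sub>M borel" and f: "\<And>u. 0 < u \<Longrightarrow> (f u)\<^sup>2 = u" for f
  proof
    show "sets (distr (restrict_space \<nu> {0<..}) borel f) = sets borel" by simp
    have "f u \<noteq> 0" if "0 < u" for u using f[OF that] that by auto
    then have "f -` {0} \<inter> space (restrict_space \<nu> {0<..}) = {}"
      by (auto simp: space_restrict_space space_pos)
    then show "emeasure (distr (restrict_space \<nu> {0<..}) borel f) {0} = 0"
      by (subst emeasure_distr[OF m]) simp_all
    have "(\<integral>\<^sup>+x. ennreal (min 1 (x\<^sup>2)) \<partial>distr (restrict_space \<nu> {0<..}) borel f) = (\<integral>\<^sup>+u. ennreal (min 1 ((f u)\<^sup>2)) \<partial>restrict_space \<nu> {0<..})"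
      by (rule nn_integral_distr[OF m]) simp
    also have "\<dots> = (\<integral>\<^sup>+u\<in>{0<..}. ennreal (min 1 ((f u)\<^sup>2)) \<partial>\<nu>)"
      by (rule nn_integral_restrict_space) (simp add: space_pos sets_pos)
    also have "\<dots> \<le> (\<integral>\<^sup>+u\<in>{0..}. ennreal (min 1 u) \<partial>\<nu>)"
      by (rule nn_integral_mono) (auto simp: indicator_def f)
    also have "\<dots> < \<infinity>" by (rule finite_pos)
    finally show "(\<integral>\<^sup>+x. ennreal (min 1 (x\<^sup>2)) \<partial>distr (restrict_space \<nu> {0<..}) borel f) < \<infinity>" .
  qed
  show "levy_measure (sqrt_image_pos \<nu>)" "levy_measure (sqrt_image_neg \<nu>)"
    unfolding sqrt_image_pos_def sqrt_image_neg_def by (rule l[OF measurable_sqrt_restrict(1)]; simp) (rule l[OF measurable_sqrt_restrict(2)]; simp)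
qed

text \<open>The Levy measure of the symmetric law when \<nu> is that of the free regular
  law.\<close>

definition symmetric_levy :: "real measure" where
  "symmetric_levy = half_sum (sqrt_image_pos \<nu>) (sqrt_image_neg \<nu>)"

lemma levy_measure_symmetric_levy: "levy_measure symmetric_levy"
proof -
  interpret P: levy_measure "sqrt_image_pos \<nu>" by (rule levy_measure_sqrt_image)
  interpret N: levy_measure "sqrt_image_neg \<nu>" by (rule levy_measure_sqrt_image)
  show ?thesis
  proof
    show "sets symmetric_levy = sets borel" by (simp add: symmetric_levy_def)
    show "emeasure symmetric_levy {0} = 0"
      unfolding symmetric_levy_def by (subst emeasure_half_sum) (simp_all add: P.null_0 N.null_0)
    have h: "(1 / 2 :: ennreal) = ennreal (1 / 2)" using divide_ennreal[of 1 2] by simp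
    have "(1 / 2 :: ennreal) < \<infinity>" unfolding h by (simp only: infinity_ennreal_def ennreal_less_top)
    moreover have "(\<integral>\<^sup>+x. ennreal (min 1 (x\<^sup>2)) \<partial>symmetric_levy) = (1 / 2) *
        ((\<integral>\<^sup>+x. ennreal (min 1 (x\<^sup>2)) \<partial>sqrt_image_pos \<nu>) + (\<integral>\<^sup>+x. ennreal (min 1 (x\<^sup>2)) \<partial>sqrt_image_neg \<nu>))"
      unfolding symmetric_levy_def by (rule nn_integral_half_sum) simp
    ultimately show "(\<integral>\<^sup>+x. ennreal (min 1 (x\<^sup>2)) \<partial>symmetric_levy) < \<infinity>"
      using P.finite_levy N.finite_levy by (simp add: ennreal_mult_less_top)
  qed
qed

text \<open>Partial fractions at sqrt u and - sqrt u, averaged, give the regular kernel at z^2. The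
  drift b of the regular law multiplies z^2 and so becomes the quadratic coefficient of the
  symmetric one, whose linear coefficient is 0.\<close>

lemma levy_khintchine_symmetric_levy:
  assumes z: "Im z \<noteq> 0"
  shows "levy_khintchine b symmetric_levy 0 z = levy_khintchine_regular \<nu> b (z\<^sup>2)"
proof -
  interpret P: levy_measure "sqrt_image_pos \<nu>" by (rule levy_measure_sqrt_image)
  interpret N: levy_measure "sqrt_image_neg \<nu>" by (rule levy_measure_sqrt_image)
  let ?k = "\<lambda>x. 1 / (1 - z * complex_of_real x) - 1 - z * complex_of_real x * complex_of_real (indicat_real {-1..1} x)"
  have k_meas: "?k \<in> borel_measurable borel" by measurable
  note intP = P.integrable_levy_kernel[OF z] and intN = N.integrable_levy_kernel[OF z]
  have iP: "integrable \<nu> (\<lambda>u. indicator {0<..} u *\<^sub>R ?k (sqrt u))"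
    using intP unfolding sqrt_image_pos_def integrable_distr_eq[OF measurable_sqrt_restrict(1) k_meas]
    by (subst (asm) integrable_restrict_space) (simp_all add: space_pos sets_pos)
  have iN: "integrable \<nu> (\<lambda>u. indicator {0<..} u *\<^sub>R ?k (- sqrt u))"
    using intN unfolding sqrt_image_neg_def integrable_distr_eq[OF measurable_sqrt_restrict(2) k_meas]
    by (subst (asm) integrable_restrict_space) (simp_all add: space_pos sets_pos)
  have vP: "integral\<^sup>L (sqrt_image_pos \<nu>) ?k = (LINT u|\<nu>. indicator {0<..} u *\<^sub>R ?k (sqrt u))"
    unfolding sqrt_image_pos_def integral_distr[OF measurable_sqrt_restrict(1) k_meas]
    by (rule integral_restrict_space) (simp add: space_pos sets_pos)
  have vN: "integral\<^sup>L (sqrt_image_neg \<nu>) ?k = (LINT u|\<nu>. indicator {0<..} u *\<^sub>R ?k (- sqrt u))"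
    unfolding sqrt_image_neg_def integral_distr[OF measurable_sqrt_restrict(2) k_meas]
    by (rule integral_restrict_space) (simp add: space_pos sets_pos)
  have "integral\<^sup>L symmetric_levy ?k = (integral\<^sup>L (sqrt_image_pos \<nu>) ?k + integral\<^sup>L (sqrt_image_neg \<nu>) ?k) / 2"
    unfolding symmetric_levy_def by (rule integral_half_sum[OF intP intN])
  also have "integral\<^sup>L (sqrt_image_pos \<nu>) ?k + integral\<^sup>L (sqrt_image_neg \<nu>) ?k
      = (LINT u|\<nu>. indicator {0<..} u *\<^sub>R ?k (sqrt u) + indicator {0<..} u *\<^sub>R ?k (- sqrt u))"
    unfolding vP vN by (rule Bochner_Integration.integral_add[OF iP iN, symmetric])
  also have "\<dots> = (LINT u|\<nu>. 2 * (indicator {0..} u *\<^sub>R (1 / (1 - z\<^sup>2 * complex_of_real u) - 1)))"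
  proof (intro Bochner_Integration.integral_cong refl)
    fix u
    show "indicator {0<..} u *\<^sub>R ?k (sqrt u) + indicator {0<..} u *\<^sub>R ?k (- sqrt u) = 2 * (indicator {0..} u *\<^sub>R (1 / (1 - z\<^sup>2 * complex_of_real u) - 1))"
    proof (cases "0 < u")
      case True
      define s where "s = complex_of_real (sqrt u)"
      have s2: "complex_of_real u = s\<^sup>2" using True unfolding s_def of_real_power[symmetric] by simp
      \<comment> \<open>The truncation interval is symmetric, so the two linear terms
        cancel.\<close>
      have i: "indicat_real {-1..1} (- sqrt u) = indicat_real {-1..1} (sqrt u)" by (auto simp: indicator_def)
      have nz2: "1 - z\<^sup>2 * complex_of_real u \<noteq> 0" using True by (intro one_minus_neq_0 power2_notin_nonneg_Reals z) simp
      have f: "1 - z\<^sup>2 * s\<^sup>2 = (1 - z * s) * (1 + z * s)" by (simp add: algebra_simps power2_eq_square)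
      have nz: "1 - z * s \<noteq> 0" "1 + z * s \<noteq> 0" using nz2 unfolding s2 f by auto
      have "1 / (1 - z * s) + 1 / (1 + z * s) = 2 / ((1 - z * s) * (1 + z * s))"
        using nz by (simp add: add_frac_eq)
      then have "?k (sqrt u) + ?k (- sqrt u) = 2 * (1 / (1 - z\<^sup>2 * complex_of_real u) - 1)"
        unfolding i s2 f by (simp add: s_def[symmetric] algebra_simps)
      then show ?thesis using True by simp
    next
      case False
      then show ?thesis by (cases "u = 0") simp_all
    qed
  qed
  also have "\<dots> = 2 * (LINT u|\<nu>. indicator {0..} u *\<^sub>R (1 / (1 - z\<^sup>2 * complex_of_real u) - 1))"
    by (simp only: integral_mult_right_zero)
  finally show ?thesis
    unfolding levy_khintchine_def levy_khintchine_regular_def set_lebesgue_integral_def by simp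
qed

text \<open>Restriction to positive points keeps the image under the positive root only, with weight
  1 / 2; the factor 2 restores it.\<close>

lemma square_image_symmetric_levy: "scale_measure 2 (square_image_pos symmetric_levy) = \<nu>"
proof (rule measure_eqI)
  interpret L: levy_measure symmetric_levy by (rule levy_measure_symmetric_levy)
  note [measurable_cong] = L.sets_levy
  have sp: "space symmetric_levy = UNIV" using sets_eq_imp_space_eq[OF L.sets_levy] by simp
  show "sets (scale_measure 2 (square_image_pos symmetric_levy)) = sets \<nu>"
    by (simp add: square_image_pos_def sets_pos)
  fix B assume "B \<in> sets (scale_measure 2 (square_image_pos symmetric_levy))"
  then have B [measurable]: "B \<in> sets borel" by (simp add: square_image_pos_def)
  have m: "(\<lambda>x. x\<^sup>2) \<in> restrict_space symmetric_levy {0<..} \<rightarrow>\<^sub>M (borel :: real measure)"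
    by (intro measurable_restrict_space1) simp
  define D where "D = {x::real. 0 < x \<and> x\<^sup>2 \<in> B}"
  have D [measurable]: "D \<in> sets borel" unfolding D_def by measurable
  have "emeasure (square_image_pos symmetric_levy) B = emeasure (restrict_space symmetric_levy {0<..}) ((\<lambda>x. x\<^sup>2) -` B \<inter> space (restrict_space symmetric_levy {0<..}))"
    unfolding square_image_pos_def by (rule emeasure_distr[OF m B])
  also have "(\<lambda>x. x\<^sup>2) -` B \<inter> space (restrict_space symmetric_levy {0<..}) = D"
    by (auto simp: space_restrict_space sp D_def)
  also have "emeasure (restrict_space symmetric_levy {0<..}) D = emeasure symmetric_levy D"
    by (rule emeasure_restrict_space) (auto simp: L.sets_levy D_def)
  also have "\<dots> = (1 / 2) * (emeasure \<nu> {u. 0 < u \<and> sqrt u \<in> D} + emeasure \<nu> {u. 0 < u \<and> - sqrt u \<in> D})"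
    unfolding symmetric_levy_def emeasure_half_sum[OF D] emeasure_sqrt_image[OF D] ..
  also have "{u. 0 < u \<and> - sqrt u \<in> D} = {}" by (auto simp: D_def)
  also have "{u. 0 < u \<and> sqrt u \<in> D} = B - {..0}" by (auto simp: D_def)
  also have "emeasure \<nu> (B - {..0}) = emeasure \<nu> B"
    by (rule emeasure_Diff_null_set) (use null_nonpos B in \<open>simp_all add: null_sets_def sets_pos\<close>)
  finally have "2 * emeasure (square_image_pos symmetric_levy) B = 2 * ((1 / 2) * emeasure \<nu> B)" by simp
  also have "\<dots> = emeasure \<nu> B"
  proof -
    have "(2 :: ennreal) * (1 / 2) = 1" by (simp add: ennreal_divide_self ennreal_times_divide)
    then show ?thesis by (simp only: mult.assoc[symmetric] mult_1)
  qed
  finally show "emeasure (scale_measure 2 (square_image_pos symmetric_levy)) B = emeasure \<nu> B" by simp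
qed

end

section \<open>The two directions of the equivalence and the relation of the Levy measures\<close>

lemma free_regular_pair_positive_levy: "free_regular_pair \<sigma> \<nu> b \<Longrightarrow> positive_levy_measure \<nu>"
  by (simp add: free_regular_pair_def positive_levy_measure_def)

lemma symmetric_imp_regular:
  assumes "\<mu> \<in> free_inf_divisible_symmetric"
  shows "\<exists>\<sigma>\<in>free_regular. free_cumulant_extends \<mu> \<and>
    (\<forall>z\<in>- \<real>. free_cumulant_ext \<mu> z = free_cumulant_regular \<sigma> (z\<^sup>2))"
proof -
  have id: "\<mu> \<in> free_inf_divisible" and \<mu>: "real_distribution \<mu>"
    and sym: "\<forall>B\<in>sets borel. measure \<mu> B = measure \<mu> (uminus ` B)"
    using assms by (simp_all add: free_inf_divisible_symmetric_def free_inf_divisible_def)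
  have invariant: "distr \<mu> borel uminus = \<mu>" using sym symmetric_iff_distr_uminus[OF \<mu>] by simp
  from free_inf_divisible_right_inverse[OF id] obtain H \<eta> A where H: "H \<in> free_levy_class"
    and g: "right_inverse_on_cone \<mu> \<eta> A (\<lambda>w. w + H w)" by (elim bexE exE)
  note D = right_inverse_on_coneD(1,2)[OF g]
  have Hh: "H holomorphic_on uhp" using H by (simp add: free_levy_class_def)
  from Nevanlinna_representation[OF H] obtain \<gamma> \<tau> where \<tau>: "finite_borel_measure \<tau>"
    and rep: "\<forall>w. Im w > 0 \<longrightarrow> H w = nevanlinna_fun \<gamma> \<tau> w" by (elim exE conjE)
  interpret \<tau>: finite_borel_measure \<tau> by fact
  note [measurable_cong] = \<tau>.M_is_borel
  define \<kappa> where "\<kappa> = distr \<tau> borel (\<lambda>x. x\<^sup>2)"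
  have \<kappa>: "regular_measure \<kappa>" unfolding \<kappa>_def by (rule regular_measure_distr_square[OF \<tau>])
  interpret \<kappa>: regular_measure \<kappa> by fact
  have H_eq: "H w = w * regular_fun 0 \<kappa> ((1 / w)\<^sup>2)" if w: "w \<in> trunc_cone \<eta> A" for w
  proof -
    have Im: "Im w > 0" using subsetD[OF trunc_cone_subset_uhp[OF D(2)] w] by simp
    let ?k = "\<lambda>x. (1 + w * complex_of_real x) / (w - complex_of_real x)"
    have i1: "integrable \<tau> ?k" by (rule \<tau>.integrable_nevanlinna_kernel) (use Im in simp)
    \<comment> \<open>Replacing x by - x in the kernel amounts to reflecting w in the imaginary
      axis; oddness of H can then be applied to the integral.\<close>
    have k_neg: "?k (- x) = - cnj ((1 + (- cnj w) * complex_of_real x) / ((- cnj w) - complex_of_real x))" for x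
    proof -
      have "- cnj ((1 + (- cnj w) * complex_of_real x) / ((- cnj w) - complex_of_real x)) = - ((1 - w * of_real x) / (- w - of_real x))" by simp
      also have "\<dots> = (1 - w * of_real x) / (- (- w - of_real x))" by (rule minus_divide_right)
      finally show ?thesis by simp
    qed
    have Imc: "Im (- cnj w) \<noteq> 0" "Im (- cnj w) > 0" using Im by simp_all
    have i2': "integrable \<tau> (\<lambda>x. (1 + (- cnj w) * complex_of_real x) / ((- cnj w) - complex_of_real x))"
      by (rule \<tau>.integrable_nevanlinna_kernel[OF Imc(1)])
    have i2: "integrable \<tau> (\<lambda>x. ?k (- x))"
      unfolding k_neg by (intro Bochner_Integration.integrable_minus integrable_cnj i2')
    have "(LINT x|\<tau>. ?k (- x)) = - (LINT x|\<tau>. cnj ((1 + (- cnj w) * complex_of_real x) / ((- cnj w) - complex_of_real x)))"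
      unfolding k_neg by (rule integral_minus)
    also have "\<dots> = - cnj (LINT x|\<tau>. (1 + (- cnj w) * complex_of_real x) / ((- cnj w) - complex_of_real x))"
      by (simp only: integral_bounded_linear[OF bounded_linear_cnj i2'])
    also have "(LINT x|\<tau>. (1 + (- cnj w) * complex_of_real x) / ((- cnj w) - complex_of_real x)) = H (- cnj w) - of_real \<gamma>"
      using rep[rule_format, OF Imc(2)] unfolding nevanlinna_fun_def by simp
    also have "H (- cnj w) = - cnj (H w)" by (rule symmetric_imp_odd[OF \<mu> invariant Hh g w])
    \<comment> \<open>The direct integral is H w - \<gamma> and the reflected one H w + \<gamma>, so
      the real constant disappears from the sum.\<close>
    finally have 2: "(LINT x|\<tau>. ?k (- x)) = H w + of_real \<gamma>" by simp
    have 1: "(LINT x|\<tau>. ?k x) = H w - of_real \<gamma>"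
      using rep[rule_format, OF Im] unfolding nevanlinna_fun_def by simp
    have "2 * H w = (LINT x|\<tau>. ?k x) + (LINT x|\<tau>. ?k (- x))" unfolding 1 2 by simp
    also have "\<dots> = (LINT x|\<tau>. ?k x + ?k (- x))"
      by (rule Bochner_Integration.integral_add[OF i1 i2, symmetric])
    also have "\<dots> = (LINT x|\<tau>. 2 * (w * ((1 / w\<^sup>2) * of_real (1 + x\<^sup>2) / (1 - 1 / w\<^sup>2 * of_real (x\<^sup>2)))))"
      by (intro Bochner_Integration.integral_cong refl nevanlinna_kernel_symmetrization[OF Im])
    also have "\<dots> = 2 * (w * (LINT x|\<tau>. (1 / w\<^sup>2) * of_real (1 + x\<^sup>2) / (1 - 1 / w\<^sup>2 * of_real (x\<^sup>2))))"
      by (simp only: integral_mult_right_zero)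
    also have "(LINT x|\<tau>. (1 / w\<^sup>2) * of_real (1 + x\<^sup>2) / (1 - 1 / w\<^sup>2 * of_real (x\<^sup>2))) =
        (LINT u|\<kappa>. (1 / w\<^sup>2) * of_real (1 + u) / (1 - 1 / w\<^sup>2 * of_real u))"
    proof -
      have "(\<lambda>x. x\<^sup>2) \<in> borel_measurable \<tau>" by (simp add: \<tau>.measurable_M_eq)
      moreover have "(\<lambda>u. (1 / w\<^sup>2) * complex_of_real (1 + u) / (1 - 1 / w\<^sup>2 * of_real u)) \<in> borel_measurable borel"
        by measurable
      ultimately show ?thesis unfolding \<kappa>_def by (rule integral_distr[symmetric])
    qed
    finally show ?thesis by (simp add: regular_fun_def power_divide)
  qed
  from regular_fun_imp_regular_pair[OF \<kappa>] obtain \<nu> b where \<nu>: "b \<ge> 0" "sets \<nu> = sets borel" "emeasure \<nu> {..0} = 0"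
    "(\<integral>\<^sup>+x\<in>{0..}. ennreal (min 1 x) \<partial>\<nu>) < \<infinity>"
    and lk: "\<forall>z. z \<notin> \<real>\<^sub>\<ge>\<^sub>0 \<longrightarrow> levy_khintchine_regular \<nu> b z = regular_fun 0 \<kappa> z"
    by (elim exE conjE)
  \<comment> \<open>The explicit drift is 0 here: that of \<sigma> is contained in \<kappa> as its
    atom at 0.\<close>
  have cl: "(\<lambda>w. w * regular_fun 0 \<kappa> (1 / w)) \<in> free_levy_class" by (rule \<kappa>.regular_fun_in_class) simp
  from exists_measure_right_inverse[OF cl] obtain \<sigma> where \<sigma>: "real_distribution \<sigma>"
    and "\<forall>\<eta>>0. \<exists>A>0. right_inverse_on_cone \<sigma> \<eta> A (\<lambda>w. w + w * regular_fun 0 \<kappa> (1 / w))" by (elim exE conjE)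
  then have "\<exists>A>0. right_inverse_on_cone \<sigma> 1 A (\<lambda>w. w + w * regular_fun 0 \<kappa> (1 / w))" by simp
  then obtain A' where A': "A' > 0" and r\<sigma>: "right_inverse_on_cone \<sigma> 1 A' (\<lambda>w. w + w * regular_fun 0 \<kappa> (1 / w))"
    by (elim exE conjE)
  have C\<sigma>: "free_cumulant \<sigma> z = levy_khintchine_regular \<nu> b z" if z: "1 / z \<in> trunc_cone 1 A'" for z
  proof -
    have "z \<notin> \<real>\<^sub>\<ge>\<^sub>0" using inverse_in_cone_imp_Im_neg[OF z A'] by (simp add: complex_nonneg_Reals_iff)
    then show ?thesis
      using right_inverse_cumulant(2)[OF \<sigma> r\<sigma>, rule_format, OF z] lk by simp
  qed
  have "\<exists>\<eta> A. invertible_on_cone \<sigma> \<eta> A \<and> (\<forall>z. 1 / z \<in> trunc_cone \<eta> A \<longrightarrow> free_cumulant \<sigma> z = levy_khintchine_regular \<nu> b z)"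
    by (rule exI[of _ 1], rule exI[of _ A'])
       (intro conjI right_inverse_cumulant(1)[OF \<sigma> r\<sigma>] allI impI C\<sigma>)
  then have pair: "free_regular_pair \<sigma> \<nu> b"
    unfolding free_regular_pair_def by (intro conjI \<nu>)
  have "\<sigma> \<in> free_inf_divisible" by (rule free_inf_divisibleI[OF \<sigma> cl r\<sigma>])
  then have "\<sigma> \<in> free_regular" using pair unfolding free_regular_def by blast
  note \<sigma>_reg = this
  have r\<mu>: "right_inverse_on_cone \<mu> \<eta> A (\<lambda>w. w + w * regular_fun 0 \<kappa> ((1 / w)\<^sup>2))"
    by (rule right_inverse_on_cone_cong[OF g]) (simp only: H_eq)
  have cnj: "regular_fun 0 \<kappa> ((cnj z)\<^sup>2) = cnj (regular_fun 0 \<kappa> (z\<^sup>2))" if "z \<in> - \<real>" for z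
    using \<kappa>.regular_fun_cnj[OF power2_notin_nonneg_Reals, of z] that by (simp add: complex_is_Real_iff)
  have "\<exists>\<eta> A. invertible_on_cone \<mu> \<eta> A \<and> (\<forall>z. 1 / z \<in> trunc_cone \<eta> A \<longrightarrow> regular_fun 0 \<kappa> (z\<^sup>2) = free_cumulant \<mu> z)"
    by (rule exI[of _ \<eta>], rule exI[of _ A])
       (intro conjI right_inverse_cumulant(1)[OF \<mu> r\<mu>] allI impI right_inverse_cumulant(2)[OF \<mu> r\<mu>, rule_format, symmetric])
  then have f: "free_cumulant_extension \<mu> (\<lambda>z. regular_fun 0 \<kappa> (z\<^sup>2))"
    unfolding free_cumulant_extension_def
    by (intro conjI ballI \<kappa>.regular_fun_square_holomorphic cnj)
  note \<sigma>_reg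
  moreover have "free_cumulant_ext \<mu> z = free_cumulant_regular \<sigma> (z\<^sup>2)" if "z \<in> - \<real>" for z
  proof -
    have z: "Im z \<noteq> 0" using that by (simp add: complex_is_Real_iff)
    show ?thesis
      unfolding free_cumulant_ext_eq[OF f z] free_cumulant_regular_eq[OF \<sigma> pair]
      using lk power2_notin_nonneg_Reals[OF z] by simp
  qed
  moreover have "free_cumulant_extends \<mu>" unfolding free_cumulant_extends_def by (rule exI, rule f)
  ultimately show ?thesis by (intro bexI[of _ \<sigma>] conjI ballI)
qed

text \<open>On reciprocals of a cone the extension is the cumulant of \<mu>, so w + w R (1 / w^2),
  with R the regular function, is a right inverse. Class membership gives infinite divisibility;
  oddness holds because R commutes with conjugation and (- cnj w)^2 = cnj (w^2). The explicit
  triplets serve to compare the Levy measures.\<close>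

lemma regular_imp_symmetric:
  assumes \<mu>: "real_distribution \<mu>" and \<sigma>: "\<sigma> \<in> free_regular" and ext: "free_cumulant_extends \<mu>"
    and eq: "\<forall>z\<in>- \<real>. free_cumulant_ext \<mu> z = free_cumulant_regular \<sigma> (z\<^sup>2)"
  shows "\<mu> \<in> free_inf_divisible_symmetric"
    and "\<exists>\<nu> b a' b'. positive_levy_measure \<nu> \<and> free_triplet \<sigma> a' \<nu> b' \<and>
      free_triplet \<mu> b (positive_levy_measure.symmetric_levy \<nu>) 0"
proof -
  have \<sigma>_rd: "real_distribution \<sigma>" using \<sigma> by (simp add: free_regular_def free_inf_divisible_def)
  from \<sigma> obtain \<nu> b where pair: "free_regular_pair \<sigma> \<nu> b" unfolding free_regular_def by blast
  then have b: "b \<ge> 0" and sets_\<nu>: "sets \<nu> = sets borel" and fin: "(\<integral>\<^sup>+x\<in>{0..}. ennreal (min 1 x) \<partial>\<nu>) < \<infinity>"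
    by (simp_all add: free_regular_pair_def)
  interpret positive_levy_measure \<nu> by (rule free_regular_pair_positive_levy[OF pair])
  from regular_pair_imp_regular_fun[OF sets_\<nu> fin, of b] obtain \<kappa> where \<kappa>: "regular_measure \<kappa>"
    and lk: "\<forall>z. z \<notin> \<real>\<^sub>\<ge>\<^sub>0 \<longrightarrow> levy_khintchine_regular \<nu> b z = regular_fun b \<kappa> z" by (elim exE conjE)
  interpret \<kappa>: regular_measure \<kappa> by fact
  from ext obtain f where f: "free_cumulant_extension \<mu> f" unfolding free_cumulant_extends_def ..
  then obtain \<eta> A where inv: "invertible_on_cone \<mu> \<eta> A" and fC: "\<forall>z. 1 / z \<in> trunc_cone \<eta> A \<longrightarrow> f z = free_cumulant \<mu> z"
    unfolding free_cumulant_extension_def by (elim conjE exE)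
  from inv obtain g where g: "right_inverse_on_cone \<mu> \<eta> A g" unfolding invertible_on_cone_def ..
  note A = right_inverse_on_coneD(2)[OF g]
  have C: "free_cumulant \<mu> z = levy_khintchine_regular \<nu> b (z\<^sup>2)" if z: "1 / z \<in> trunc_cone \<eta> A" for z
  proof -
    have Im: "Im z \<noteq> 0" using inverse_in_cone_imp_Im_neg[OF z A] by simp
    then have "z \<in> - \<real>" by (simp add: complex_is_Real_iff)
    then have "f z = free_cumulant_regular \<sigma> (z\<^sup>2)"
      using bspec[OF eq] free_cumulant_ext_eq[OF f Im] by simp
    then show ?thesis using fC z by (simp add: free_cumulant_regular_eq[OF \<sigma>_rd pair])
  qed
  have "\<forall>z. 1 / z \<in> trunc_cone \<eta> A \<longrightarrow> free_cumulant \<mu> z = regular_fun b \<kappa> (z\<^sup>2)"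
  proof (intro allI impI)
    fix z assume z: "1 / z \<in> trunc_cone \<eta> A"
    have "Im z \<noteq> 0" using inverse_in_cone_imp_Im_neg[OF z A] by simp
    then show "free_cumulant \<mu> z = regular_fun b \<kappa> (z\<^sup>2)"
      using C[OF z] lk power2_notin_nonneg_Reals[of z] by simp
  qed
  from cumulant_right_inverse[OF \<mu> inv this]
  have r: "right_inverse_on_cone \<mu> \<eta> A (\<lambda>w. w + w * regular_fun b \<kappa> (1 / w\<^sup>2))"
    by (simp add: power_one_over)
  have cl: "(\<lambda>w. w * regular_fun b \<kappa> (1 / w\<^sup>2)) \<in> free_levy_class"
    by (rule \<kappa>.regular_fun_square_in_class[OF b])
  have id: "\<mu> \<in> free_inf_divisible" by (rule free_inf_divisibleI[OF \<mu> cl r])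
  have "distr \<mu> borel uminus = \<mu>"
  proof (rule odd_imp_symmetric[OF \<mu> r])
    fix w assume w: "w \<in> trunc_cone \<eta> A"
    have "Im w \<noteq> 0" using subsetD[OF trunc_cone_subset_uhp[OF A] w] by simp
    then have "1 / w\<^sup>2 \<notin> \<real>\<^sub>\<ge>\<^sub>0" by (intro inverse_notin_nonneg_Reals power2_notin_nonneg_Reals)
    from \<kappa>.regular_fun_cnj[OF this]
    have "regular_fun b \<kappa> (1 / (- cnj w)\<^sup>2) = cnj (regular_fun b \<kappa> (1 / w\<^sup>2))" by simp
    then show "- cnj w * regular_fun b \<kappa> (1 / (- cnj w)\<^sup>2) = - cnj (w * regular_fun b \<kappa> (1 / w\<^sup>2))" by simp
  qed
  then show "\<mu> \<in> free_inf_divisible_symmetric"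
    using id symmetric_iff_distr_uminus[OF \<mu>] by (simp add: free_inf_divisible_symmetric_def)
  have "\<exists>\<eta> A. invertible_on_cone \<mu> \<eta> A \<and> (\<forall>z. 1 / z \<in> trunc_cone \<eta> A \<longrightarrow> free_cumulant \<mu> z = levy_khintchine b symmetric_levy 0 z)"
  proof (rule exI[of _ \<eta>], rule exI[of _ A], intro conjI inv allI impI)
    fix z assume z: "1 / z \<in> trunc_cone \<eta> A"
    have "Im z \<noteq> 0" using inverse_in_cone_imp_Im_neg[OF z A] by simp
    then show "free_cumulant \<mu> z = levy_khintchine b symmetric_levy 0 z"
      unfolding C[OF z] by (rule levy_khintchine_symmetric_levy[symmetric])
  qed
  then have "free_triplet \<mu> b symmetric_levy 0"
    using b levy_measure_symmetric_levy unfolding free_triplet_def levy_measure_def by simp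
  then show "\<exists>\<nu> b a' b'. positive_levy_measure \<nu> \<and> free_triplet \<sigma> a' \<nu> b' \<and>
      free_triplet \<mu> b (positive_levy_measure.symmetric_levy \<nu>) 0"
    using positive_levy_measure_axioms free_regular_pair_triplet[OF pair] by (intro exI conjI)
qed

text \<open>Triplets are asserted alongside the two relations because
  \<open>free_levy_measure\<close> is a definite description; their existence, with uniqueness,
  makes it denote the actual Levy measure.\<close>

theorem theorem12:
  fixes \<mu> :: "real measure"
  assumes "real_distribution \<mu>"
  shows "(\<mu> \<in> free_inf_divisible_symmetric \<longleftrightarrow>
           (\<exists>\<sigma>\<in>free_regular. free_cumulant_extends \<mu> \<and>
              (\<forall>z\<in>- \<real>. free_cumulant_ext \<mu> z = free_cumulant_regular \<sigma> (z\<^sup>2)))) \<and>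
         (\<forall>\<sigma>\<in>free_regular. free_cumulant_extends \<mu> \<and>
              (\<forall>z\<in>- \<real>. free_cumulant_ext \<mu> z = free_cumulant_regular \<sigma> (z\<^sup>2)) \<longrightarrow>
            (\<exists>a b. free_triplet \<mu> a (free_levy_measure \<mu>) b) \<and>
            (\<exists>a b. free_triplet \<sigma> a (free_levy_measure \<sigma>) b) \<and>
            (\<forall>B\<in>sets borel. emeasure (free_levy_measure \<mu>) B =
               (1 / 2) * (emeasure (sqrt_image_pos (free_levy_measure \<sigma>)) B +
                          emeasure (sqrt_image_neg (free_levy_measure \<sigma>)) B)) \<and>
            free_levy_measure \<sigma> = scale_measure 2 (square_image_pos (free_levy_measure \<mu>)))"
proof (intro conjI iffI ballI impI)
  show "\<exists>\<sigma>\<in>free_regular. free_cumulant_extends \<mu> \<and>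
      (\<forall>z\<in>- \<real>. free_cumulant_ext \<mu> z = free_cumulant_regular \<sigma> (z\<^sup>2))"
    if "\<mu> \<in> free_inf_divisible_symmetric"
    by (rule symmetric_imp_regular[OF that])
  show "\<mu> \<in> free_inf_divisible_symmetric"
    if "\<exists>\<sigma>\<in>free_regular. free_cumulant_extends \<mu> \<and>
      (\<forall>z\<in>- \<real>. free_cumulant_ext \<mu> z = free_cumulant_regular \<sigma> (z\<^sup>2))"
    using that by (elim bexE conjE) (rule regular_imp_symmetric(1)[OF assms])
next
  fix \<sigma> assume \<sigma>: "\<sigma> \<in> free_regular"
    and h: "free_cumulant_extends \<mu> \<and> (\<forall>z\<in>- \<real>. free_cumulant_ext \<mu> z = free_cumulant_regular \<sigma> (z\<^sup>2))"
  have \<sigma>_rd: "real_distribution \<sigma>" using \<sigma> by (simp add: free_regular_def free_inf_divisible_def)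
  from regular_imp_symmetric(2)[OF assms \<sigma> conjunct1[OF h] conjunct2[OF h]]
  obtain \<nu> b a' b' where \<nu>: "positive_levy_measure \<nu>" and t\<sigma>: "free_triplet \<sigma> a' \<nu> b'"
    and t\<mu>: "free_triplet \<mu> b (positive_levy_measure.symmetric_levy \<nu>) 0" by (elim exE conjE)
  interpret positive_levy_measure \<nu> by fact
  note L\<sigma> = free_levy_measure_eq[OF \<sigma>_rd t\<sigma>] and L\<mu> = free_levy_measure_eq[OF assms t\<mu>]
  show "\<exists>a b. free_triplet \<mu> a (free_levy_measure \<mu>) b" unfolding L\<mu> using t\<mu> by (intro exI)
  show "\<exists>a b. free_triplet \<sigma> a (free_levy_measure \<sigma>) b" unfolding L\<sigma> using t\<sigma> by (intro exI)
  show "emeasure (free_levy_measure \<mu>) B = (1 / 2) * (emeasure (sqrt_image_pos (free_levy_measure \<sigma>)) B +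
      emeasure (sqrt_image_neg (free_levy_measure \<sigma>)) B)" if "B \<in> sets borel" for B
    unfolding L\<mu> L\<sigma> symmetric_levy_def by (rule emeasure_half_sum[OF that])
  show "free_levy_measure \<sigma> = scale_measure 2 (square_image_pos (free_levy_measure \<mu>))"
    unfolding L\<mu> L\<sigma> by (rule square_image_symmetric_levy[symmetric])
qed

end
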